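(* Let $A$ be a unital AF algebra endowed with a faithful tracial state $\mu$. Let $\mathcal{I}=(A_n,\alpha_n)_{n\in\mathbb{N}}$ be an inductive sequence of finite dimensional C*-algebras with C*-inductive limit $A$, with $A_0=\mathbb{C}$ and where $\alpha_n:A_n\to A_{n+1}$ is a unital injective *-morphism for all $n\in\mathbb{N}$. Let $\iota_n:A_n\to A$ be the canonical *-morphisms. For all $n\in\mathbb{N}$, let $E_n:A\to A$ be the unique conditional expectation of $A$ onto $\iota_n(A_n)$ such that $\mu\circ E_n=\mu$. Let $\beta:\mathbb{N}\to(0,\infty)$ have limit $0$ at infinity. For all $a\in\mathfrak{sa}(A)$, set $$L_{\mathcal{I},\mu}^\beta(a)=\sup\left\{\frac{\|a-E_n(a)\|_A}{\beta(n)}:n\in\mathbb{N}\right\}.$$ Then $(A,L_{\mathcal{I},\mu}^\beta)$ is a $(2,0)$-quasi-Leibniz quantum compact metric space. Moreover, for all $n\in\mathbb{N}$: $$\Lambda\left(\left(A_n,L_{\mathcal{I},\mu}^\beta\circ\iota_n\right),\left(A,L_{\mathcal{I},\mu}^\beta\right)\right)\leq\beta(n),$$ and thus $$\lim_{n\to\infty}\Lambda\left(\left(A_n,L_{\mathcal{I},\mu}^\beta\circ\iota_n\right),\left(A,L_{\mathcal{I},\mu}^\beta\right)\right)=0.$$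
   Context: $\mathbb{N}=\{0,1,2,\ldots\}$. For a unital C*-algebra $A$, $1_A$ is its unit, $\mathfrak{sa}(A)$ its self-adjoint part, $\mathscr{S}(A)$ its state space. A conditional expectation of $A$ onto a C*-subalgebra $B$ is a positive linear map $E:A\to B$ of norm $1$, onto $B$, with $E(bac)=bE(a)c$ for all $b,c\in B$, $a\in A$. A $(2,0)$-quasi-Leibniz quantum compact metric space is a pair $(A,L)$ of a unital C*-algebra $A$ and a seminorm $L$ defined on a dense Jordan-Lie subalgebra $\mathrm{dom}(L)$ of $\mathfrak{sa}(A)$ (and $L=\infty$ off $\mathrm{dom}(L)$; when $L$ is given by a formula with values in $[0,\infty]$, $\mathrm{dom}(L)=\{L<\infty\}$) such that: (1) $\{a\in\mathfrak{sa}(A):L(a)=0\}=\mathbb{R}1_A$; (2) $\max\{L(\frac{ab+ba}{2}),L(\frac{ab-ba}{2i})\}\leq 2(\|a\|_AL(b)+\|b\|_AL(a))$ for all $a,b\in\mathrm{dom}(L)$; (3) the Monge-Kantorovich metric $\mathsf{mk}_L(\varphi,\psi)=\sup\{|\varphi(a)-\psi(a)|:a\in\mathrm{dom}(L),L(a)\leq1\}$ metrizes the weak* topology of $\mathscr{S}(A)$; (4) $L$ is lower semi-continuous for $\|\cdot\|_A$. Quantum propinquity $\Lambda$. A bridge from $A$ to $B$ (unital C*-algebras) is $\gamma=(D,\pi_A,\pi_B,\omega)$ where $D$ is a unital C*-algebra, $\pi_A:A\to D$ and $\pi_B:B\to D$ are unital *-monomorphisms, and $\omega\in D$ is such that $\mathscr{S}_1(D|\omega)=\{\varphi\in\mathscr{S}(D):\varphi(1-\omega^*\omega)=\varphi(1-\omega\omega^*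 )=0\}\neq\emptyset$. Given $(A,L_A)$, $(B,L_B)$, the height of $\gamma$ is the maximum of the Hausdorff distance for $\mathsf{mk}_{L_A}$ between $\mathscr{S}(A)$ and $\{\varphi\circ\pi_A:\varphi\in\mathscr{S}_1(D|\omega)\}$ and the Hausdorff distance for $\mathsf{mk}_{L_B}$ between $\mathscr{S}(B)$ and $\{\varphi\circ\pi_B:\varphi\in\mathscr{S}_1(D|\omega)\}$. The reach of $\gamma$ is the Hausdorff distance between $\{a\in\mathfrak{sa}(A):L_A(a)\leq1\}$ and $\{b\in\mathfrak{sa}(B):L_B(b)\leq1\}$ when the distance between $a$ and $b$ is $\|\pi_A(a)\omega-\omega\pi_B(b)\|_D$. The length of $\gamma$ is the maximum of its height and reach. $\Lambda$ is the largest function from pairs of $(2,0)$-quasi-Leibniz quantum compact metric spaces to $[0,\infty)$ which is symmetric, satisfies the triangle inequality, and satisfies $\Lambda((A,L_A),(B,L_B))\leq$ the length of any bridge from $A$ to $B$. (It vanishes exactly when there is a *-isomorphism $\pi:A\to B$ with $L_B\circ\pi=L_A$.) *)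

theory Defs
  imports "HOL-Analysis.Analysis" "HOL-Algebra.Module"
begin

section \<open>Unital C*-algebras\<close>

record 'a cstar = "(complex, 'a) module" +
  star :: "'a \<Rightarrow> 'a"
  cnorm :: "'a \<Rightarrow> real"

text \<open>The C*-algebra of complex numbers. It also serves as the ring of scalars of all others.\<close>

definition complex_cstar :: "complex cstar" where
  "complex_cstar =
    \<lparr>carrier = UNIV, mult = (*), one = 1, zero = 0, add = (+), smult = (*), star = cnj, cnorm = cmod\<rparr>"

text \<open>The guard makes this a total symmetric function, as \<^locale>\<open>Metric_space\<close> requires.\<close>

definition cstar_dist :: "'a cstar \<Rightarrow> 'a \<Rightarrow> 'a \<Rightarrow> real" where
  "cstar_dist A x y =
    (if x \<in> carrier A \<and> y \<in> carrier A then cnorm A (x \<ominus>\<^bsub>A\<^esub> y) else 0)"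

definition norm_topology :: "'a cstar \<Rightarrow> 'a topology" where
  "norm_topology A = Metric_space.mtopology (carrier A) (cstar_dist A)"

text \<open>As usual for unital C*-algebras, the zero algebra is excluded.\<close>

locale cstar_algebra = Ring.ring A + Module.module complex_cstar A for A :: "'a cstar" (structure) +
  assumes one_not_zero: "\<one> \<noteq> \<zero>"
    and smult_mult_left:
      "\<lbrakk>x \<in> carrier A; y \<in> carrier A\<rbrakk> \<Longrightarrow> (c \<odot> x) \<otimes> y = c \<odot> (x \<otimes> y)"
    and smult_mult_right:
      "\<lbrakk>x \<in> carrier A; y \<in> carrier A\<rbrakk> \<Longrightarrow> x \<otimes> (c \<odot> y) = c \<odot> (x \<otimes> y)"
    and star_closed: "x \<in> carrier A \<Longrightarrow> star A x \<in> carrier A"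
    and star_star: "x \<in> carrier A \<Longrightarrow> star A (star A x) = x"
    and star_add:
      "\<lbrakk>x \<in> carrier A; y \<in> carrier A\<rbrakk> \<Longrightarrow> star A (x \<oplus> y) = star A x \<oplus> star A y"
    and star_smult: "x \<in> carrier A \<Longrightarrow> star A (c \<odot> x) = cnj c \<odot> star A x"
    and star_mult:
      "\<lbrakk>x \<in> carrier A; y \<in> carrier A\<rbrakk> \<Longrightarrow> star A (x \<otimes> y) = star A y \<otimes> star A x"
    and cnorm_nonneg: "x \<in> carrier A \<Longrightarrow> 0 \<le> cnorm A x"
    and cnorm_eq_zero_iff: "x \<in> carrier A \<Longrightarrow> cnorm A x = 0 \<longleftrightarrow> x = \<zero>"
    and cnorm_add:
      "\<lbrakk>x \<in> carrier A; y \<in> carrier A\<rbrakk> \<Longrightarrow> cnorm A (x \<oplus> y) \<le> cnorm A x + cnorm A y"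
    and cnorm_smult: "x \<in> carrier A \<Longrightarrow> cnorm A (c \<odot> x) = cmod c * cnorm A x"
    and cnorm_mult:
      "\<lbrakk>x \<in> carrier A; y \<in> carrier A\<rbrakk> \<Longrightarrow> cnorm A (x \<otimes> y) \<le> cnorm A x * cnorm A y"
    and cstar_identity: "x \<in> carrier A \<Longrightarrow> cnorm A (star A x \<otimes> x) = (cnorm A x)\<^sup>2"
    and complete: "Metric_space.mcomplete (carrier A) (cstar_dist A)"

definition self_adjoint :: "'a cstar \<Rightarrow> 'a set" where
  "self_adjoint A = {a \<in> carrier A. star A a = a}"

definition positive_elements :: "'a cstar \<Rightarrow> 'a set" where
  "positive_elements A = {star A b \<otimes>\<^bsub>A\<^esub> b | b. b \<in> carrier A}"

lemma cstar_dist_complex: "cstar_dist complex_cstar = dist"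
proof -
  have "cring complex_cstar"
    by unfold_locales (auto simp: complex_cstar_def Units_def algebra_simps intro: exI[of _ "- _"] add.right_inverse add.left_inverse)
  then interpret R: cring complex_cstar .
  have [simp]: "\<ominus>\<^bsub>complex_cstar\<^esub> y = - y" for y
    by (rule R.minus_equality) (auto simp: complex_cstar_def)
  show ?thesis
    by (intro ext) (auto simp: cstar_dist_def a_minus_def dist_norm, auto simp: complex_cstar_def)
qed

lemma cstar_algebra_complex: "cstar_algebra complex_cstar"
proof -
  have "cring complex_cstar"
    by unfold_locales (auto simp: complex_cstar_def Units_def algebra_simps intro: exI[of _ "- _"] add.right_inverse add.left_inverse)
  then interpret R: cring complex_cstar .
  have c: "Metric_space.mcomplete (carrier complex_cstar) (cstar_dist complex_cstar)"
    unfolding cstar_dist_complex using complete_UNIV by (simp add: complex_cstar_def)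
  show ?thesis
    by unfold_locales (use c in \<open>auto simp: complex_cstar_def algebra_simps norm_mult norm_triangle_ineq power2_eq_square\<close>)
qed

lemma positive_elements_complex: "positive_elements complex_cstar = {z. z \<in> \<real> \<and> 0 \<le> Re z}"
proof -
  have "z \<in> \<real> \<Longrightarrow> 0 \<le> Re z \<Longrightarrow> \<exists>b. z = cnj b * b" for z
    by (rule exI[of _ "complex_of_real (sqrt (Re z))"]) (auto simp: complex_eq_iff complex_is_Real_iff)
  then show ?thesis by (auto simp: positive_elements_def complex_cstar_def complex_is_Real_iff)
qed

definition finite_dimensional :: "'a cstar \<Rightarrow> bool" where
  "finite_dimensional A \<longleftrightarrow>
    (\<exists>S. finite S \<and> S \<subseteq> carrier A \<and>
      (\<forall>x\<in>carrier A. \<exists>c :: 'a \<Rightarrow> complex. x = (\<Oplus>\<^bsub>A\<^esub>s\<in>S. c s \<odot>\<^bsub>A\<^esub> s)))"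

definition cstar_subalgebra :: "'a cstar \<Rightarrow> 'a set \<Rightarrow> bool" where
  "cstar_subalgebra A B \<longleftrightarrow>
    B \<noteq> {} \<and> B \<subseteq> carrier A \<and>
    (\<forall>x\<in>B. \<forall>y\<in>B. x \<oplus>\<^bsub>A\<^esub> y \<in> B \<and> x \<otimes>\<^bsub>A\<^esub> y \<in> B) \<and>
    (\<forall>x\<in>B. \<forall>c. c \<odot>\<^bsub>A\<^esub> x \<in> B) \<and>
    (\<forall>x\<in>B. star A x \<in> B) \<and>
    closedin (norm_topology A) B"


section \<open>Maps between C*-algebras\<close>

definition linear_map :: "'a cstar \<Rightarrow> 'b cstar \<Rightarrow> ('a \<Rightarrow> 'b) \<Rightarrow> bool" where
  "linear_map A B f \<longleftrightarrow>
    f \<in> carrier A \<rightarrow> carrier B \<and>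
    (\<forall>x\<in>carrier A. \<forall>y\<in>carrier A. f (x \<oplus>\<^bsub>A\<^esub> y) = f x \<oplus>\<^bsub>B\<^esub> f y) \<and>
    (\<forall>c. \<forall>x\<in>carrier A. f (c \<odot>\<^bsub>A\<^esub> x) = c \<odot>\<^bsub>B\<^esub> f x)"

definition positive_map :: "'a cstar \<Rightarrow> 'b cstar \<Rightarrow> ('a \<Rightarrow> 'b) \<Rightarrow> bool" where
  "positive_map A B f \<longleftrightarrow> linear_map A B f \<and> f ` positive_elements A \<subseteq> positive_elements B"

definition map_norm :: "'a cstar \<Rightarrow> 'b cstar \<Rightarrow> ('a \<Rightarrow> 'b) \<Rightarrow> ennreal" where
  "map_norm A B f = (SUP a \<in> {a \<in> carrier A. cnorm A a \<le> 1}. ennreal (cnorm B (f a)))"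

text \<open>Unital *-morphisms, since elements of \<^const>\<open>ring_hom\<close> preserve the unit.\<close>

definition star_hom :: "'a cstar \<Rightarrow> 'b cstar \<Rightarrow> ('a \<Rightarrow> 'b) \<Rightarrow> bool" where
  "star_hom A B f \<longleftrightarrow>
    f \<in> ring_hom A B \<and> linear_map A B f \<and> (\<forall>x\<in>carrier A. f (star A x) = star B (f x))"

definition star_mono :: "'a cstar \<Rightarrow> 'b cstar \<Rightarrow> ('a \<Rightarrow> 'b) \<Rightarrow> bool" where
  "star_mono A B f \<longleftrightarrow> star_hom A B f \<and> inj_on f (carrier A)"

definition star_isomorphic :: "'a cstar \<Rightarrow> 'b cstar \<Rightarrow> bool" where
  "star_isomorphic A B \<longleftrightarrow> (\<exists>f. star_hom A B f \<and> bij_betw f (carrier A) (carrier B))"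

definition conditional_expectation :: "'a cstar \<Rightarrow> 'a set \<Rightarrow> ('a \<Rightarrow> 'a) \<Rightarrow> bool" where
  "conditional_expectation A B E \<longleftrightarrow>
    cstar_subalgebra A B \<and> positive_map A A E \<and> map_norm A A E = 1 \<and> E ` carrier A = B \<and>
    (\<forall>b\<in>B. \<forall>c\<in>B. \<forall>a\<in>carrier A.
      E (b \<otimes>\<^bsub>A\<^esub> a \<otimes>\<^bsub>A\<^esub> c) = b \<otimes>\<^bsub>A\<^esub> E a \<otimes>\<^bsub>A\<^esub> c)"


section \<open>States\<close>

text \<open>States are extensional functions, so that two states agreeing on the carrier are equal.\<close>

definition states :: "'a cstar \<Rightarrow> ('a \<Rightarrow> complex) set" where
  "states A = {\<phi> \<in> extensional (carrier A).
    positive_map A complex_cstar \<phi> \<and> map_norm A complex_cstar \<phi> = 1}"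

text \<open>The weak* topology is that of pointwise convergence on the carrier.\<close>

definition weak_star_topology :: "'a cstar \<Rightarrow> ('a \<Rightarrow> complex) topology" where
  "weak_star_topology A =
    subtopology (product_topology (\<lambda>_. euclidean) (carrier A)) (states A)"

definition faithful_tracial_state :: "'a cstar \<Rightarrow> ('a \<Rightarrow> complex) \<Rightarrow> bool" where
  "faithful_tracial_state A \<mu> \<longleftrightarrow>
    \<mu> \<in> states A \<and>
    (\<forall>a\<in>carrier A. \<forall>b\<in>carrier A. \<mu> (a \<otimes>\<^bsub>A\<^esub> b) = \<mu> (b \<otimes>\<^bsub>A\<^esub> a)) \<and>
    (\<forall>a\<in>carrier A. \<mu> (star A a \<otimes>\<^bsub>A\<^esub> a) = 0 \<longrightarrow> a = \<zero>\<^bsub>A\<^esub>)"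


section \<open>Inductive limits\<close>

fun connecting_map :: "(nat \<Rightarrow> 'a \<Rightarrow> 'a) \<Rightarrow> nat \<Rightarrow> nat \<Rightarrow> 'a \<Rightarrow> 'a" where
  "connecting_map \<alpha> n 0 x = x"
| "connecting_map \<alpha> n (Suc k) x = \<alpha> (n + k) (connecting_map \<alpha> n k x)"

text \<open>
  The C*-inductive limit of a sequence of C*-algebras and unital *-morphisms is the
  Hausdorff completion of the algebraic inductive limit for the C*-seminorm that maps the class of
  an element to the limit of the norms of its images. The following says that the algebra \<open>A\<close>,
  together with the canonical *-morphisms \<open>\<iota> n\<close>, is such a completion.
\<close>

definition cstar_inductive_limit ::
  "(nat \<Rightarrow> 'a cstar) \<Rightarrow> (nat \<Rightarrow> 'a \<Rightarrow> 'a) \<Rightarrow> 'a cstar \<Rightarrow> (nat \<Rightarrow> 'a \<Rightarrow> 'a) \<Rightarrow> bool"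
where
  "cstar_inductive_limit F \<alpha> A \<iota> \<longleftrightarrow>
    cstar_algebra A \<and>
    (\<forall>n. star_hom (F n) A (\<iota> n)) \<and>
    (\<forall>n. \<forall>x\<in>carrier (F n). \<iota> (Suc n) (\<alpha> n x) = \<iota> n x) \<and>
    (\<forall>n. \<forall>x\<in>carrier (F n).
      (\<lambda>k. cnorm (F (n + k)) (connecting_map \<alpha> n k x)) \<longlonglongrightarrow> cnorm A (\<iota> n x)) \<and>
    norm_topology A closure_of (\<Union>n. \<iota> n ` carrier (F n)) = carrier A"


section \<open>Quasi-Leibniz quantum compact metric spaces\<close>

text \<open>Only the values of \<open>L\<close> on self-adjoint elements are ever used.\<close>

definition lip_dom :: "'a cstar \<Rightarrow> ('a \<Rightarrow> ennreal) \<Rightarrow> 'a set" where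
  "lip_dom A L = {a \<in> self_adjoint A. L a < \<infinity>}"

definition lip_ball :: "'a cstar \<Rightarrow> ('a \<Rightarrow> ennreal) \<Rightarrow> 'a set" where
  "lip_ball A L = {a \<in> self_adjoint A. L a \<le> 1}"

definition jordan_product :: "'a cstar \<Rightarrow> 'a \<Rightarrow> 'a \<Rightarrow> 'a" where
  "jordan_product A a b = (1 / 2) \<odot>\<^bsub>A\<^esub> (a \<otimes>\<^bsub>A\<^esub> b \<oplus>\<^bsub>A\<^esub> b \<otimes>\<^bsub>A\<^esub> a)"

definition lie_product :: "'a cstar \<Rightarrow> 'a \<Rightarrow> 'a \<Rightarrow> 'a" where
  "lie_product A a b = (1 / (2 * \<i>)) \<odot>\<^bsub>A\<^esub> (a \<otimes>\<^bsub>A\<^esub> b \<ominus>\<^bsub>A\<^esub> b \<otimes>\<^bsub>A\<^esub> a)"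

definition jordan_lie_subalgebra :: "'a cstar \<Rightarrow> 'a set \<Rightarrow> bool" where
  "jordan_lie_subalgebra A J \<longleftrightarrow>
    J \<noteq> {} \<and> J \<subseteq> self_adjoint A \<and>
    (\<forall>a\<in>J. \<forall>b\<in>J. a \<oplus>\<^bsub>A\<^esub> b \<in> J \<and> jordan_product A a b \<in> J \<and> lie_product A a b \<in> J) \<and>
    (\<forall>a\<in>J. \<forall>t::real. complex_of_real t \<odot>\<^bsub>A\<^esub> a \<in> J)"

definition mk_dist ::
  "'a cstar \<Rightarrow> ('a \<Rightarrow> ennreal) \<Rightarrow> ('a \<Rightarrow> complex) \<Rightarrow> ('a \<Rightarrow> complex) \<Rightarrow> ennreal"
where
  "mk_dist A L \<phi> \<psi> = (SUP a \<in> lip_ball A L. ennreal (cmod (\<phi> a - \<psi> a)))"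

definition quantum_compact_metric_space :: "'a cstar \<Rightarrow> ('a \<Rightarrow> ennreal) \<Rightarrow> bool" where
  "quantum_compact_metric_space A L \<longleftrightarrow>
    cstar_algebra A \<and>
    \<comment> \<open>a seminorm on a dense Jordan-Lie subalgebra\<close>
    jordan_lie_subalgebra A (lip_dom A L) \<and>
    self_adjoint A \<subseteq> norm_topology A closure_of lip_dom A L \<and>
    (\<forall>a\<in>lip_dom A L. \<forall>b\<in>lip_dom A L. L (a \<oplus>\<^bsub>A\<^esub> b) \<le> L a + L b) \<and>
    (\<forall>a\<in>lip_dom A L. \<forall>t::real. L (complex_of_real t \<odot>\<^bsub>A\<^esub> a) = ennreal \<bar>t\<bar> * L a) \<and>
    \<comment> \<open>vanishing exactly on the scalars\<close>
    {a \<in> self_adjoint A. L a = 0} = range (\<lambda>t::real. complex_of_real t \<odot>\<^bsub>A\<^esub> \<one>\<^bsub>A\<^esub>) \<and>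
    \<comment> \<open>the (2,0)-quasi-Leibniz inequality\<close>
    (\<forall>a\<in>lip_dom A L. \<forall>b\<in>lip_dom A L.
      max (L (jordan_product A a b)) (L (lie_product A a b))
        \<le> 2 * (ennreal (cnorm A a) * L b + ennreal (cnorm A b) * L a)) \<and>
    \<comment> \<open>the Monge-Kantorovich metric metrizes the weak* topology\<close>
    (\<forall>\<phi>\<in>states A. \<forall>\<psi>\<in>states A. mk_dist A L \<phi> \<psi> < \<infinity>) \<and>
    Metric_space (states A) (\<lambda>\<phi> \<psi>. enn2real (mk_dist A L \<phi> \<psi>)) \<and>
    Metric_space.mtopology (states A) (\<lambda>\<phi> \<psi>. enn2real (mk_dist A L \<phi> \<psi>))
      = weak_star_topology A \<and>
    \<comment> \<open>lower semi-continuity\<close>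
    (\<forall>r. closedin (subtopology (norm_topology A) (self_adjoint A)) {a \<in> self_adjoint A. L a \<le> r})"


section \<open>The quantum propinquity\<close>

text \<open>
  The function \<open>d\<close> is allowed to relate two different types because the reach of a bridge compares
  elements of two different algebras.
\<close>

definition hausdorff_distance :: "('a \<Rightarrow> 'b \<Rightarrow> ennreal) \<Rightarrow> 'a set \<Rightarrow> 'b set \<Rightarrow> ennreal" where
  "hausdorff_distance d S T = max (SUP s\<in>S. INF t\<in>T. d s t) (SUP t\<in>T. INF s\<in>S. d s t)"

definition one_level_states :: "'a cstar \<Rightarrow> 'a \<Rightarrow> ('a \<Rightarrow> complex) set" where
  "one_level_states D \<omega> = {\<phi> \<in> states D.
    \<phi> (\<one>\<^bsub>D\<^esub> \<ominus>\<^bsub>D\<^esub> star D \<omega> \<otimes>\<^bsub>D\<^esub> \<omega>) = 0 \<and>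
    \<phi> (\<one>\<^bsub>D\<^esub> \<ominus>\<^bsub>D\<^esub> \<omega> \<otimes>\<^bsub>D\<^esub> star D \<omega>) = 0}"

definition bridge ::
  "'a cstar \<Rightarrow> 'b cstar \<Rightarrow> 'd cstar \<Rightarrow> ('a \<Rightarrow> 'd) \<Rightarrow> ('b \<Rightarrow> 'd) \<Rightarrow> 'd \<Rightarrow> bool"
where
  "bridge A B D \<pi>\<^sub>A \<pi>\<^sub>B \<omega> \<longleftrightarrow>
    cstar_algebra D \<and> star_mono A D \<pi>\<^sub>A \<and> star_mono B D \<pi>\<^sub>B \<and>
    \<omega> \<in> carrier D \<and> one_level_states D \<omega> \<noteq> {}"

text \<open>\<^const>\<open>compose\<close> restricts \<open>\<phi> \<circ> \<pi>\<close> to the carrier, making it an element of \<^const>\<open>states\<close>.\<close>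

definition bridge_height ::
  "'a cstar \<Rightarrow> ('a \<Rightarrow> ennreal) \<Rightarrow> 'b cstar \<Rightarrow> ('b \<Rightarrow> ennreal) \<Rightarrow>
    'd cstar \<Rightarrow> ('a \<Rightarrow> 'd) \<Rightarrow> ('b \<Rightarrow> 'd) \<Rightarrow> 'd \<Rightarrow> ennreal"
where
  "bridge_height A L\<^sub>A B L\<^sub>B D \<pi>\<^sub>A \<pi>\<^sub>B \<omega> = max
    (hausdorff_distance (mk_dist A L\<^sub>A) (states A)
      ((\<lambda>\<phi>. compose (carrier A) \<phi> \<pi>\<^sub>A) ` one_level_states D \<omega>))
    (hausdorff_distance (mk_dist B L\<^sub>B) (states B)
      ((\<lambda>\<phi>. compose (carrier B) \<phi> \<pi>\<^sub>B) ` one_level_states D \<omega>))"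

definition bridge_reach ::
  "'a cstar \<Rightarrow> ('a \<Rightarrow> ennreal) \<Rightarrow> 'b cstar \<Rightarrow> ('b \<Rightarrow> ennreal) \<Rightarrow>
    'd cstar \<Rightarrow> ('a \<Rightarrow> 'd) \<Rightarrow> ('b \<Rightarrow> 'd) \<Rightarrow> 'd \<Rightarrow> ennreal"
where
  "bridge_reach A L\<^sub>A B L\<^sub>B D \<pi>\<^sub>A \<pi>\<^sub>B \<omega> =
    hausdorff_distance
      (\<lambda>a b. ennreal (cnorm D (\<pi>\<^sub>A a \<otimes>\<^bsub>D\<^esub> \<omega> \<ominus>\<^bsub>D\<^esub> \<omega> \<otimes>\<^bsub>D\<^esub> \<pi>\<^sub>B b)))
      (lip_ball A L\<^sub>A) (lip_ball B L\<^sub>B)"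

definition bridge_length ::
  "'a cstar \<Rightarrow> ('a \<Rightarrow> ennreal) \<Rightarrow> 'b cstar \<Rightarrow> ('b \<Rightarrow> ennreal) \<Rightarrow>
    'd cstar \<Rightarrow> ('a \<Rightarrow> 'd) \<Rightarrow> ('b \<Rightarrow> 'd) \<Rightarrow> 'd \<Rightarrow> ennreal"
where
  "bridge_length A L\<^sub>A B L\<^sub>B D \<pi>\<^sub>A \<pi>\<^sub>B \<omega> =
    max (bridge_height A L\<^sub>A B L\<^sub>B D \<pi>\<^sub>A \<pi>\<^sub>B \<omega>) (bridge_reach A L\<^sub>A B L\<^sub>B D \<pi>\<^sub>A \<pi>\<^sub>B \<omega>)"

text \<open>
  HOL has no quantification over types, so all spaces and all bridge algebras have their carriers in
  one arbitrary type \<open>'u\<close>. This loses no generality. Quantum compact metric spaces are separable,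
  and replacing the algebra \<open>D\<close> of a bridge by the separable C*-subalgebra generated by the images
  of the two spaces and \<open>\<omega>\<close> does not change its length, because states extend. So only algebras of
  the cardinality of the continuum matter, and any type that carries a C*-algebra at all carries an
  isomorphic copy of each of them.
\<close>

type_synonym 'u metrized = "'u cstar \<times> ('u \<Rightarrow> ennreal)"

definition qcms :: "'u metrized set" where
  "qcms = {(A, L). quantum_compact_metric_space A L}"

definition below_bridge_lengths :: "('u metrized \<Rightarrow> 'u metrized \<Rightarrow> real) \<Rightarrow> bool" where
  "below_bridge_lengths d \<longleftrightarrow>
    (\<forall>X\<in>qcms. \<forall>Y\<in>qcms. 0 \<le> d X Y) \<and>
    (\<forall>X\<in>qcms. \<forall>Y\<in>qcms. d X Y = d Y X) \<and>
    (\<forall>X\<in>qcms. \<forall>Y\<in>qcms. \<forall>Z\<in>qcms. d X Z \<le> d X Y + d Y Z) \<and>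
    (\<forall>(A, L\<^sub>A)\<in>qcms. \<forall>(B, L\<^sub>B)\<in>qcms. \<forall>(D :: 'u cstar) \<pi>\<^sub>A \<pi>\<^sub>B \<omega>.
      bridge A B D \<pi>\<^sub>A \<pi>\<^sub>B \<omega> \<longrightarrow>
        ennreal (d (A, L\<^sub>A) (B, L\<^sub>B)) \<le> bridge_length A L\<^sub>A B L\<^sub>B D \<pi>\<^sub>A \<pi>\<^sub>B \<omega>)"

text \<open>
  The pointwise supremum of these functions again satisfies all the conditions, hence is the
  largest one. It is formed in \<^typ>\<open>ennreal\<close> because a supremum in \<^typ>\<open>real\<close> would be
  unspecified for an unbounded set. Outside \<^const>\<open>qcms\<close> it is infinite.
\<close>

definition propinquity :: "'u metrized \<Rightarrow> 'u metrized \<Rightarrow> ennreal" where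
  "propinquity X Y = (SUP d \<in> Collect below_bridge_lengths. ennreal (d X Y))"

lemma propinquity_sym:
  assumes "X \<in> qcms" "Y \<in> qcms"
  shows "propinquity X Y = propinquity Y X"
  unfolding propinquity_def using assms by (intro SUP_cong refl) (auto simp: below_bridge_lengths_def)

lemma propinquity_triangle:
  assumes "X \<in> qcms" "Y \<in> qcms" "Z \<in> qcms"
  shows "propinquity X Z \<le> propinquity X Y + propinquity Y Z"
  unfolding propinquity_def
proof (rule SUP_least)
  fix d :: "'a metrized \<Rightarrow> 'a metrized \<Rightarrow> real" assume d: "d \<in> Collect below_bridge_lengths"
  have "ennreal (d X Z) \<le> ennreal (d X Y) + ennreal (d Y Z)"
  proof -
    have nn: "0 \<le> d X Y" "0 \<le> d Y Z" and le: "d X Z \<le> d X Y + d Y Z"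
      using d assms unfolding below_bridge_lengths_def by blast+
    show ?thesis
      unfolding ennreal_plus[OF nn, symmetric] using le by (rule ennreal_leI)
  qed
  also have "\<dots> \<le> (SUP d \<in> Collect below_bridge_lengths. ennreal (d X Y)) + (SUP d \<in> Collect below_bridge_lengths. ennreal (d Y Z))"
    using d by (intro add_mono SUP_upper2[OF d] order_refl)
  finally show "ennreal (d X Z) \<le> \<dots>" .
qed

lemma propinquity_le_bridge_length:
  fixes A B D :: "'u cstar"
  assumes "(A,L) \<in> qcms" "(B,M) \<in> qcms" "bridge A B (D::'u cstar) p q w"
  shows "propinquity (A,L) (B,M) \<le> bridge_length A L B M D p q w"
  unfolding propinquity_def
proof (rule SUP_least)
  fix d :: "'u metrized \<Rightarrow> 'u metrized \<Rightarrow> real" assume "d \<in> Collect below_bridge_lengths"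
  then show "ennreal (d (A,L) (B,M)) \<le> bridge_length A L B M D p q w"
    using assms unfolding below_bridge_lengths_def by blast
qed


section \<open>The Lip-norm of an inductive sequence\<close>

definition lip_norm ::
  "'a cstar \<Rightarrow> (nat \<Rightarrow> 'a \<Rightarrow> 'a) \<Rightarrow> (nat \<Rightarrow> real) \<Rightarrow> 'a \<Rightarrow> ennreal"
where
  "lip_norm A E \<beta> a = (SUP n. ennreal (cnorm A (a \<ominus>\<^bsub>A\<^esub> E n a) / \<beta> n))"

end

theory Submission
  imports Defs
begin

text \<open>
  The space \<open>(A, L)\<close>. Each \<open>E\<^sub>n\<close> is a contractive projection onto the subalgebra \<open>\<iota>\<^sub>n(F\<^sub>n)\<close>, so \<open>ab\<close>
  and \<open>E\<^sub>n(ab)\<close> are both within \<open>\<parallel>ab - E\<^sub>n(a)E\<^sub>n(b)\<parallel>\<close> of \<open>E\<^sub>n(a)E\<^sub>n(b)\<close>; this gives the Leibniz inequality with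
  factor 2. On \<open>\<iota>\<^sub>n(F\<^sub>n)\<close> only finitely many terms of the supremum are nonzero, so the
  Lip-norm is finite on a dense set, and it vanishes exactly on the range \<open>\<complex>1\<close> of \<open>E\<^sub>0\<close> because
  \<open>F\<^sub>0 = \<complex>\<close>. For the metric: if \<open>L(a) \<le> 1\<close> then \<open>a\<close> is within \<open>\<beta>(n)\<close> of \<open>E\<^sub>n(a)\<close>, and modulo
  scalars, on which states agree, \<open>E\<^sub>n(a)\<close> lies in a ball of a finite-dimensional space. As
  \<open>\<beta>(n) \<rightarrow> 0\<close>, the Monge-Kantorovich metric is controlled by finitely many evaluations up to any
  given error, hence weak* continuous; conversely it controls every evaluation up to a small error,
  because the domain of \<open>L\<close> is dense. These arguments are carried out in the locale
  \<open>finite_rank_tower\<close>, which speaks of the maps \<open>E\<^sub>n\<close> only and therefore applies verbatim to each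
  \<open>(F\<^sub>n, L \<circ> \<iota>\<^sub>n)\<close>, with the maps that the \<open>E\<^sub>m\<close> induce there.

  The propinquity. The bridge from \<open>F\<^sub>n\<close> to \<open>A\<close> is \<open>(A, \<iota>\<^sub>n, id, 1)\<close>. All states of \<open>A\<close> belong to its
  1-level set. Its height is 0 because every state of \<open>F\<^sub>n\<close> extends to \<open>A\<close> by composition with \<open>E\<^sub>n\<close>.
  Its reach is at most \<open>\<beta>(n)\<close> because \<open>E\<^sub>n\<close> maps the Lip-ball of \<open>A\<close> into that of \<open>F\<^sub>n\<close> and moves its
  elements by at most \<open>\<beta>(n)\<close>. The former uses \<open>E\<^sub>m E\<^sub>n = E\<^sub>n E\<^sub>m = E\<^sub>m\<close> for \<open>m \<le> n\<close>, which follows from the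
  invariance of \<open>\<mu>\<close>.

  Two facts of C*-algebra theory are needed, and both are proved in finite dimensions without
  spectral theory, by the same device: all norms on a finite-dimensional space are equivalent, and
  \<open>\<parallel>h\<^sup>m\<parallel> = \<parallel>h\<parallel>\<^sup>m\<close> for self-adjoint \<open>h\<close> and \<open>m = 2\<^sup>k\<close>, so that constants disappear on taking
  \<open>m\<close>-th roots. One fact is that the injective morphisms \<open>\<alpha>\<^sub>n\<close>, hence the \<open>\<iota>\<^sub>n\<close>, are isometric
  (\<open>star_mono_isometric\<close>). The other is that \<open>\<parallel>1 - c\<^sup>*c\<parallel> \<le> 1\<close> if \<open>\<parallel>c\<parallel> \<le> 1\<close> and \<open>c\<^sup>*c \<in> \<iota>\<^sub>n(F\<^sub>n)\<close>
  (\<open>cnorm_one_minus_square_le_1\<close>), which yields positivity of the extended states. There the second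
  norm is the Hilbert space norm of the faithful trace.
\<close>

section \<open>Calculating in C*-algebras\<close>

lemma complex_cstar_simps [simp]:
  "carrier complex_cstar = UNIV" "x \<otimes>\<^bsub>complex_cstar\<^esub> y = x * y" "x \<oplus>\<^bsub>complex_cstar\<^esub> y = x + y"
  "\<one>\<^bsub>complex_cstar\<^esub> = 1" "\<zero>\<^bsub>complex_cstar\<^esub> = 0" "c \<odot>\<^bsub>complex_cstar\<^esub> x = c * x"
  "star complex_cstar x = cnj x" "cnorm complex_cstar x = cmod x"
  by (simp_all add: complex_cstar_def)

locale complex_module = Module.module complex_cstar A for A :: "'a cstar" (structure)
begin

lemma add_in_carrier: "\<lbrakk>x \<in> carrier A; y \<in> carrier A\<rbrakk> \<Longrightarrow> x \<oplus> y \<in> carrier A"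
  by simp

lemma minus_in_carrier: "\<lbrakk>x \<in> carrier A; y \<in> carrier A\<rbrakk> \<Longrightarrow> x \<ominus> y \<in> carrier A"
  by simp

lemma smult_add_left: "x \<in> carrier A \<Longrightarrow> (a + b) \<odot> x = a \<odot> x \<oplus> b \<odot> x"
  using smult_l_distr[of a b x] by simp

lemma smult_add_right: "\<lbrakk>x \<in> carrier A; y \<in> carrier A\<rbrakk> \<Longrightarrow> c \<odot> (x \<oplus> y) = c \<odot> x \<oplus> c \<odot> y"
  using smult_r_distr[of c x y] by simp

lemma smult_smult: "x \<in> carrier A \<Longrightarrow> a \<odot> (b \<odot> x) = (a * b) \<odot> x"
  using smult_assoc1[of a b x] by simp

lemma one_smult [simp]: "x \<in> carrier A \<Longrightarrow> 1 \<odot> x = x"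
  using smult_one[of x] by simp

lemma zero_smult [simp]: "x \<in> carrier A \<Longrightarrow> 0 \<odot> x = \<zero>"
  using smult_l_null[of x] by simp

lemma smult_zero [simp]: "c \<odot> \<zero> = \<zero>"
  using smult_r_null[of c] by simp

lemma uminus_eq_smult: "x \<in> carrier A \<Longrightarrow> \<ominus> x = (- 1) \<odot> x"
  by (rule M.minus_equality) (auto simp: smult_add_left[symmetric] simp del: one_smult
      intro: trans[OF arg_cong2[where f = "(\<oplus>)", OF refl one_smult[symmetric]]])

lemma minus_eq_add_smult: "\<lbrakk>x \<in> carrier A; y \<in> carrier A\<rbrakk> \<Longrightarrow> x \<ominus> y = x \<oplus> (- 1) \<odot> y"
  by (simp add: M.minus_eq uminus_eq_smult)

lemma smult_cancel:
  assumes "x \<in> carrier A"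
  shows "x \<oplus> (- 1) \<odot> x = \<zero>" "(- 1) \<odot> x \<oplus> x = \<zero>"
    "y \<in> carrier A \<Longrightarrow> x \<oplus> ((- 1) \<odot> x \<oplus> y) = y" "y \<in> carrier A \<Longrightarrow> (- 1) \<odot> x \<oplus> (x \<oplus> y) = y"
proof -
  show *: "x \<oplus> (- 1) \<odot> x = \<zero>"
    using assms M.r_neg[of x] by (simp add: uminus_eq_smult)
  then show **: "(- 1) \<odot> x \<oplus> x = \<zero>"
    using assms by (simp add: M.a_comm)
  show "y \<in> carrier A \<Longrightarrow> x \<oplus> ((- 1) \<odot> x \<oplus> y) = y" "y \<in> carrier A \<Longrightarrow> (- 1) \<odot> x \<oplus> (x \<oplus> y) = y"
    using assms * ** by (simp_all add: M.a_assoc[symmetric])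
qed

text \<open>
  Subtraction is expressed through scalar multiplication, so that differences of sums of monomials
  normalize by associativity, commutativity and cancellation of adjacent terms.
\<close>

lemmas module_simps = minus_eq_add_smult uminus_eq_smult smult_add_right smult_smult
  M.a_assoc M.a_comm M.a_lcomm smult_cancel

lemma minus_eq_zero_iff: "\<lbrakk>x \<in> carrier A; y \<in> carrier A\<rbrakk> \<Longrightarrow> x \<ominus> y = \<zero> \<longleftrightarrow> x = y"
  by (metis M.minus_eq M.r_neg M.minus_equality M.minus_minus M.a_inv_closed)

end

context cstar_algebra
begin

sublocale complex_module A ..

lemma semiring: "Ring.semiring A"
  by unfold_locales

lemma monoid_mult: "Group.monoid A"
  by unfold_locales

lemma mult_closed [simp]: "\<lbrakk>x \<in> carrier A; y \<in> carrier A\<rbrakk> \<Longrightarrow> x \<otimes> y \<in> carrier A"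
  by (rule monoid.m_closed[OF monoid_mult])

lemma mult_assoc: "\<lbrakk>x \<in> carrier A; y \<in> carrier A; z \<in> carrier A\<rbrakk> \<Longrightarrow> x \<otimes> y \<otimes> z = x \<otimes> (y \<otimes> z)"
  by (rule monoid.m_assoc[OF monoid_mult])

lemma one_carrier [simp]: "\<one> \<in> carrier A"
  by (rule monoid.one_closed[OF monoid_mult])

lemma mult_one [simp]: "x \<in> carrier A \<Longrightarrow> x \<otimes> \<one> = x" "x \<in> carrier A \<Longrightarrow> \<one> \<otimes> x = x"
  by (simp_all add: monoid.r_one[OF monoid_mult] monoid.l_one[OF monoid_mult])

lemma ring_l_distr: "\<lbrakk>x \<in> carrier A; y \<in> carrier A; z \<in> carrier A\<rbrakk> \<Longrightarrow> (x \<oplus> y) \<otimes> z = x \<otimes> z \<oplus> y \<otimes> z"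
  by (rule Ring.semiring.l_distr[OF semiring])

lemma ring_r_distr: "\<lbrakk>x \<in> carrier A; y \<in> carrier A; z \<in> carrier A\<rbrakk> \<Longrightarrow> z \<otimes> (x \<oplus> y) = z \<otimes> x \<oplus> z \<otimes> y"
  by (rule Ring.semiring.r_distr[OF semiring])

lemma zero_mult [simp]: "x \<in> carrier A \<Longrightarrow> \<zero> \<otimes> x = \<zero>"
  using smult_mult_left[of \<one> x 0] by simp

declare star_closed [simp] star_star [simp]

lemma star_one [simp]: "star A \<one> = \<one>"
  by (metis star_star star_closed one_carrier mult_one star_mult)

lemma star_zero [simp]: "star A \<zero> = \<zero>"
  using star_smult[of \<one> 0] by simp

lemmas cstar_simps = module_simps mult_assoc ring_r_distr ring_l_distr smult_mult_left
  smult_mult_right star_add star_smult star_mult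

lemma cnorm_zero [simp]: "cnorm A \<zero> = 0"
  using cnorm_eq_zero_iff[of \<zero>] by simp

lemma cnorm_minus: "\<lbrakk>x \<in> carrier A; y \<in> carrier A\<rbrakk> \<Longrightarrow> cnorm A (x \<ominus> y) \<le> cnorm A x + cnorm A y"
  using cnorm_add[of x "(-1) \<odot> y"] by (simp add: minus_eq_add_smult cnorm_smult)

lemma cnorm_minus_commute: "\<lbrakk>x \<in> carrier A; y \<in> carrier A\<rbrakk> \<Longrightarrow> cnorm A (x \<ominus> y) = cnorm A (y \<ominus> x)"
  using cnorm_smult[of "x \<ominus> y" "-1"] by (simp add: cstar_simps)

lemma cnorm_triangle:
  assumes "x \<in> carrier A" "y \<in> carrier A" "z \<in> carrier A"
  shows "cnorm A (x \<ominus> z) \<le> cnorm A (x \<ominus> y) + cnorm A (y \<ominus> z)"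
proof -
  have "x \<ominus> z = (x \<ominus> y) \<oplus> (y \<ominus> z)" using assms by (simp add: cstar_simps)
  then show ?thesis using assms cnorm_add[of "x \<ominus> y" "y \<ominus> z"] by simp
qed

lemma cnorm_one [simp]: "cnorm A \<one> = 1"
proof -
  have "cnorm A \<one> = (cnorm A \<one>)\<^sup>2" using cstar_identity[of \<one>] by simp
  moreover have "cnorm A \<one> \<noteq> 0" using cnorm_eq_zero_iff[of \<one>] one_not_zero by simp
  ultimately show ?thesis by (simp add: power2_eq_square)
qed

lemma cnorm_star [simp]:
  assumes "x \<in> carrier A" shows "cnorm A (star A x) = cnorm A x"
proof -
  have le: "cnorm A y \<le> cnorm A (star A y)" if "y \<in> carrier A" for y
  proof (cases "cnorm A y = 0")
    case True then show ?thesis using cnorm_nonneg[of "star A y"] that by simp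
  next
    case False
    have "cnorm A y * cnorm A y \<le> cnorm A (star A y) * cnorm A y"
      using cstar_identity[of y] cnorm_mult[of "star A y" y] that by (simp add: power2_eq_square)
    then show ?thesis using False cnorm_nonneg[of y] that by simp
  qed
  show ?thesis using le[of x] le[of "star A x"] assms by simp
qed

lemma Metric_space_cstar_dist: "Metric_space (carrier A) (cstar_dist A)"
  by unfold_locales (auto simp: cstar_dist_def cnorm_nonneg cnorm_minus_commute cnorm_triangle cnorm_eq_zero_iff minus_eq_zero_iff)

lemma cnorm_square_self_adjoint: "h \<in> self_adjoint A \<Longrightarrow> cnorm A (h \<otimes> h) = (cnorm A h)\<^sup>2"
  using cstar_identity[of h] by (simp add: self_adjoint_def)

end

section \<open>Norms on finite-dimensional subspaces\<close>

context complex_module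
begin

definition seminorm :: "('a \<Rightarrow> real) \<Rightarrow> bool" where
  "seminorm N \<longleftrightarrow>
    (\<forall>x\<in>carrier A. \<forall>y\<in>carrier A. N (x \<oplus> y) \<le> N x + N y) \<and>
    (\<forall>c. \<forall>x\<in>carrier A. N (c \<odot> x) = cmod c * N x)"

definition norm_on :: "('a \<Rightarrow> real) \<Rightarrow> bool" where
  "norm_on N \<longleftrightarrow> seminorm N \<and> (\<forall>x\<in>carrier A. N x = 0 \<longrightarrow> x = \<zero>)"

lemma norm_on_seminorm: "norm_on N \<Longrightarrow> seminorm N"
  by (simp add: norm_on_def)

lemma seminormD:
  assumes "seminorm N" "x \<in> carrier A"
  shows "N (c \<odot> x) = cmod c * N x" "y \<in> carrier A \<Longrightarrow> N (x \<oplus> y) \<le> N x + N y"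
  using assms by (simp_all add: seminorm_def)

lemma seminorm_zero: "seminorm N \<Longrightarrow> N \<zero> = 0"
  unfolding seminorm_def by (metis M.zero_closed mult_zero_left norm_zero smult_zero)

lemma seminorm_nonneg:
  assumes "seminorm N" "x \<in> carrier A" shows "0 \<le> N x"
proof -
  have "N (x \<oplus> (-1) \<odot> x) \<le> N x + N ((-1) \<odot> x)"
    using assms by (intro seminormD) simp_all
  moreover have "N ((-1) \<odot> x) = N x"
    using assms by (simp add: seminormD)
  ultimately show ?thesis using assms by (simp add: smult_cancel seminorm_zero)
qed

abbreviation lincomb :: "('i \<Rightarrow> 'a) \<Rightarrow> 'i set \<Rightarrow> ('i \<Rightarrow> complex) \<Rightarrow> 'a" where
  "lincomb v I c \<equiv> (\<Oplus>i\<in>I. c i \<odot> v i)"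

lemma lincomb_closed [simp]: "v \<in> I \<rightarrow> carrier A \<Longrightarrow> lincomb v I c \<in> carrier A"
  by (intro M.finsum_closed) auto

lemma lincomb_insert:
  "\<lbrakk>finite I; i \<notin> I; v \<in> insert i I \<rightarrow> carrier A\<rbrakk> \<Longrightarrow>
    lincomb v (insert i I) c = c i \<odot> v i \<oplus> lincomb v I c"
  by (subst M.finsum_insert) (auto simp: Pi_iff)

lemma lincomb_add:
  assumes "v \<in> I \<rightarrow> carrier A"
  shows "lincomb v I (\<lambda>i. c i + d i) = lincomb v I c \<oplus> lincomb v I d"
proof -
  have "lincomb v I (\<lambda>i. c i + d i) = (\<Oplus>i\<in>I. c i \<odot> v i \<oplus> d i \<odot> v i)"
    using assms by (intro M.finsum_cong') (auto simp: smult_add_left Pi_iff)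
  also have "\<dots> = lincomb v I c \<oplus> lincomb v I d"
    using assms by (intro M.finsum_addf) auto
  finally show ?thesis .
qed

lemma lincomb_smult:
  assumes "finite I" "v \<in> I \<rightarrow> carrier A"
  shows "lincomb v I (\<lambda>i. r * c i) = r \<odot> lincomb v I c"
  using assms
proof (induction I)
  case (insert i I)
  then have "lincomb v (insert i I) d = d i \<odot> v i \<oplus> lincomb v I d" for d
    by (intro lincomb_insert)
  then show ?case using insert by (simp add: Pi_iff smult_add_right smult_smult)
qed simp

lemma seminorm_lincomb_le:
  assumes "seminorm N" "finite I" "v \<in> I \<rightarrow> carrier A"
  shows "N (lincomb v I c) \<le> (\<Sum>i\<in>I. cmod (c i) * N (v i))"
  using assms(2,3)
proof (induction I)
  case empty then show ?case using seminorm_zero[OF assms(1)] by simp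
next
  case (insert i I)
  then have "lincomb v (insert i I) c = c i \<odot> v i \<oplus> lincomb v I c"
    by (intro lincomb_insert)
  moreover have "N (c i \<odot> v i \<oplus> lincomb v I c) \<le> N (c i \<odot> v i) + N (lincomb v I c)"
    using insert.prems assms(1) by (intro seminormD) (simp_all add: Pi_iff)
  moreover have "N (c i \<odot> v i) = cmod (c i) * N (v i)"
    using insert.prems assms(1) by (simp add: Pi_iff seminormD)
  ultimately show ?case using insert by auto
qed

text \<open>
  The norm is a continuous positive function of the coefficients on the compact unit sphere, hence
  bounded below there.
\<close>

lemma coefficients_le_norm:
  assumes N: "seminorm N" and I: "finite I" "v \<in> I \<rightarrow> carrier A"
    and indep: "\<forall>c. N (lincomb v I c) = 0 \<longrightarrow> (\<forall>i\<in>I. c i = 0)"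
  shows "\<exists>K\<ge>0. \<forall>c. \<forall>i\<in>I. cmod (c i) \<le> K * N (lincomb v I c)"
proof (cases "I = {}")
  case True then show ?thesis by auto
next
  case False
  define g where "g c = N (lincomb v I c)" for c
  define sphere where "sphere = (Pi UNIV (\<lambda>_. cball 0 1)) \<inter> {c. (\<Sum>i\<in>I. cmod (c i)) = 1}"
  have g_nonneg: "0 \<le> g c" for c
    unfolding g_def using seminorm_nonneg[OF N] I by simp
  have "compact (PiE UNIV (\<lambda>_::'b. cball (0::complex) 1))"
    unfolding compactin_euclidean_iff[symmetric] euclidean_product_topology[symmetric]
    by (subst compactin_PiE) auto
  then have "compact sphere"
    unfolding sphere_def using continuous_on_product_coordinates[where 'a = 'b and 'b = complex]
    by (intro compact_Int_closed closed_Collect_eq continuous_intros) (auto simp: PiE_UNIV_domain intro: continuous_on_product_coordinates)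
  moreover have "sphere \<noteq> {}"
  proof -
    from False obtain i0 where "i0 \<in> I" by auto
    then have "(\<lambda>i. if i = i0 then 1 else 0) \<in> sphere"
      using I(1) by (auto simp: sphere_def if_distrib[of cmod] cong: if_cong)
    then show ?thesis by auto
  qed
  moreover have "continuous_on sphere g"
    unfolding continuous_on_def
  proof
    fix c
    define h where "h d = (\<Sum>i\<in>I. cmod (d i - c i) * N (v i))" for d
    have "continuous_on UNIV h"
      unfolding h_def by (intro continuous_intros) (auto intro: continuous_on_product_coordinates)
    then have h: "(h \<longlongrightarrow> h c) (at c within sphere)"
      by (meson UNIV_I continuous_on_def continuous_on_subset subset_UNIV tendsto_within_subset)
    have half: "g e - g d \<le> (\<Sum>i\<in>I. cmod (e i - d i) * N (v i))" for d e
    proof -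
      have "lincomb v I e = lincomb v I d \<oplus> lincomb v I (\<lambda>i. e i - d i)"
        using I by (subst lincomb_add[symmetric]) auto
      then have "g e \<le> g d + N (lincomb v I (\<lambda>i. e i - d i))"
        using N I unfolding g_def by (simp add: seminormD)
      then show ?thesis using seminorm_lincomb_le[OF N I, of "\<lambda>i. e i - d i"] by simp
    qed
    have "dist (g d) (g c) \<le> h d" for d
      using half[of d c] half[of c d] by (auto simp: dist_real_def h_def norm_minus_commute abs_le_iff)
    moreover have "h c = 0" by (simp add: h_def)
    ultimately have "((\<lambda>d. dist (g d) (g c)) \<longlongrightarrow> 0) (at c within sphere)"
      using h by (intro tendsto_sandwich[OF _ _ tendsto_const[of 0] h[unfolded \<open>h c = 0\<close>]]) auto
    then show "(g \<longlongrightarrow> g c) (at c within sphere)"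
      by (subst tendsto_dist_iff)
  qed
  ultimately obtain c0 where c0: "c0 \<in> sphere" "\<And>c. c \<in> sphere \<Longrightarrow> g c0 \<le> g c"
    by (metis continuous_attains_inf)
  have "g c0 \<noteq> 0"
  proof
    assume "g c0 = 0"
    then have "\<forall>i\<in>I. c0 i = 0" using indep unfolding g_def by blast
    then show False using c0(1) by (simp add: sphere_def)
  qed
  then have pos: "0 < g c0" using g_nonneg[of c0] by simp
  have "cmod (c i) \<le> 1 / g c0 * g c" if "i \<in> I" for c i
  proof -
    define r where "r = (\<Sum>i\<in>I. cmod (c i))"
    have ir: "cmod (c j) \<le> r" if "j \<in> I" for j
      unfolding r_def using that I(1) by (intro member_le_sum) auto
    show ?thesis
    proof (cases "r = 0")
      case True
      then have "cmod (c i) \<le> 0" using ir[OF that] by simp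
      also have "\<dots> \<le> 1 / g c0 * g c" using pos g_nonneg[of c] by simp
      finally show ?thesis .
    next
      case False
      then have r: "0 < r" unfolding r_def by (simp add: less_le sum_nonneg)
      define e where "e j = (if j \<in> I then c j / r else 0)" for j
      have "e \<in> sphere"
        unfolding sphere_def e_def using r ir
        by (auto simp: norm_divide sum_divide_distrib[symmetric] r_def[symmetric] divide_le_eq_1)
      moreover have "g e = g c / r"
      proof -
        have "lincomb v I e = lincomb v I (\<lambda>i. complex_of_real (1 / r) * c i)"
          using I by (intro M.finsum_cong') (auto simp: e_def Pi_iff)
        also have "\<dots> = complex_of_real (1 / r) \<odot> lincomb v I c"
          using I by (rule lincomb_smult)
        finally show ?thesis
          using N I r unfolding g_def by (simp add: seminormD norm_divide)
      qed
      ultimately have "g c0 * r \<le> g c" using mult_left_mono[OF c0(2)[of e], of r] r by (simp add: mult.commute)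
      then have "r \<le> 1 / g c0 * g c" using pos by (simp add: field_simps)
      then show ?thesis using ir[OF that] by simp
    qed
  qed
  then show ?thesis using pos by (intro exI[of _ "1 / g c0"]) (simp add: g_def)
qed

text \<open>
  Dependent generators are discarded one at a time until the coefficients are controlled by the norm.
\<close>

lemma bounded_coefficients:
  assumes norm: "norm_on N" and "finite I" "v \<in> I \<rightarrow> carrier A"
  shows "\<exists>T\<subseteq>I. \<exists>K\<ge>0. \<forall>c. \<exists>d. lincomb v I c = lincomb v T d \<and>
    (\<forall>i\<in>T. cmod (d i) \<le> K * N (lincomb v I c))"
  using assms(2,3)
proof (induction I rule: finite_psubset_induct)
  case (psubset I)
  have N: "seminorm N" "\<And>x. x \<in> carrier A \<Longrightarrow> N x = 0 \<Longrightarrow> x = \<zero>"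
    using norm unfolding norm_on_def by blast+
  show ?case
  proof (cases "\<forall>c. N (lincomb v I c) = 0 \<longrightarrow> (\<forall>i\<in>I. c i = 0)")
    case True
    from coefficients_le_norm[OF N(1) psubset.hyps psubset.prems, OF True] obtain K where
      K: "K \<ge> 0" "\<forall>c. \<forall>i\<in>I. cmod (c i) \<le> K * N (lincomb v I c)" by (elim exE conjE) (rule that)
    show ?thesis
    proof (rule exI[of _ I], rule conjI[OF order_refl], rule exI[of _ K], rule conjI[OF K(1)], rule allI)
      show "\<exists>d. lincomb v I c = lincomb v I d \<and> (\<forall>i\<in>I. cmod (d i) \<le> K * N (lincomb v I c))" for c
        by (rule exI[of _ c], rule conjI[OF refl]) (rule spec[OF K(2)])
    qed
  next
    case False
    then obtain c0 i0 where c0: "N (lincomb v I c0) = 0" "i0 \<in> I" "c0 i0 \<noteq> 0" by blast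
    let ?J = "I - {i0}"
    have vJ: "v \<in> ?J \<rightarrow> carrier A" using psubset.prems by auto
    have reduce: "\<exists>c'. lincomb v I c = lincomb v ?J c'" for c
    proof -
      \<comment> \<open>subtract the multiple of the relation \<open>c0\<close> that cancels the coefficient of \<open>i0\<close>\<close>
      define c' where "c' i = c i + (- c i0 / c0 i0) * c0 i" for i
      have "lincomb v I c' = lincomb v I c \<oplus> (- c i0 / c0 i0) \<odot> lincomb v I c0"
        using psubset unfolding c'_def by (subst lincomb_add) (simp_all only: lincomb_smult)
      also have "\<dots> = lincomb v I c"
        using N(2)[OF _ c0(1)] psubset.prems by simp
      finally have "lincomb v I c = lincomb v (insert i0 ?J) c'"
        using c0(2) by (simp add: insert_absorb)
      also have "\<dots> = c' i0 \<odot> v i0 \<oplus> lincomb v ?J c'"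
        using psubset.hyps psubset.prems c0(2) by (intro lincomb_insert) (auto simp: insert_absorb)
      also have "c' i0 = 0" using c0(3) by (simp add: c'_def)
      finally show ?thesis using psubset.prems c0(2) vJ by (auto simp: Pi_iff)
    qed
    have "?J \<subset> I" using c0(2) by auto
    from psubset.IH[OF this vJ] obtain T K where T: "T \<subseteq> ?J" "K \<ge> 0"
      "\<forall>c. \<exists>d. lincomb v ?J c = lincomb v T d \<and> (\<forall>i\<in>T. cmod (d i) \<le> K * N (lincomb v ?J c))"
      by (elim exE conjE) (rule that)
    show ?thesis
    proof (intro exI[of _ T] conjI exI[of _ K] allI)
      show "T \<subseteq> I" "K \<ge> 0" using T by auto
      show "\<exists>d. lincomb v I c = lincomb v T d \<and> (\<forall>i\<in>T. cmod (d i) \<le> K * N (lincomb v I c))" for c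
      proof -
        obtain c' where "lincomb v I c = lincomb v ?J c'" using reduce[of c] by (elim exE) (rule that)
        then show ?thesis using spec[OF T(3), of c'] by (simp only:)
      qed
    qed
  qed
qed

text \<open>This is the equivalence of norms in finite dimensions, in the form in which it is applied.\<close>

lemma norm_dominates_seminorm:
  assumes N: "norm_on N" and M: "seminorm M" and I: "finite I" "v \<in> I \<rightarrow> carrier A"
  shows "\<exists>K\<ge>0. \<forall>c. M (lincomb v I c) \<le> K * N (lincomb v I c)"
proof -
  from bounded_coefficients[OF N I] obtain T K where T: "T \<subseteq> I" "K \<ge> 0"
    "\<forall>c. \<exists>d. lincomb v I c = lincomb v T d \<and> (\<forall>i\<in>T. cmod (d i) \<le> K * N (lincomb v I c))"
    by (elim exE conjE) (rule that)
  have vT: "finite T" "v \<in> T \<rightarrow> carrier A" using T(1) I finite_subset by auto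
  have Mv: "0 \<le> M (v i)" if "i \<in> T" for i
    using seminorm_nonneg[OF M] vT that by auto
  have "M (lincomb v I c) \<le> (K * (\<Sum>i\<in>T. M (v i))) * N (lincomb v I c)" for c
  proof -
    from T(3)[rule_format, of c] obtain d where
      d: "lincomb v I c = lincomb v T d" "\<forall>i\<in>T. cmod (d i) \<le> K * N (lincomb v I c)"
      by (elim exE conjE) (rule that)
    have "M (lincomb v I c) \<le> (\<Sum>i\<in>T. cmod (d i) * M (v i))"
      unfolding d(1) by (rule seminorm_lincomb_le[OF M vT])
    also have "\<dots> \<le> (\<Sum>i\<in>T. (K * N (lincomb v I c)) * M (v i))"
      by (intro sum_mono mult_right_mono d(2)[rule_format] Mv)
    finally show ?thesis by (simp add: sum_distrib_left sum_distrib_right mult_ac)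
  qed
  moreover have "0 \<le> K * (\<Sum>i\<in>T. M (v i))"
    using T(2) Mv by (intro mult_nonneg_nonneg sum_nonneg)
  ultimately show ?thesis by (intro exI[of _ "K * (\<Sum>i\<in>T. M (v i))"] conjI allI)
qed

end


section \<open>Injective morphisms from finite-dimensional algebras are isometric\<close>

text \<open>Multiplicative constants disappear on taking roots of growing order.\<close>

lemma le_if_powers_le:
  fixes a b K :: real
  assumes "0 \<le> a" "0 \<le> b" and le: "\<And>n. a ^ (2 ^ n) \<le> K * b ^ (2 ^ n)"
  shows "a \<le> b"
proof (rule ccontr)
  assume "\<not> a \<le> b"
  then have ab: "b < a" by simp
  show False
  proof (cases "b = 0")
    case True then show ?thesis using le[of 0] ab by simp
  next
    case False
    then have b: "0 < b" using assms by simp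
    then have r: "1 < a / b" using ab by simp
    obtain n where "K < (a / b) ^ n" using real_arch_pow[OF r] by blast
    also have "\<dots> \<le> (a / b) ^ (2 ^ n)"
      using r by (intro power_increasing) (auto intro: less_imp_le[OF less_exp])
    finally show False using le[of n] b by (simp add: power_divide field_simps)
  qed
qed

context cstar_algebra
begin

lemma pow_closed [simp]: "x \<in> carrier A \<Longrightarrow> x [^] (n::nat) \<in> carrier A"
  by (rule monoid.nat_pow_closed[OF monoid_mult])

lemma pow_Suc_left: "x \<in> carrier A \<Longrightarrow> x [^] Suc n = x \<otimes> x [^] n"
  by (rule monoid.nat_pow_Suc2[OF monoid_mult])

lemma pow_Suc_right: "x [^] Suc n = x [^] n \<otimes> x"
  by (rule monoid.nat_pow_Suc[OF monoid_mult])

lemma star_pow: "x \<in> carrier A \<Longrightarrow> star A (x [^] (n::nat)) = star A x [^] n"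
proof (induction n)
  case (Suc n)
  have "star A (x [^] Suc n) = star A x \<otimes> star A (x [^] n)"
    using Suc.prems by (simp only: pow_Suc_right star_mult pow_closed)
  then show ?case using Suc by (simp only: pow_Suc_left star_closed)
qed simp

text \<open>The C*-identity for the self-adjoint powers of \<open>h\<close>, applied repeatedly.\<close>

lemma cnorm_pow_self_adjoint:
  assumes h: "h \<in> self_adjoint A"
  shows "cnorm A (h [^] (2 ^ n :: nat)) = cnorm A h ^ (2 ^ n)"
proof (induction n)
  case 0
  show ?case using h pow_Suc_right[of h 0] by (simp add: self_adjoint_def)
next
  case (Suc n)
  have hc: "h \<in> carrier A" using h by (simp add: self_adjoint_def)
  let ?p = "h [^] (2 ^ n :: nat)"
  have "?p \<in> self_adjoint A" using h by (simp add: self_adjoint_def star_pow)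
  moreover have "h [^] (2 ^ Suc n :: nat) = ?p \<otimes> ?p"
    using monoid.nat_pow_mult[OF monoid_mult hc, of "2 ^ n" "2 ^ n"] by (simp add: mult_2)
  ultimately show ?case using Suc cnorm_square_self_adjoint[of ?p] by (simp only: power_Suc2 power_mult)
qed

lemma norm_on_cnorm: "norm_on (cnorm A)"
  unfolding norm_on_def seminorm_def by (simp add: cnorm_add cnorm_smult cnorm_eq_zero_iff)

end

lemma star_hom_simps:
  assumes "star_hom A B f" "x \<in> carrier A"
  shows "f x \<in> carrier B" "f (c \<odot>\<^bsub>A\<^esub> x) = c \<odot>\<^bsub>B\<^esub> f x" "f (star A x) = star B (f x)"
    "f \<one>\<^bsub>A\<^esub> = \<one>\<^bsub>B\<^esub>"
    "y \<in> carrier A \<Longrightarrow> f (x \<oplus>\<^bsub>A\<^esub> y) = f x \<oplus>\<^bsub>B\<^esub> f y"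
    "y \<in> carrier A \<Longrightarrow> f (x \<otimes>\<^bsub>A\<^esub> y) = f x \<otimes>\<^bsub>B\<^esub> f y"
  using assms by (auto simp: star_hom_def linear_map_def ring_hom_def)

lemma linear_map_zero:
  assumes "complex_module A" "complex_module B" "linear_map A B f"
  shows "f \<zero>\<^bsub>A\<^esub> = \<zero>\<^bsub>B\<^esub>"
proof -
  interpret A: complex_module A by fact
  interpret B: complex_module B by fact
  have "f (0 \<odot>\<^bsub>A\<^esub> \<zero>\<^bsub>A\<^esub>) = 0 \<odot>\<^bsub>B\<^esub> f \<zero>\<^bsub>A\<^esub>"
    using assms(3) A.M.zero_closed unfolding linear_map_def by blast
  moreover have "f \<zero>\<^bsub>A\<^esub> \<in> carrier B"
    using assms(3) A.M.zero_closed unfolding linear_map_def by blast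
  ultimately show ?thesis by simp
qed

lemma linear_map_minus:
  assumes "complex_module A" "complex_module B" "linear_map A B f" "x \<in> carrier A" "y \<in> carrier A"
  shows "f (x \<ominus>\<^bsub>A\<^esub> y) = f x \<ominus>\<^bsub>B\<^esub> f y"
proof -
  interpret A: complex_module A by fact
  interpret B: complex_module B by fact
  show ?thesis using assms(3-5)
    by (auto simp: linear_map_def A.minus_eq_add_smult B.minus_eq_add_smult Pi_iff)
qed

lemma linear_map_lincomb:
  assumes "complex_module A" "complex_module B" "linear_map A B f" "finite I" "v \<in> I \<rightarrow> carrier A"
  shows "f (\<Oplus>\<^bsub>A\<^esub>i\<in>I. c i \<odot>\<^bsub>A\<^esub> v i) = (\<Oplus>\<^bsub>B\<^esub>i\<in>I. c i \<odot>\<^bsub>B\<^esub> f (v i))"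
proof -
  interpret A: complex_module A by fact
  interpret B: complex_module B by fact
  have f: "f \<in> carrier A \<rightarrow> carrier B" using assms(3) by (simp add: linear_map_def)
  show ?thesis using assms(4,5)
  proof (induction I)
    case empty then show ?case using linear_map_zero[OF assms(1-3)] by simp
  next
    case (insert i I)
    then have "f (c i \<odot>\<^bsub>A\<^esub> v i \<oplus>\<^bsub>A\<^esub> (\<Oplus>\<^bsub>A\<^esub>i\<in>I. c i \<odot>\<^bsub>A\<^esub> v i)) = c i \<odot>\<^bsub>B\<^esub> f (v i) \<oplus>\<^bsub>B\<^esub> f (\<Oplus>\<^bsub>A\<^esub>i\<in>I. c i \<odot>\<^bsub>A\<^esub> v i)"
      using assms(3) unfolding linear_map_def by (simp add: Pi_iff)
    moreover have "(\<lambda>i. c i \<odot>\<^bsub>B\<^esub> f (v i)) \<in> insert i I \<rightarrow> carrier B" using insert.prems f by (auto simp: Pi_iff)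
    ultimately show ?case using insert
      by (simp add: Pi_iff)
  qed
qed

text \<open>
  The norm of the domain and the norm of the image are two norms on a finite-dimensional space, so
  each dominates the other up to a constant. Apply this to \<open>h\<^sup>m\<close> with \<open>h = x\<^sup>*x\<close> and \<open>m\<close> a
  power of 2, and take \<open>m\<close>-th roots.
\<close>

lemma star_mono_isometric:
  assumes "cstar_algebra F" "cstar_algebra G" "finite_dimensional F" "star_mono F G \<pi>"
    and x: "x \<in> carrier F"
  shows "cnorm G (\<pi> x) = cnorm F x"
proof -
  interpret F: cstar_algebra F by fact
  interpret G: cstar_algebra G by fact
  have \<pi>: "star_hom F G \<pi>" "inj_on \<pi> (carrier F)" using assms(4) by (auto simp: star_mono_def)
  note hom = star_hom_simps[OF \<pi>(1)]
  have lin: "linear_map F G \<pi>" using \<pi>(1) by (simp add: star_hom_def)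
  obtain S where S: "finite S" "S \<subseteq> carrier F"
    "\<And>x. x \<in> carrier F \<Longrightarrow> \<exists>c. x = F.lincomb (\<lambda>s. s) S c"
    using assms(3) unfolding finite_dimensional_def by blast
  have Sv: "(\<lambda>s. s) \<in> S \<rightarrow> carrier F" using S by auto
  let ?N = "\<lambda>x. cnorm G (\<pi> x)"
  have N: "F.norm_on ?N"
    unfolding F.norm_on_def
  proof (intro conjI ballI impI)
    show "F.seminorm ?N"
      unfolding F.seminorm_def by (simp add: hom G.cnorm_add G.cnorm_smult)
    fix x assume x: "x \<in> carrier F" "?N x = 0"
    then have "\<pi> x = \<pi> \<zero>\<^bsub>F\<^esub>"
      using linear_map_zero[OF F.complex_module_axioms G.complex_module_axioms lin] hom(1)
      by (simp add: G.cnorm_eq_zero_iff)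
    then show "x = \<zero>\<^bsub>F\<^esub>" using \<pi>(2) x by (simp add: inj_on_eq_iff)
  qed
  from F.norm_dominates_seminorm[OF N F.norm_on_seminorm[OF F.norm_on_cnorm] S(1) Sv] obtain K1 where
    "\<forall>c. cnorm F (F.lincomb (\<lambda>s. s) S c) \<le> K1 * ?N (F.lincomb (\<lambda>s. s) S c)"
    by (elim exE conjE) (rule that)
  then have K1: "cnorm F x \<le> K1 * ?N x" if "x \<in> carrier F" for x
    using S(3)[OF that] by (elim exE) simp
  from F.norm_dominates_seminorm[OF F.norm_on_cnorm F.norm_on_seminorm[OF N] S(1) Sv]
  obtain K2 where "\<forall>c. ?N (F.lincomb (\<lambda>s. s) S c) \<le> K2 * cnorm F (F.lincomb (\<lambda>s. s) S c)"
    by (elim exE conjE) (rule that)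
  then have K2: "?N x \<le> K2 * cnorm F x" if "x \<in> carrier F" for x
    using S(3)[OF that] by (elim exE) simp
  define h where "h = star F x \<otimes>\<^bsub>F\<^esub> x"
  have h: "h \<in> self_adjoint F" "h \<in> carrier F" using x by (auto simp: h_def self_adjoint_def F.star_mult)
  have \<pi>h: "\<pi> h \<in> self_adjoint G" using h hom(1,3)[of h] by (simp add: self_adjoint_def)
  have \<pi>pow: "\<pi> (h [^]\<^bsub>F\<^esub> (n::nat)) = \<pi> h [^]\<^bsub>G\<^esub> n" for n
    by (induction n) (use h(2) hom in \<open>auto simp: F.pow_Suc_left G.pow_Suc_left simp del: monoid.nat_pow_Suc\<close>)
  have pow_le: "?N h ^ (2 ^ n) \<le> K2 * cnorm F h ^ (2 ^ n)" "cnorm F h ^ (2 ^ n) \<le> K1 * ?N h ^ (2 ^ n)" for n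
    using K1[of "h [^]\<^bsub>F\<^esub> (2 ^ n :: nat)"] K2[of "h [^]\<^bsub>F\<^esub> (2 ^ n :: nat)"] h(2)
      F.cnorm_pow_self_adjoint[OF h(1), of n] G.cnorm_pow_self_adjoint[OF \<pi>h, of n]
    by (simp_all add: \<pi>pow)
  have "?N h \<le> cnorm F h"
    by (rule le_if_powers_le[OF G.cnorm_nonneg[OF hom(1)[OF h(2)]] F.cnorm_nonneg[OF h(2)] pow_le(1)])
  moreover have "cnorm F h \<le> ?N h"
    by (rule le_if_powers_le[OF F.cnorm_nonneg[OF h(2)] G.cnorm_nonneg[OF hom(1)[OF h(2)]] pow_le(2)])
  ultimately have "?N h = cnorm F h" by (rule antisym)
  moreover have "?N h = (?N x)\<^sup>2" "cnorm F h = (cnorm F x)\<^sup>2"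
    using x G.cstar_identity[of "\<pi> x"] by (simp_all add: h_def hom F.cstar_identity)
  ultimately show ?thesis
    using x F.cnorm_nonneg[of x] G.cnorm_nonneg[of "\<pi> x"] by (simp add: hom(1))
qed

section \<open>Positive functionals\<close>

lemma complex_module_complex: "complex_module complex_cstar"
proof -
  interpret cstar_algebra complex_cstar by (rule cstar_algebra_complex)
  show ?thesis by unfold_locales
qed

lemma minus_complex_cstar [simp]: "x \<ominus>\<^bsub>complex_cstar\<^esub> y = x - y"
  using complex_module.minus_eq_add_smult[OF complex_module_complex, of x y] by simp

lemma map_norm_le_1D:
  assumes A: "cstar_algebra A" and B: "cstar_algebra B" and f: "linear_map A B f" "map_norm A B f \<le> 1"
    and a: "a \<in> carrier A"
  shows "cnorm B (f a) \<le> cnorm A a"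
proof (cases "cnorm A a = 0")
  interpret A: cstar_algebra A by fact
  interpret B: cstar_algebra B by fact
  case True
  then have "a = \<zero>\<^bsub>A\<^esub>" using a A.cnorm_eq_zero_iff by simp
  then show ?thesis using linear_map_zero[OF A.complex_module_axioms B.complex_module_axioms f(1)] by simp
next
  interpret A: cstar_algebra A by fact
  interpret B: cstar_algebra B by fact
  case False
  then have pos: "0 < cnorm A a" using A.cnorm_nonneg[OF a] by simp
  let ?r = "complex_of_real (1 / cnorm A a)"
  have "cnorm A (?r \<odot>\<^bsub>A\<^esub> a) \<le> 1" using a pos by (simp add: A.cnorm_smult norm_divide)
  then have "ennreal (cnorm B (f (?r \<odot>\<^bsub>A\<^esub> a))) \<le> map_norm A B f"
    unfolding map_norm_def using a by (intro SUP_upper) simp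
  then have "cnorm B (f (?r \<odot>\<^bsub>A\<^esub> a)) \<le> 1"
    using f(2) by (metis ennreal_le_1 order_trans)
  moreover have "f (?r \<odot>\<^bsub>A\<^esub> a) = ?r \<odot>\<^bsub>B\<^esub> f a" "f a \<in> carrier B"
    using f(1) a by (auto simp: linear_map_def)
  ultimately show ?thesis using pos by (simp add: B.cnorm_smult norm_divide)
qed

context cstar_algebra
begin

lemma functional_simps:
  assumes "linear_map A complex_cstar f" "x \<in> carrier A"
  shows "f (c \<odot> x) = c * f x" "y \<in> carrier A \<Longrightarrow> f (x \<oplus> y) = f x + f y" "y \<in> carrier A \<Longrightarrow> f (x \<ominus> y) = f x - f y"
  using assms linear_map_minus[OF complex_module_axioms complex_module_complex assms(1), of x y]
  by (auto simp: linear_map_def)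

lemma positive_functional_linear: "positive_map A complex_cstar f \<Longrightarrow> linear_map A complex_cstar f"
  by (simp add: positive_map_def)

lemma positive_functional_square:
  assumes "positive_map A complex_cstar f" "x \<in> carrier A"
  shows "f (star A x \<otimes> x) \<in> \<real>" "0 \<le> Re (f (star A x \<otimes> x))"
proof -
  have "star A x \<otimes> x \<in> positive_elements A" using assms(2) by (auto simp: positive_elements_def)
  then have "f (star A x \<otimes> x) \<in> positive_elements complex_cstar"
    using assms(1) unfolding positive_map_def by blast
  then show "f (star A x \<otimes> x) \<in> \<real>" "0 \<le> Re (f (star A x \<otimes> x))"
    by (simp_all add: positive_elements_complex)
qed

lemma positive_functional_add_square:
  assumes f: "positive_map A complex_cstar f" and x: "x \<in> carrier A" and y: "y \<in> carrier A"
  shows "f (star A (x \<oplus> t \<odot> y) \<otimes> (x \<oplus> t \<odot> y)) =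
    f (star A x \<otimes> x) + t * f (star A x \<otimes> y) + cnj t * f (star A y \<otimes> x) + cnj t * t * f (star A y \<otimes> y)"
  using x y by (simp add: cstar_simps functional_simps[OF positive_functional_linear[OF f]] algebra_simps)

text \<open>
  Since \<open>f((x + ty)\<^sup>*(x + ty))\<close> is real for \<open>t = 1\<close> and \<open>t = \<i>\<close>, the cross terms are conjugate.
\<close>

lemma positive_functional_hermitian:
  assumes f: "positive_map A complex_cstar f" and x: "x \<in> carrier A" and y: "y \<in> carrier A"
  shows "f (star A y \<otimes> x) = cnj (f (star A x \<otimes> y))"
proof -
  have sq: "Im (f (star A z \<otimes> z)) = 0" if "z \<in> carrier A" for z
    using positive_functional_square(1)[OF f that] by (simp add: complex_is_Real_iff)
  have "Im (f (star A (x \<oplus> t \<odot> y) \<otimes> (x \<oplus> t \<odot> y))) = 0" for t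
    using x y by (intro sq) simp
  then have "Im (t * f (star A x \<otimes> y) + cnj t * f (star A y \<otimes> x)) = 0" if "cmod t = 1" for t
    using sq[OF x] sq[OF y] that unfolding positive_functional_add_square[OF f x y]
    by (simp add: complex_norm_square[symmetric] mult.commute[of "cnj t" t])
  from this[of 1] this[of "\<i>"] show ?thesis by (simp add: complex_eq_iff)
qed

text \<open>
  For \<open>u = x - s z\<^sup>*y\<close> with \<open>z = f(x\<^sup>*y)\<close>, the value \<open>f(u\<^sup>*u)\<close> is a nonnegative quadratic polynomial in
  the real number \<open>s\<close>.
\<close>

lemma Cauchy_Schwarz:
  assumes f: "positive_map A complex_cstar f" and x: "x \<in> carrier A" and y: "y \<in> carrier A"
  shows "(cmod (f (star A x \<otimes> y)))\<^sup>2 \<le> Re (f (star A x \<otimes> x)) * Re (f (star A y \<otimes> y))"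
proof -
  define a b z w where "a = Re (f (star A x \<otimes> x))" and "b = Re (f (star A y \<otimes> y))"
    and "z = f (star A x \<otimes> y)" and "w = (cmod z)\<^sup>2"
  have ab: "0 \<le> a" "0 \<le> b" using positive_functional_square[OF f] x y by (simp_all add: a_def b_def)
  have quad: "0 \<le> a - 2 * s * w + s\<^sup>2 * w * b" for s :: real
  proof -
    let ?t = "- complex_of_real s * cnj z"
    have "0 \<le> Re (f (star A (x \<oplus> ?t \<odot> y) \<otimes> (x \<oplus> ?t \<odot> y)))"
      using x y by (intro positive_functional_square[OF f]) simp
    also have "\<dots> = a + Re (?t * z + cnj (?t * z)) + Re (cnj ?t * ?t) * b"
      unfolding positive_functional_add_square[OF f x y] positive_functional_hermitian[OF f x y]
      using positive_functional_square(1)[OF f y]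
      by (simp add: a_def b_def z_def complex_is_Real_iff)
    also have "\<dots> = a - 2 * s * w + s\<^sup>2 * w * b"
    proof -
      have "w = Re z * Re z + Im z * Im z" unfolding w_def cmod_power2 by (simp add: power2_eq_square)
      then show ?thesis by (simp add: algebra_simps power2_eq_square)
    qed
    finally show ?thesis .
  qed
  have "w \<le> a * b"
  proof (cases "b = 0")
    case True
    show ?thesis
    proof (rule ccontr)
      assume "\<not> w \<le> a * b"
      then have "0 < w" using True by simp
      then show False using quad[of "(a + 1) / (2 * w)"] True by (simp add: field_simps)
    qed
  next
    case False
    then show ?thesis using quad[of "1 / b"] ab by (simp add: field_simps power2_eq_square)
  qed
  then show ?thesis by (simp add: a_def b_def z_def w_def)
qed

text \<open>
  By Cauchy--Schwarz the norm \<open>M\<close> of \<open>f\<close> satisfies \<open>M\<^sup>2 \<le> f(1) M\<close>, because \<open>a\<^sup>*a\<close> is again in the unit ball.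
\<close>

lemma positive_functional_bound:
  assumes f: "positive_map A complex_cstar f"
    and C: "\<And>a. a \<in> carrier A \<Longrightarrow> cmod (f a) \<le> C * cnorm A a" and a: "a \<in> carrier A"
  shows "cmod (f a) \<le> Re (f \<one>) * cnorm A a"
proof -
  note lin = functional_simps[OF positive_functional_linear[OF f]]
  define p where "p = Re (f \<one>)"
  define ball where "ball = {a \<in> carrier A. cnorm A a \<le> 1}"
  define M where "M = (SUP a\<in>ball. cmod (f a))"
  have p: "0 \<le> p" using positive_functional_square(2)[OF f one_carrier] by (simp add: p_def)
  have bdd: "bdd_above ((\<lambda>a. cmod (f a)) ` ball)"
  proof (rule bdd_aboveI2)
    fix a assume "a \<in> ball"
    then have a: "a \<in> carrier A" "cnorm A a \<le> 1" by (auto simp: ball_def)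
    have "cmod (f a) \<le> C * cnorm A a" by (rule C[OF a(1)])
    also have "\<dots> \<le> \<bar>C\<bar> * 1" using a cnorm_nonneg by (intro mult_mono) auto
    finally show "cmod (f a) \<le> \<bar>C\<bar>" by simp
  qed
  have le_M: "cmod (f a) \<le> M" if "a \<in> ball" for a
    unfolding M_def by (rule cSUP_upper[OF that bdd])
  have one: "\<one> \<in> ball" by (simp add: ball_def)
  have M0: "0 \<le> M" using le_M[OF one] by (rule order_trans[OF norm_ge_zero])
  have "cmod (f a) \<le> sqrt (p * M)" if "a \<in> ball" for a
  proof (rule real_le_rsqrt)
    have a: "a \<in> carrier A" "cnorm A a \<le> 1" using that by (auto simp: ball_def)
    have "(cmod (f a))\<^sup>2 \<le> p * Re (f (star A a \<otimes> a))"
      using Cauchy_Schwarz[OF f one_carrier a(1)] a(1) by (simp add: p_def)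
    also have "\<dots> \<le> p * M"
    proof (rule mult_left_mono[OF _ p])
      have "star A a \<otimes> a \<in> ball"
        using a cnorm_nonneg[OF a(1)] by (simp add: ball_def cstar_identity abs_square_le_1)
      then show "Re (f (star A a \<otimes> a)) \<le> M" using le_M complex_Re_le_cmod order_trans by blast
    qed
    finally show "(cmod (f a))\<^sup>2 \<le> p * M" .
  qed
  then have "M \<le> sqrt (p * M)"
    unfolding M_def using one by (intro cSUP_least) auto
  then have "M * M \<le> p * M"
    using M0 p by (metis mult_nonneg_nonneg power2_eq_square real_sqrt_le_iff real_sqrt_unique)
  then have Mp: "M \<le> p" using M0 p by (cases "M = 0") auto
  show ?thesis
  proof (cases "cnorm A a = 0")
    case True
    then show ?thesis using C[OF a] by simp
  next
    case False
    then have pos: "0 < cnorm A a" using cnorm_nonneg[OF a] by simp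
    let ?b = "complex_of_real (1 / cnorm A a) \<odot> a"
    have "?b \<in> ball" using a pos by (simp add: ball_def cnorm_smult norm_divide)
    from order_trans[OF le_M[OF this] Mp] show ?thesis
      using pos a by (simp add: lin norm_divide p_def field_simps)
  qed
qed

lemma state_positive: "\<phi> \<in> states A \<Longrightarrow> positive_map A complex_cstar \<phi>"
  by (simp add: states_def)

lemmas state_linear = positive_functional_linear[OF state_positive]

lemma state_le_cnorm: "\<phi> \<in> states A \<Longrightarrow> a \<in> carrier A \<Longrightarrow> cmod (\<phi> a) \<le> cnorm A a"
  using map_norm_le_1D[OF cstar_algebra_axioms cstar_algebra_complex state_linear, of \<phi> a]
  by (simp add: states_def)

lemma state_one:
  assumes "\<phi> \<in> states A" shows "\<phi> \<one> = 1"
proof -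
  let ?p = "Re (\<phi> \<one>)"
  have pos: "positive_map A complex_cstar \<phi>" using assms by (rule state_positive)
  have "0 \<le> ?p" "\<phi> \<one> \<in> \<real>"
    using positive_functional_square[OF pos one_carrier] by simp_all
  have "cmod (\<phi> a) \<le> ?p * cnorm A a" if "a \<in> carrier A" for a
    using positive_functional_bound[OF pos, of 1 a] state_le_cnorm[OF assms] that by simp
  then have "cmod (\<phi> a) \<le> ?p" if "a \<in> carrier A" "cnorm A a \<le> 1" for a
    using that \<open>0 \<le> ?p\<close> by (meson mult_left_le order_trans)
  then have "map_norm A complex_cstar \<phi> \<le> ennreal ?p"
    unfolding map_norm_def by (intro SUP_least ennreal_leI) simp
  then have "1 \<le> ?p" using assms by (simp add: states_def)
  moreover have "cmod (\<phi> \<one>) \<le> 1" using state_le_cnorm[OF assms one_carrier] by simp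
  ultimately have "?p = 1" using complex_Re_le_cmod[of "\<phi> \<one>"] by simp
  then show ?thesis using \<open>\<phi> \<one> \<in> \<real>\<close> by (simp add: complex_eq_iff complex_is_Real_iff)
qed

lemma stateI:
  assumes "\<phi> \<in> extensional (carrier A)" "positive_map A complex_cstar \<phi>"
    "\<And>a. a \<in> carrier A \<Longrightarrow> cmod (\<phi> a) \<le> cnorm A a" "\<phi> \<one> = 1"
  shows "\<phi> \<in> states A"
proof -
  have "map_norm A complex_cstar \<phi> \<le> 1"
    unfolding map_norm_def by (rule SUP_least) (use assms(3) in \<open>auto intro: order_trans\<close>)
  moreover have "1 \<le> map_norm A complex_cstar \<phi>"
    unfolding map_norm_def by (rule SUP_upper2[of \<one>]) (simp_all add: assms(4))
  ultimately show ?thesis using assms(1,2) by (simp add: states_def)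
qed

lemma positive_functional_real:
  assumes "positive_map A complex_cstar f" "a \<in> self_adjoint A" shows "f a \<in> \<real>"
  using positive_functional_hermitian[OF assms(1) one_carrier, of a] assms(2)
  by (simp add: self_adjoint_def Reals_cnj_iff)

text \<open>The functional \<open>x \<mapsto> \<phi>(z\<^sup>*xz)\<close> is positive, so its norm is its value at 1.\<close>

lemma state_conjugation_bound:
  assumes \<phi>: "\<phi> \<in> states A" and y: "y \<in> carrier A" and z: "z \<in> carrier A"
  shows "cmod (\<phi> (star A z \<otimes> y \<otimes> z)) \<le> Re (\<phi> (star A z \<otimes> z)) * cnorm A y"
proof -
  define f where "f x = \<phi> (star A z \<otimes> x \<otimes> z)" for x
  have "linear_map A complex_cstar f"
    unfolding linear_map_def f_def using z
    by (auto simp: cstar_simps functional_simps[OF state_linear[OF \<phi>]])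
  moreover have "f (star A b \<otimes> b) = \<phi> (star A (b \<otimes> z) \<otimes> (b \<otimes> z))" if "b \<in> carrier A" for b
    unfolding f_def using that z by (simp add: cstar_simps)
  ultimately have "positive_map A complex_cstar f"
    unfolding positive_map_def positive_elements_complex
    using positive_functional_square[OF state_positive[OF \<phi>]] z
    by (auto simp: positive_elements_def)
  moreover have "cmod (f x) \<le> (cnorm A z * cnorm A z) * cnorm A x" if x: "x \<in> carrier A" for x
  proof -
    have "cmod (f x) \<le> cnorm A (star A z \<otimes> x \<otimes> z)"
      unfolding f_def using x z by (intro state_le_cnorm[OF \<phi>]) simp
    also have "\<dots> \<le> cnorm A (star A z \<otimes> x) * cnorm A z" using x z by (simp add: cnorm_mult)
    also have "\<dots> \<le> (cnorm A z * cnorm A x) * cnorm A z"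
      using x z cnorm_mult[of "star A z" x] by (simp add: mult_right_mono cnorm_nonneg)
    finally show ?thesis by (simp add: mult_ac)
  qed
  ultimately have "cmod (f y) \<le> Re (f \<one>) * cnorm A y"
    using y by (rule positive_functional_bound)
  then show ?thesis using z by (simp add: f_def)
qed

text \<open>
  Left multiplication by \<open>1 - h\<close> with \<open>h = c\<^sup>*c\<close> is a contraction for the Hilbert seminorm of \<open>\<phi>\<close>.
  Indeed \<open>(1 - h)\<^sup>2 = 1 - 2h + h\<^sup>2\<close>, and \<open>\<phi>(y\<^sup>*h\<^sup>2y) \<le> \<phi>(y\<^sup>*hy)\<close> because
  \<open>h\<^sup>2 = c\<^sup>*(cc\<^sup>*)c\<close> with \<open>\<parallel>cc\<^sup>*\<parallel> \<le> 1\<close>.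
\<close>

lemma state_square_contract:
  assumes \<phi>: "\<phi> \<in> states A" and c: "c \<in> carrier A" "cnorm A c \<le> 1" and y: "y \<in> carrier A"
  defines "z \<equiv> (\<one> \<ominus> star A c \<otimes> c) \<otimes> y"
  shows "Re (\<phi> (star A z \<otimes> z)) \<le> Re (\<phi> (star A y \<otimes> y))"
proof -
  let ?w = "c \<otimes> y"
  have w: "?w \<in> carrier A" using c y by simp
  have eq: "star A z \<otimes> z = (star A y \<otimes> y \<ominus> 2 \<odot> (star A ?w \<otimes> ?w)) \<oplus> star A ?w \<otimes> (c \<otimes> star A c) \<otimes> ?w"
  proof -
    have two: "(-2) \<odot> x = (-1) \<odot> x \<oplus> (-1) \<odot> x" if "x \<in> carrier A" for x
      using smult_add_left[of x "-1" "-1"] that by simp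
    show ?thesis unfolding z_def using c y by (simp add: cstar_simps two)
  qed
  have "\<phi> (star A z \<otimes> z) = \<phi> (star A y \<otimes> y) - 2 * \<phi> (star A ?w \<otimes> ?w) + \<phi> (star A ?w \<otimes> (c \<otimes> star A c) \<otimes> ?w)"
    unfolding eq using c y by (simp add: functional_simps[OF state_linear[OF \<phi>]])
  moreover have "Re (\<phi> (star A ?w \<otimes> (c \<otimes> star A c) \<otimes> ?w)) \<le> Re (\<phi> (star A ?w \<otimes> ?w))"
  proof -
    have "cmod (\<phi> (star A ?w \<otimes> (c \<otimes> star A c) \<otimes> ?w)) \<le> Re (\<phi> (star A ?w \<otimes> ?w)) * cnorm A (c \<otimes> star A c)"
      using c w by (intro state_conjugation_bound[OF \<phi>]) simp_all
    also have "\<dots> \<le> Re (\<phi> (star A ?w \<otimes> ?w)) * 1"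
      using c cstar_identity[of "star A c"] cnorm_nonneg[of c] positive_functional_square(2)[OF state_positive[OF \<phi>] w]
      by (intro mult_left_mono) (simp_all add: abs_square_le_1)
    finally show ?thesis using complex_Re_le_cmod[of "\<phi> (star A ?w \<otimes> (c \<otimes> star A c) \<otimes> ?w)"] by linarith
  qed
  ultimately show ?thesis
    using positive_functional_square(2)[OF state_positive[OF \<phi>] w] by simp
qed

definition norm2 :: "('a \<Rightarrow> complex) \<Rightarrow> 'a \<Rightarrow> real" where
  "norm2 \<phi> x = sqrt (Re (\<phi> (star A x \<otimes> x)))"

lemma seminorm_norm2:
  assumes \<phi>: "\<phi> \<in> states A"
  shows "seminorm (norm2 \<phi>)"
  unfolding seminorm_def
proof (intro conjI ballI allI)
  note lin = functional_simps[OF state_linear[OF \<phi>]] and pos = state_positive[OF \<phi>]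
  fix x assume x: "x \<in> carrier A"
  have sq: "(norm2 \<phi> z)\<^sup>2 = Re (\<phi> (star A z \<otimes> z))" if "z \<in> carrier A" for z
    using positive_functional_square(2)[OF pos that] by (simp add: norm2_def)
  show "norm2 \<phi> (c \<odot> x) = cmod c * norm2 \<phi> x" for c
  proof -
    have "\<phi> (star A (c \<odot> x) \<otimes> (c \<odot> x)) = complex_of_real ((cmod c)\<^sup>2) * \<phi> (star A x \<otimes> x)"
      using x by (simp add: cstar_simps lin complex_norm_square[symmetric] mult.commute[of "cnj c"])
    then show ?thesis by (simp add: norm2_def real_sqrt_mult)
  qed
  fix y assume y: "y \<in> carrier A"
  have "cmod (\<phi> (star A x \<otimes> y)) \<le> norm2 \<phi> x * norm2 \<phi> y"
    using real_le_rsqrt[OF Cauchy_Schwarz[OF pos x y]] by (simp add: norm2_def real_sqrt_mult)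
  then have cs: "Re (\<phi> (star A x \<otimes> y)) \<le> norm2 \<phi> x * norm2 \<phi> y"
    using complex_Re_le_cmod order_trans by blast
  have "(norm2 \<phi> (x \<oplus> y))\<^sup>2 = Re (\<phi> (star A x \<otimes> x)) + 2 * Re (\<phi> (star A x \<otimes> y)) + Re (\<phi> (star A y \<otimes> y))"
    using positive_functional_add_square[OF pos x y, of 1] x y positive_functional_hermitian[OF pos x y]
    by (simp add: sq)
  also have "\<dots> \<le> (norm2 \<phi> x + norm2 \<phi> y)\<^sup>2"
    using cs x y by (simp add: power2_sum sq)
  finally show "norm2 \<phi> (x \<oplus> y) \<le> norm2 \<phi> x + norm2 \<phi> y"
  proof (rule power2_le_imp_le)
    show "0 \<le> norm2 \<phi> x + norm2 \<phi> y"
      using positive_functional_square(2)[OF pos x] positive_functional_square(2)[OF pos y]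
      by (simp add: norm2_def)
  qed
qed

text \<open>
  For \<open>k = 1 - c\<^sup>*c\<close> all powers of \<open>k\<close> have Hilbert norm at most 1. They lie in a
  finite-dimensional subspace, where the C*-norm is dominated by the Hilbert norm of a faithful
  state. Hence \<open>\<parallel>k\<parallel>\<^sup>m = \<parallel>k\<^sup>m\<parallel>\<close> is bounded along the powers \<open>m\<close> of 2, that is, \<open>\<parallel>k\<parallel> \<le> 1\<close>.
  In this form the spectral positivity of \<open>c\<^sup>*c\<close> enters.
\<close>

lemma cnorm_one_minus_square_le_1:
  assumes \<phi>: "\<phi> \<in> states A" and faithful: "\<And>a. a \<in> carrier A \<Longrightarrow> \<phi> (star A a \<otimes> a) = 0 \<Longrightarrow> a = \<zero>"
    and c: "c \<in> carrier A" "cnorm A c \<le> 1" and I: "finite I" "v \<in> I \<rightarrow> carrier A"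
    and span: "\<And>n::nat. \<exists>d. (\<one> \<ominus> star A c \<otimes> c) [^] n = lincomb v I d"
  shows "cnorm A (\<one> \<ominus> star A c \<otimes> c) \<le> 1"
proof -
  define k where "k = \<one> \<ominus> star A c \<otimes> c"
  have kc: "k \<in> carrier A" and ks: "k \<in> self_adjoint A"
    using c by (simp_all add: k_def self_adjoint_def cstar_simps)
  have "norm_on (norm2 \<phi>)"
    unfolding norm_on_def
  proof (intro conjI ballI impI seminorm_norm2[OF \<phi>])
    fix a assume a: "a \<in> carrier A" "norm2 \<phi> a = 0"
    then show "a = \<zero>"
      using positive_functional_square(1)[OF state_positive[OF \<phi>] a(1)] faithful[of a]
      by (simp add: norm2_def complex_eq_iff complex_is_Real_iff)
  qed
  from norm_dominates_seminorm[OF this norm_on_seminorm[OF norm_on_cnorm] I] obtain K where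
    K: "0 \<le> K" "\<forall>d. cnorm A (lincomb v I d) \<le> K * norm2 \<phi> (lincomb v I d)"
    by (elim exE conjE) (rule that)
  have contract: "norm2 \<phi> (k [^] n) \<le> 1" for n :: nat
  proof (induction n)
    case 0 show ?case by (simp add: norm2_def state_one[OF \<phi>])
  next
    case (Suc n)
    then show ?case using state_square_contract[OF \<phi> c, of "k [^] n"] kc
      unfolding norm2_def pow_Suc_left[OF kc] by (simp add: k_def[symmetric])
  qed
  have "cnorm A k ^ (2 ^ n) \<le> K * 1 ^ (2 ^ n)" for n
  proof -
    have "cnorm A (k [^] (2 ^ n :: nat)) \<le> K * norm2 \<phi> (k [^] (2 ^ n :: nat))"
    proof -
      obtain d where "k [^] (2 ^ n :: nat) = lincomb v I d"
        using span[of "2 ^ n"] unfolding k_def[symmetric] by (elim exE) (rule that)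
      then show ?thesis using spec[OF K(2), of d] by simp
    qed
    also have "\<dots> \<le> K * 1" using contract K(1) by (rule mult_left_mono)
    finally show ?thesis by (simp add: cnorm_pow_self_adjoint[OF ks])
  qed
  then show ?thesis unfolding k_def[symmetric]
    by (rule le_if_powers_le[rotated 2]) (simp_all add: cnorm_nonneg kc)
qed

end

section \<open>Lip-norms from towers of finite rank projections\<close>

context cstar_algebra
begin

lemma self_adjoint_carrier: "a \<in> self_adjoint A \<Longrightarrow> a \<in> carrier A"
  by (simp add: self_adjoint_def)

lemma self_adjoint_one: "\<one> \<in> self_adjoint A"
  by (simp add: self_adjoint_def)

lemma self_adjoint_add: "\<lbrakk>a \<in> self_adjoint A; b \<in> self_adjoint A\<rbrakk> \<Longrightarrow> a \<oplus> b \<in> self_adjoint A"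
  by (simp add: self_adjoint_def star_add)

lemma self_adjoint_smult: "a \<in> self_adjoint A \<Longrightarrow> complex_of_real t \<odot> a \<in> self_adjoint A"
  by (simp add: self_adjoint_def star_smult)

lemma self_adjoint_jordan: "\<lbrakk>a \<in> self_adjoint A; b \<in> self_adjoint A\<rbrakk> \<Longrightarrow> jordan_product A a b \<in> self_adjoint A"
  by (simp add: self_adjoint_def jordan_product_def cstar_simps)

lemma self_adjoint_lie: "\<lbrakk>a \<in> self_adjoint A; b \<in> self_adjoint A\<rbrakk> \<Longrightarrow> lie_product A a b \<in> self_adjoint A"
  by (simp add: self_adjoint_def lie_product_def cstar_simps)

lemma Cartesian_decomposition:
  assumes "a \<in> carrier A"
  obtains x y where "x \<in> self_adjoint A" "y \<in> self_adjoint A" "a = x \<oplus> \<i> \<odot> y"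
proof
  let ?x = "(1 / 2) \<odot> (a \<oplus> star A a)" and ?y = "(1 / (2 * \<i>)) \<odot> (a \<ominus> star A a)"
  show "?x \<in> self_adjoint A" "?y \<in> self_adjoint A"
    using assms by (simp_all add: self_adjoint_def cstar_simps)
  have "a = (1 / 2) \<odot> a \<oplus> (1 / 2) \<odot> a"
    using assms smult_add_left[of a "1 / 2" "1 / 2"] by simp
  then show "a = ?x \<oplus> \<i> \<odot> ?y"
    using assms smult_cancel[of "(1/2) \<odot> star A a"] by (simp add: cstar_simps)
qed

lemma functional_lincomb:
  assumes f: "linear_map A complex_cstar f" and "finite I" "v \<in> I \<rightarrow> carrier A"
  shows "f (lincomb v I c) = (\<Sum>i\<in>I. c i * f (v i))"
  using assms(2,3)
proof (induction I)
  case empty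
  then show ?case
    using linear_map_zero[OF complex_module_axioms complex_module_complex f] by simp
next
  case (insert i I)
  then have "lincomb v (insert i I) c = c i \<odot> v i \<oplus> lincomb v I c"
    by (intro lincomb_insert)
  then show ?case using insert by (simp add: functional_simps[OF f] Pi_iff)
qed

end

text \<open>
  The subalgebras enter only as the ranges of the maps \<open>E n\<close>: the inclusions between them are the
  axiom \<open>E_tower\<close>, and closure under products is \<open>E_mult\<close>. The seminorm \<open>L\<close> is prescribed on
  self-adjoint elements only, so that \<open>lip_norm A E \<beta> \<circ> \<iota> n\<close> is an instance on \<open>F n\<close>.
\<close>

locale finite_rank_tower = cstar_algebra A for A :: "'a cstar" (structure) +
  fixes E :: "nat \<Rightarrow> 'a \<Rightarrow> 'a" and \<beta> :: "nat \<Rightarrow> real" and L :: "'a \<Rightarrow> ennreal"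
  assumes E_linear: "linear_map A A (E n)"
    and E_contractive: "a \<in> carrier A \<Longrightarrow> cnorm A (E n a) \<le> cnorm A a"
    and E_self_adjoint: "a \<in> self_adjoint A \<Longrightarrow> E n a \<in> self_adjoint A"
    and E_mult: "\<lbrakk>a \<in> carrier A; b \<in> carrier A\<rbrakk> \<Longrightarrow> E n (E n a \<otimes> E n b) = E n a \<otimes> E n b"
    and E_tower: "\<lbrakk>n \<le> m; a \<in> carrier A\<rbrakk> \<Longrightarrow> E m (E n a) = E n a"
    and E_0_scalar: "a \<in> carrier A \<Longrightarrow> \<exists>c. E 0 a = c \<odot> \<one>"
    and E_one: "E n \<one> = \<one>"
    and E_finite_rank: "\<exists>I v. finite I \<and> v \<in> I \<rightarrow> carrier A \<and>
      (\<forall>a\<in>carrier A. \<exists>c. E n a = lincomb (v :: 'a \<Rightarrow> 'a) I c)"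
    and E_dense: "\<lbrakk>a \<in> carrier A; 0 < e\<rbrakk> \<Longrightarrow> \<exists>n. cnorm A (a \<ominus> E n a) < e"
    and \<beta>_pos: "0 < \<beta> n"
    and \<beta>_lim: "\<beta> \<longlonglongrightarrow> 0"
    and L_eq_lip_norm: "a \<in> self_adjoint A \<Longrightarrow> L a = lip_norm A E \<beta> a"
begin

lemma E_closed [simp]: "a \<in> carrier A \<Longrightarrow> E n a \<in> carrier A"
  using E_linear[of n] by (auto simp: linear_map_def)

lemma E_add: "\<lbrakk>a \<in> carrier A; b \<in> carrier A\<rbrakk> \<Longrightarrow> E n (a \<oplus> b) = E n a \<oplus> E n b"
  and E_smult: "a \<in> carrier A \<Longrightarrow> E n (c \<odot> a) = c \<odot> E n a"
  using E_linear[of n] by (auto simp: linear_map_def)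

lemma E_minus: "\<lbrakk>a \<in> carrier A; b \<in> carrier A\<rbrakk> \<Longrightarrow> E n (a \<ominus> b) = E n a \<ominus> E n b"
  by (simp add: minus_eq_add_smult E_add E_smult)

definition defect :: "nat \<Rightarrow> 'a \<Rightarrow> real" where
  "defect n a = cnorm A (a \<ominus> E n a)"

lemma seminorm_defect: "seminorm (defect n)"
  unfolding seminorm_def
proof (intro conjI ballI allI)
  fix a b c assume a: "a \<in> carrier A"
  have "c \<odot> a \<ominus> E n (c \<odot> a) = c \<odot> (a \<ominus> E n a)"
    using a by (simp add: E_smult cstar_simps)
  then show "defect n (c \<odot> a) = cmod c * defect n a"
    using a by (simp add: defect_def cnorm_smult)
  assume b: "b \<in> carrier A"
  have "(a \<oplus> b) \<ominus> E n (a \<oplus> b) = (a \<ominus> E n a) \<oplus> (b \<ominus> E n b)"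
    using a b by (simp add: E_add cstar_simps)
  then show "defect n (a \<oplus> b) \<le> defect n a + defect n b"
    using a b by (simp add: defect_def cnorm_add)
qed

lemmas defect_add = seminormD(2)[OF seminorm_defect] and defect_smult = seminormD(1)[OF seminorm_defect]
  and defect_nonneg = seminorm_nonneg[OF seminorm_defect]

lemma defect_minus: "\<lbrakk>a \<in> carrier A; b \<in> carrier A\<rbrakk> \<Longrightarrow> defect n (a \<ominus> b) \<le> defect n a + defect n b"
  using defect_add[of a "(-1) \<odot> b" n] by (simp add: minus_eq_add_smult defect_smult)

lemma defect_E: "\<lbrakk>m \<le> n; a \<in> carrier A\<rbrakk> \<Longrightarrow> defect n (E m a) = 0"
  by (simp add: defect_def E_tower minus_eq_zero_iff[THEN iffD2])

lemma defect_le_cnorm: "a \<in> carrier A \<Longrightarrow> defect n a \<le> 2 * cnorm A a"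
  using cnorm_minus[of a "E n a"] E_contractive[of a n] by (simp add: defect_def)

text \<open>
  Both \<open>ab\<close> and \<open>E\<^sub>n(ab)\<close> are close to \<open>E\<^sub>n(a) E\<^sub>n(b)\<close>, which \<open>E\<^sub>n\<close> fixes; this is the source of
  the factor 2 in the Leibniz inequality.
\<close>

lemma defect_mult:
  assumes a: "a \<in> carrier A" and b: "b \<in> carrier A"
  shows "defect n (a \<otimes> b) \<le> 2 * (cnorm A a * defect n b + cnorm A b * defect n a)"
proof -
  let ?e = "E n a \<otimes> E n b"
  have near: "cnorm A (a \<otimes> b \<ominus> ?e) \<le> cnorm A a * defect n b + cnorm A b * defect n a"
  proof -
    have "a \<otimes> b \<ominus> ?e = a \<otimes> (b \<ominus> E n b) \<oplus> (a \<ominus> E n a) \<otimes> E n b"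
      using a b by (simp add: cstar_simps)
    then have "cnorm A (a \<otimes> b \<ominus> ?e) \<le> cnorm A (a \<otimes> (b \<ominus> E n b)) + cnorm A ((a \<ominus> E n a) \<otimes> E n b)"
      using a b by (simp add: cnorm_add)
    also have "cnorm A (a \<otimes> (b \<ominus> E n b)) \<le> cnorm A a * defect n b"
      using a b by (simp add: defect_def cnorm_mult)
    also have "cnorm A ((a \<ominus> E n a) \<otimes> E n b) \<le> defect n a * cnorm A (E n b)"
      using a b by (simp add: defect_def cnorm_mult)
    also have "defect n a * cnorm A (E n b) \<le> defect n a * cnorm A b"
      using a b by (intro mult_left_mono E_contractive defect_nonneg)
    finally show ?thesis by (simp add: mult.commute)
  qed
  have "cnorm A (?e \<ominus> E n (a \<otimes> b)) \<le> cnorm A (a \<otimes> b \<ominus> ?e)"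
  proof -
    have "?e \<ominus> E n (a \<otimes> b) = E n (?e \<ominus> a \<otimes> b)"
      using a b by (simp add: E_minus E_mult)
    then show ?thesis
      using a b E_contractive[of "?e \<ominus> a \<otimes> b" n] by (simp add: cnorm_minus_commute)
  qed
  moreover have "defect n (a \<otimes> b) \<le> cnorm A (a \<otimes> b \<ominus> ?e) + cnorm A (?e \<ominus> E n (a \<otimes> b))"
    unfolding defect_def using a b by (intro cnorm_triangle) simp_all
  ultimately have "defect n (a \<otimes> b) \<le> 2 * cnorm A (a \<otimes> b \<ominus> ?e)" by simp
  also have "\<dots> \<le> 2 * (cnorm A a * defect n b + cnorm A b * defect n a)"
    using near by simp
  finally show ?thesis .
qed

lemma defect_jordan_lie:
  assumes a: "a \<in> carrier A" and b: "b \<in> carrier A"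
  shows "defect n (jordan_product A a b) \<le> 2 * (cnorm A a * defect n b + cnorm A b * defect n a)"
    "defect n (lie_product A a b) \<le> 2 * (cnorm A a * defect n b + cnorm A b * defect n a)"
  using defect_mult[OF a b, of n] defect_mult[OF b a, of n] a b
    defect_add[of "a \<otimes> b" "b \<otimes> a" n] defect_minus[of "a \<otimes> b" "b \<otimes> a" n]
  by (simp_all add: jordan_product_def lie_product_def defect_smult norm_divide norm_mult)

lemma L_eq: "a \<in> self_adjoint A \<Longrightarrow> L a = (SUP n. ennreal (defect n a / \<beta> n))"
  by (simp add: L_eq_lip_norm lip_norm_def defect_def)

lemma L_le_iff:
  assumes "a \<in> self_adjoint A" "0 \<le> r"
  shows "L a \<le> ennreal r \<longleftrightarrow> (\<forall>n. defect n a \<le> r * \<beta> n)"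
  using assms by (simp add: L_eq SUP_le_iff pos_divide_le_eq[OF \<beta>_pos])

lemma lip_domE:
  assumes "a \<in> lip_dom A L"
  obtains r where "a \<in> self_adjoint A" "0 \<le> r" "L a = ennreal r" "\<And>n. defect n a \<le> r * \<beta> n"
proof -
  have a: "a \<in> self_adjoint A" "L a < \<infinity>" using assms by (auto simp: lip_dom_def)
  then obtain r where r: "0 \<le> r" "L a = ennreal r" by (cases "L a") auto
  then show thesis using L_le_iff[OF a(1) r(1)] by (intro that[OF a(1) r]) simp
qed

lemma lip_domI:
  assumes "a \<in> self_adjoint A" "0 \<le> r" "\<And>n. defect n a \<le> r * \<beta> n"
  shows "a \<in> lip_dom A L" "L a \<le> ennreal r"
proof -
  show le: "L a \<le> ennreal r" using L_le_iff[OF assms(1,2)] assms(3) by simp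
  show "a \<in> lip_dom A L" unfolding lip_dom_def using le_less_trans[OF le ennreal_less_top] assms(1) by simp
qed

lemma lip_ball_defect: "a \<in> lip_ball A L \<Longrightarrow> a \<in> self_adjoint A \<and> defect n a \<le> \<beta> n"
  using L_le_iff[of a 1] by (auto simp: lip_ball_def)

text \<open>Only the defects with index below \<open>m\<close> can be nonzero.\<close>

lemma E_lip_dom:
  assumes a: "a \<in> self_adjoint A"
  shows "E m a \<in> lip_dom A L"
proof (rule lip_domI(1))
  have c: "a \<in> carrier A" using a by (rule self_adjoint_carrier)
  let ?r = "\<Sum>k<m. defect k (E m a) / \<beta> k"
  have nonneg: "0 \<le> defect k (E m a) / \<beta> k" for k
    using defect_nonneg[of "E m a" k] c \<beta>_pos[of k] by simp
  show "E m a \<in> self_adjoint A" using a by (rule E_self_adjoint)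
  show "0 \<le> ?r" by (intro sum_nonneg nonneg)
  show "defect n (E m a) \<le> ?r * \<beta> n" for n
  proof (cases "m \<le> n")
    case True
    then show ?thesis using defect_E[OF True c] \<open>0 \<le> ?r\<close> \<beta>_pos[of n] by simp
  next
    case False
    then have "defect n (E m a) / \<beta> n \<le> ?r"
      by (intro member_le_sum nonneg) auto
    then show ?thesis using \<beta>_pos[of n] by (simp add: pos_divide_le_eq)
  qed
qed

lemma L_add:
  assumes "a \<in> lip_dom A L" "b \<in> lip_dom A L"
  shows "a \<oplus> b \<in> lip_dom A L" "L (a \<oplus> b) \<le> L a + L b"
proof -
  from assms(1) obtain r where a: "a \<in> self_adjoint A" "0 \<le> r" "L a = ennreal r" "\<And>n. defect n a \<le> r * \<beta> n"
    by (rule lip_domE) (rule that)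
  from assms(2) obtain s where b: "b \<in> self_adjoint A" "0 \<le> s" "L b = ennreal s" "\<And>n. defect n b \<le> s * \<beta> n"
    by (rule lip_domE) (rule that)
  have "defect n (a \<oplus> b) \<le> (r + s) * \<beta> n" for n
    using defect_add[of a b n] a(4)[of n] b(4)[of n] a(1) b(1)
    by (simp add: self_adjoint_carrier distrib_right)
  from lip_domI[OF self_adjoint_add[OF a(1) b(1)] _ this]
  show "a \<oplus> b \<in> lip_dom A L" "L (a \<oplus> b) \<le> L a + L b"
    using a(2,3) b(2,3) by simp_all
qed

lemma L_smult:
  assumes "a \<in> self_adjoint A"
  shows "L (complex_of_real t \<odot> a) = ennreal \<bar>t\<bar> * L a"
  using assms
  by (simp add: L_eq self_adjoint_smult defect_smult self_adjoint_carrier SUP_mult_left_ennreal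
      times_divide_eq_right[symmetric] ennreal_mult' del: times_divide_eq_right)

lemma L_jordan_lie:
  assumes "a \<in> lip_dom A L" "b \<in> lip_dom A L" and p: "p = jordan_product A a b \<or> p = lie_product A a b"
  shows "p \<in> lip_dom A L" "L p \<le> 2 * (ennreal (cnorm A a) * L b + ennreal (cnorm A b) * L a)"
proof -
  from assms(1) obtain r where a: "a \<in> self_adjoint A" "0 \<le> r" "L a = ennreal r" "\<And>n. defect n a \<le> r * \<beta> n"
    by (rule lip_domE) (rule that)
  from assms(2) obtain s where b: "b \<in> self_adjoint A" "0 \<le> s" "L b = ennreal s" "\<And>n. defect n b \<le> s * \<beta> n"
    by (rule lip_domE) (rule that)
  note c = self_adjoint_carrier[OF a(1)] self_adjoint_carrier[OF b(1)]
  let ?R = "2 * (cnorm A a * s + cnorm A b * r)"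
  have R: "0 \<le> ?R" using a(2) b(2) c by (simp add: cnorm_nonneg)
  have "defect n p \<le> ?R * \<beta> n" for n
  proof -
    have "defect n p \<le> 2 * (cnorm A a * defect n b + cnorm A b * defect n a)"
      using p defect_jordan_lie[OF c, of n] by auto
    also have "\<dots> \<le> 2 * (cnorm A a * (s * \<beta> n) + cnorm A b * (r * \<beta> n))"
      using a(4) b(4) c by (intro mult_left_mono add_mono) (simp_all add: cnorm_nonneg)
    finally show ?thesis by (simp add: algebra_simps)
  qed
  moreover have "p \<in> self_adjoint A"
    using p self_adjoint_jordan[OF a(1) b(1)] self_adjoint_lie[OF a(1) b(1)] by auto
  ultimately have "p \<in> lip_dom A L" "L p \<le> ennreal ?R"
    using lip_domI[OF _ R] by blast+
  moreover have "ennreal ?R = 2 * (ennreal (cnorm A a) * L b + ennreal (cnorm A b) * L a)"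
    using a(2,3) b(2,3) c by (simp add: ennreal_mult cnorm_nonneg)
  ultimately show "p \<in> lip_dom A L" "L p \<le> 2 * (ennreal (cnorm A a) * L b + ennreal (cnorm A b) * L a)"
    by simp_all
qed

lemma L_kernel: "{a \<in> self_adjoint A. L a = 0} = range (\<lambda>t::real. complex_of_real t \<odot> \<one>)"
proof (intro equalityI subsetI)
  fix a assume "a \<in> {a \<in> self_adjoint A. L a = 0}"
  then have a: "a \<in> self_adjoint A" "L a \<le> ennreal 0" and c: "a \<in> carrier A"
    by (auto simp: self_adjoint_carrier)
  have "defect 0 a \<le> 0" using L_le_iff[OF a(1), of 0] a(2) by simp
  then have "a = E 0 a"
    using c cnorm_nonneg[of "a \<ominus> E 0 a"] by (simp add: defect_def cnorm_eq_zero_iff minus_eq_zero_iff)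
  then obtain z where z: "a = z \<odot> \<one>" using E_0_scalar[OF c] by metis
  have "(cnj z - z) \<odot> \<one> = \<zero>"
    using a(1) smult_add_left[of \<one> "cnj z" "- z"] smult_cancel(1)[of "z \<odot> \<one>"]
    by (simp add: self_adjoint_def z star_smult smult_smult)
  then have "cnorm A ((cnj z - z) \<odot> \<one>) = 0" by simp
  then have "cnj z = z" by (simp add: cnorm_smult)
  then have "a = complex_of_real (Re z) \<odot> \<one>" using z by (simp add: Reals_cnj_iff[symmetric])
  then show "a \<in> range (\<lambda>t::real. complex_of_real t \<odot> \<one>)" by blast
next
  fix a assume "a \<in> range (\<lambda>t::real. complex_of_real t \<odot> \<one>)"
  then obtain t :: real where t: "a = complex_of_real t \<odot> \<one>" by blast
  have sa: "a \<in> self_adjoint A" unfolding t by (intro self_adjoint_smult self_adjoint_one)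
  have "defect n a = 0" for n
    by (simp add: t defect_def E_smult E_one minus_eq_zero_iff[THEN iffD2])
  then show "a \<in> {a \<in> self_adjoint A. L a = 0}"
    using sa L_le_iff[OF sa, of 0] by simp
qed

lemma jordan_lie_subalgebra_lip_dom: "jordan_lie_subalgebra A (lip_dom A L)"
  unfolding jordan_lie_subalgebra_def
proof (intro conjI ballI allI)
  have "\<one> \<in> lip_dom A L" using E_lip_dom[OF self_adjoint_one, of 0] by (simp add: E_one)
  then show "lip_dom A L \<noteq> {}" by blast
  show "lip_dom A L \<subseteq> self_adjoint A" by (auto simp: lip_dom_def)
next
  fix a b assume ab: "a \<in> lip_dom A L" "b \<in> lip_dom A L"
  show "a \<oplus> b \<in> lip_dom A L" "jordan_product A a b \<in> lip_dom A L" "lie_product A a b \<in> lip_dom A L"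
    using L_add(1)[OF ab] L_jordan_lie(1)[OF ab] by simp_all
next
  fix a and t :: real assume "a \<in> lip_dom A L"
  then show "complex_of_real t \<odot> a \<in> lip_dom A L"
    by (auto simp: lip_dom_def self_adjoint_smult L_smult ennreal_mult_less_top)
qed

lemma lip_dom_dense: "self_adjoint A \<subseteq> norm_topology A closure_of lip_dom A L"
proof
  interpret D: Metric_space "carrier A" "cstar_dist A" by (rule Metric_space_cstar_dist)
  fix a assume a: "a \<in> self_adjoint A"
  then have c: "a \<in> carrier A" by (rule self_adjoint_carrier)
  have "\<exists>y\<in>lip_dom A L. y \<in> D.mball a r" if "0 < r" for r
  proof -
    obtain n where "cnorm A (a \<ominus> E n a) < r" using E_dense[OF c \<open>0 < r\<close>] by blast
    then show ?thesis using c E_lip_dom[OF a, of n] by (auto simp: cstar_dist_def)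
  qed
  then show "a \<in> norm_topology A closure_of lip_dom A L"
    using c unfolding norm_topology_def D.metric_closure_of by blast
qed

text \<open>\<open>L\<close> is a supremum of continuous functions.\<close>

lemma L_lower_semicontinuous:
  "closedin (subtopology (norm_topology A) (self_adjoint A)) {a \<in> self_adjoint A. L a \<le> r}"
proof -
  interpret D: Metric_space "carrier A" "cstar_dist A" by (rule Metric_space_cstar_dist)
  define C where "C = {a \<in> carrier A. \<forall>n. ennreal (defect n a / \<beta> n) \<le> r}"
  have "closedin (norm_topology A) C"
    unfolding norm_topology_def D.closedin_metric
  proof (intro conjI allI impI)
    show "C \<subseteq> carrier A" by (auto simp: C_def)
    fix x assume "x \<in> carrier A - C"
    then obtain n where x: "x \<in> carrier A" and gt: "r < ennreal (defect n x / \<beta> n)"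
      by (auto simp: C_def not_le)
    then obtain q where q: "0 \<le> q" "r = ennreal q" by (cases r) auto
    have lt: "q * \<beta> n < defect n x"
      using gt q(1) \<beta>_pos[of n] unfolding q(2) by (simp add: ennreal_less_iff pos_less_divide_eq)
    let ?\<rho> = "(defect n x - q * \<beta> n) / 2"
    have "y \<notin> C" if "y \<in> D.mball x ?\<rho>" for y
    proof -
      have y: "y \<in> carrier A" "cnorm A (x \<ominus> y) < ?\<rho>" using that x by (auto simp: cstar_dist_def)
      have "x = y \<oplus> (x \<ominus> y)" using x y by (simp add: cstar_simps)
      then have "defect n x \<le> defect n y + defect n (x \<ominus> y)"
        using defect_add[of y "x \<ominus> y" n] x y by simp
      also have "\<dots> < defect n y + (defect n x - q * \<beta> n)"
        using defect_le_cnorm[of "x \<ominus> y" n] x y by simp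
      finally have "\<not> ennreal (defect n y / \<beta> n) \<le> r"
        using q(1) \<beta>_pos[of n] by (simp add: q(2) pos_divide_le_eq)
      then show ?thesis by (auto simp: C_def)
    qed
    then show "\<exists>\<rho>>0. disjnt C (D.mball x \<rho>)"
      using lt by (intro exI[of _ ?\<rho>]) (auto simp: disjnt_def)
  qed
  moreover have "{a \<in> self_adjoint A. L a \<le> r} = C \<inter> self_adjoint A"
    by (auto simp: C_def L_eq SUP_le_iff self_adjoint_carrier)
  ultimately show ?thesis by (auto simp: closedin_subtopology)
qed

end


section \<open>The Monge-Kantorovich metric of a tower\<close>

context finite_rank_tower
begin

definition mk :: "('a \<Rightarrow> complex) \<Rightarrow> ('a \<Rightarrow> complex) \<Rightarrow> real" where
  "mk \<phi> \<psi> = enn2real (mk_dist A L \<phi> \<psi>)"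

lemma state_E_0:
  assumes "\<phi> \<in> states A" "\<psi> \<in> states A" "a \<in> carrier A"
  shows "\<phi> (E 0 a) = \<psi> (E 0 a)"
proof -
  obtain c where "E 0 a = c \<odot> \<one>" using E_0_scalar[OF assms(3)] by blast
  then show ?thesis
    using assms(1,2) by (simp add: functional_simps[OF state_linear] state_one)
qed

text \<open>
  States agree on scalars, so on the Lip-ball their difference only sees \<open>a - E\<^sub>0(a)\<close>, whose norm is
  at most \<open>\<beta> 0\<close>.
\<close>

lemma states_diff_lip_ball:
  assumes "\<phi> \<in> states A" "\<psi> \<in> states A" "a \<in> lip_ball A L"
  shows "cmod (\<phi> a - \<psi> a) \<le> 2 * \<beta> 0"
proof -
  have c: "a \<in> carrier A" and d: "defect 0 a \<le> \<beta> 0"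
    using lip_ball_defect[OF assms(3), of 0] by (auto simp: self_adjoint_carrier)
  let ?y = "a \<ominus> E 0 a"
  have "\<phi> a - \<psi> a = \<phi> ?y - \<psi> ?y"
    using c state_E_0[OF assms(1,2) c] assms(1,2) by (simp add: functional_simps[OF state_linear])
  also have "cmod \<dots> \<le> cmod (\<phi> ?y) + cmod (\<psi> ?y)" by (rule norm_triangle_ineq4)
  also have "\<dots> \<le> 2 * \<beta> 0"
    using state_le_cnorm[OF assms(1), of ?y] state_le_cnorm[OF assms(2), of ?y] c d
    by (simp add: defect_def)
  finally show ?thesis .
qed

lemma mk_dist_finite:
  assumes "\<phi> \<in> states A" "\<psi> \<in> states A"
  shows "mk_dist A L \<phi> \<psi> < \<infinity>"
proof -
  have "mk_dist A L \<phi> \<psi> \<le> ennreal (2 * \<beta> 0)"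
    unfolding mk_dist_def by (intro SUP_least ennreal_leI states_diff_lip_ball assms)
  then show ?thesis by (rule le_less_trans) simp
qed

lemma le_mk:
  assumes "\<phi> \<in> states A" "\<psi> \<in> states A" "a \<in> lip_ball A L"
  shows "cmod (\<phi> a - \<psi> a) \<le> mk \<phi> \<psi>"
proof -
  have "ennreal (cmod (\<phi> a - \<psi> a)) \<le> mk_dist A L \<phi> \<psi>"
    unfolding mk_dist_def using assms(3) by (rule SUP_upper)
  then show ?thesis
    using mk_dist_finite[OF assms(1,2)] unfolding mk_def
    by (cases "mk_dist A L \<phi> \<psi>") auto
qed

lemma mk_le:
  assumes "0 \<le> r" "\<And>a. a \<in> lip_ball A L \<Longrightarrow> cmod (\<phi> a - \<psi> a) \<le> r"
  shows "mk \<phi> \<psi> \<le> r"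
proof -
  have "mk_dist A L \<phi> \<psi> \<le> ennreal r"
    unfolding mk_dist_def by (intro SUP_least ennreal_leI assms(2))
  then show ?thesis using assms(1) unfolding mk_def by (metis enn2real_mono enn2real_ennreal ennreal_less_top)
qed

lemma mk_nonneg: "0 \<le> mk \<phi> \<psi>"
  by (simp add: mk_def)

text \<open>Evaluation at any element is Lipschitz up to an arbitrarily small error, by density.\<close>

lemma states_diff_le_mk:
  assumes "a \<in> carrier A" "0 < e"
  shows "\<exists>l>0. \<forall>\<phi>\<in>states A. \<forall>\<psi>\<in>states A. cmod (\<phi> a - \<psi> a) \<le> e + l * mk \<phi> \<psi>"
proof -
  have sa: "\<exists>l>0. \<forall>\<phi>\<in>states A. \<forall>\<psi>\<in>states A. cmod (\<phi> a - \<psi> a) \<le> e + l * mk \<phi> \<psi>"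
    if a: "a \<in> self_adjoint A" and e: "0 < e" for a and e :: real
  proof -
    have c: "a \<in> carrier A" using a by (rule self_adjoint_carrier)
    from e have "0 < e / 2" by simp
    from E_dense[OF c this] obtain n where n: "cnorm A (a \<ominus> E n a) < e / 2" by blast
    from E_lip_dom[OF a] obtain r where r: "E n a \<in> self_adjoint A" "0 \<le> r" "L (E n a) = ennreal r"
      by (rule lip_domE) (rule that)
    define l where "l = r + 1"
    have l: "0 < l" using r(2) by (simp add: l_def)
    define b where "b = complex_of_real (1 / l) \<odot> E n a"
    have "L b = ennreal (r / l)"
      using l r(2) unfolding b_def L_smult[OF r(1)] r(3) by (simp add: ennreal_mult[symmetric])
    moreover have "r / l \<le> 1" using l by (simp add: l_def)
    ultimately have b: "b \<in> lip_ball A L"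
      using self_adjoint_smult[OF r(1), of "1 / l"] by (simp add: lip_ball_def b_def)
    have "cmod (\<phi> a - \<psi> a) \<le> e + l * mk \<phi> \<psi>" if st: "\<phi> \<in> states A" "\<psi> \<in> states A" for \<phi> \<psi>
    proof -
      note lin = functional_simps[OF state_linear[OF st(1)]] functional_simps[OF state_linear[OF st(2)]]
      have "cmod (\<phi> b - \<psi> b) \<le> mk \<phi> \<psi>" by (rule le_mk[OF st b])
      moreover have "\<phi> (E n a) - \<psi> (E n a) = complex_of_real l * (\<phi> b - \<psi> b)"
        using c l by (simp add: b_def lin field_simps)
      ultimately have "cmod (\<phi> (E n a) - \<psi> (E n a)) \<le> l * mk \<phi> \<psi>"
        using l by (simp add: norm_mult)
      moreover have "cmod (\<phi> (a \<ominus> E n a)) \<le> e / 2" "cmod (\<psi> (a \<ominus> E n a)) \<le> e / 2"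
        using state_le_cnorm[OF st(1), of "a \<ominus> E n a"] state_le_cnorm[OF st(2), of "a \<ominus> E n a"] c n by simp_all
      moreover have "\<phi> a - \<psi> a = (\<phi> (a \<ominus> E n a) - \<psi> (a \<ominus> E n a)) + (\<phi> (E n a) - \<psi> (E n a))"
        using c by (simp add: lin)
      ultimately show ?thesis
        using norm_triangle_ineq[of "\<phi> (a \<ominus> E n a) - \<psi> (a \<ominus> E n a)" "\<phi> (E n a) - \<psi> (E n a)"]
          norm_triangle_ineq4[of "\<phi> (a \<ominus> E n a)" "\<psi> (a \<ominus> E n a)"] by simp
    qed
    then show ?thesis using l by blast
  qed
  from assms(2) have e2: "0 < e / 2" by simp
  obtain x y where xy: "x \<in> self_adjoint A" "y \<in> self_adjoint A" "a = x \<oplus> \<i> \<odot> y"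
    using Cartesian_decomposition[OF assms(1)] .
  from sa[OF xy(1) e2] obtain l where l: "l > 0"
    "\<forall>\<phi>\<in>states A. \<forall>\<psi>\<in>states A. cmod (\<phi> x - \<psi> x) \<le> e / 2 + l * mk \<phi> \<psi>" by blast
  from sa[OF xy(2) e2] obtain m where m: "m > 0"
    "\<forall>\<phi>\<in>states A. \<forall>\<psi>\<in>states A. cmod (\<phi> y - \<psi> y) \<le> e / 2 + m * mk \<phi> \<psi>" by blast
  have "cmod (\<phi> a - \<psi> a) \<le> e + (l + m) * mk \<phi> \<psi>" if st: "\<phi> \<in> states A" "\<psi> \<in> states A" for \<phi> \<psi>
  proof -
    have "\<phi> a - \<psi> a = (\<phi> x - \<psi> x) + \<i> * (\<phi> y - \<psi> y)"
      using xy st by (simp add: functional_simps[OF state_linear] self_adjoint_carrier algebra_simps)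
    then have "cmod (\<phi> a - \<psi> a) \<le> cmod (\<phi> x - \<psi> x) + cmod (\<phi> y - \<psi> y)"
      using norm_triangle_ineq[of "\<phi> x - \<psi> x" "\<i> * (\<phi> y - \<psi> y)"] by (simp add: norm_mult)
    also have "\<dots> \<le> (e / 2 + l * mk \<phi> \<psi>) + (e / 2 + m * mk \<phi> \<psi>)"
      using l(2) m(2) st by (intro add_mono) blast+
    finally show ?thesis by (simp add: algebra_simps)
  qed
  then show ?thesis using l(1) m(1) by (intro exI[of _ "l + m"]) auto
qed

lemma Metric_space_mk: "Metric_space (states A) mk"
proof
  show "0 \<le> mk \<phi> \<psi>" for \<phi> \<psi> by (rule mk_nonneg)
  show "mk \<phi> \<psi> = mk \<psi> \<phi>" for \<phi> \<psi> by (simp add: mk_def mk_dist_def norm_minus_commute)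
next
  fix \<phi> \<psi> assume st: "\<phi> \<in> states A" "\<psi> \<in> states A"
  show "mk \<phi> \<psi> = 0 \<longleftrightarrow> \<phi> = \<psi>"
  proof
    assume zero: "mk \<phi> \<psi> = 0"
    have "\<phi> a = \<psi> a" if a: "a \<in> carrier A" for a
    proof -
      have "cmod (\<phi> a - \<psi> a) \<le> 0"
      proof (rule field_le_epsilon)
        fix e :: real assume "0 < e"
        from states_diff_le_mk[OF a this] st zero show "cmod (\<phi> a - \<psi> a) \<le> 0 + e" by fastforce
      qed
      then show ?thesis by simp
    qed
    then show "\<phi> = \<psi>" using st by (auto simp: states_def intro: extensionalityI)
  next
    assume "\<phi> = \<psi>"
    then have "mk \<phi> \<psi> \<le> 0" by (intro mk_le) simp_all
    then show "mk \<phi> \<psi> = 0" using mk_nonneg[of \<phi> \<psi>] by simp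
  qed
next
  fix \<phi> \<psi> \<rho> assume st: "\<phi> \<in> states A" "\<psi> \<in> states A" "\<rho> \<in> states A"
  show "mk \<phi> \<rho> \<le> mk \<phi> \<psi> + mk \<psi> \<rho>"
  proof (rule mk_le)
    show "0 \<le> mk \<phi> \<psi> + mk \<psi> \<rho>" using mk_nonneg[of \<phi> \<psi>] mk_nonneg[of \<psi> \<rho>] by simp
    fix a assume a: "a \<in> lip_ball A L"
    show "cmod (\<phi> a - \<rho> a) \<le> mk \<phi> \<psi> + mk \<psi> \<rho>"
      using le_mk[OF st(1,2) a] le_mk[OF st(2,3) a] norm_triangle_ineq[of "\<phi> a - \<psi> a" "\<psi> a - \<rho> a"] by simp
  qed
qed

lemma states_extensional: "states A \<subseteq> extensional (carrier A)"
  by (auto simp: states_def)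

lemma topspace_weak_star: "topspace (weak_star_topology A) = states A"
  using states_extensional by (auto simp: weak_star_topology_def PiE_iff extensional_def)

text \<open>
  Up to \<open>2 \<beta> n\<close> the difference of two states on the Lip-ball is determined by the image under \<open>E\<^sub>n\<close>
  of the ball of radius \<open>\<beta> 0\<close>, that is, by boundedly many coefficients in a finite-dimensional
  space. So finitely many evaluations control the metric up to an arbitrarily small error.
\<close>

lemma mk_le_finitely_many:
  assumes e: "0 < e"
  shows "\<exists>T v K. finite T \<and> v \<in> T \<rightarrow> carrier A \<and> 0 \<le> K \<and> (\<forall>\<phi>\<in>states A. \<forall>\<psi>\<in>states A.
    mk \<phi> \<psi> \<le> e + K * (\<Sum>t\<in>T. cmod (\<phi> ((v :: 'a \<Rightarrow> 'a) t) - \<psi> (v t))))"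
proof -
  from e have "0 < e / 2" by simp
  with \<beta>_lim obtain n where n: "\<beta> n < e / 2"
    by (metis (no_types, lifting) eventually_happens order_tendstoD(2) trivial_limit_sequentially)
  from E_finite_rank[of n] obtain I v where I: "finite I" "v \<in> I \<rightarrow> carrier A"
    and span: "\<forall>a\<in>carrier A. \<exists>c. E n a = lincomb (v :: 'a \<Rightarrow> 'a) I c"
    by (elim exE conjE) (rule that)
  from bounded_coefficients[OF norm_on_cnorm I] obtain T K where T: "T \<subseteq> I" "K \<ge> 0"
    "\<forall>c. \<exists>d. lincomb v I c = lincomb v T d \<and> (\<forall>i\<in>T. cmod (d i) \<le> K * cnorm A (lincomb v I c))"
    by (elim exE conjE) (rule that)
  have vT: "finite T" "v \<in> T \<rightarrow> carrier A" using T(1) I finite_subset by auto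
  have "mk \<phi> \<psi> \<le> e + K * \<beta> 0 * (\<Sum>t\<in>T. cmod (\<phi> (v t) - \<psi> (v t)))" (is "_ \<le> ?r")
    if st: "\<phi> \<in> states A" "\<psi> \<in> states A" for \<phi> \<psi>
  proof (rule mk_le)
    note lin = functional_simps[OF state_linear[OF st(1)]] functional_simps[OF state_linear[OF st(2)]]
    show "0 \<le> ?r" using e T(2) \<beta>_pos[of 0] by (intro add_nonneg_nonneg mult_nonneg_nonneg sum_nonneg) simp_all
    fix a assume a: "a \<in> lip_ball A L"
    then have c: "a \<in> carrier A" using lip_ball_defect self_adjoint_carrier by blast
    have d: "defect k a \<le> \<beta> k" for k using lip_ball_defect[OF a] by blast
    define y where "y = a \<ominus> E 0 a"
    have y: "y \<in> carrier A" "cnorm A y \<le> \<beta> 0" using c d[of 0] by (simp_all add: y_def defect_def)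
    have "y \<ominus> E n y = a \<ominus> E n a"
      using c by (simp add: y_def E_add E_smult E_tower cstar_simps)
    then have rest: "cnorm A (y \<ominus> E n y) < e / 2" using d[of n] n by (simp add: defect_def)
    from span[rule_format, OF y(1)] obtain c' where c': "E n y = lincomb v I c'" by (elim exE) (rule that)
    from spec[OF T(3), of c'] obtain b where
      b: "E n y = lincomb v T b" "\<forall>t\<in>T. cmod (b t) \<le> K * cnorm A (E n y)"
      unfolding c'[symmetric] by (elim exE conjE) (rule that)
    have "K * cnorm A (E n y) \<le> K * \<beta> 0"
      using E_contractive[OF y(1), of n] y(2) T(2) by (intro mult_left_mono) simp_all
    then have bK: "cmod (b t) \<le> K * \<beta> 0" if "t \<in> T" for t
      using bspec[OF b(2) that] by (rule order_trans[rotated])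
    have "\<phi> (E n y) - \<psi> (E n y) = (\<Sum>t\<in>T. b t * (\<phi> (v t) - \<psi> (v t)))"
      unfolding b(1) functional_lincomb[OF state_linear[OF st(1)] vT] functional_lincomb[OF state_linear[OF st(2)] vT]
      by (simp add: sum_subtractf right_diff_distrib)
    also have "cmod \<dots> \<le> (\<Sum>t\<in>T. cmod (b t * (\<phi> (v t) - \<psi> (v t))))" by (rule norm_sum)
    also have "\<dots> \<le> (\<Sum>t\<in>T. K * \<beta> 0 * cmod (\<phi> (v t) - \<psi> (v t)))"
      unfolding norm_mult by (intro sum_mono mult_right_mono bK) simp_all
    also have "\<dots> = K * \<beta> 0 * (\<Sum>t\<in>T. cmod (\<phi> (v t) - \<psi> (v t)))" by (simp add: sum_distrib_left)
    finally have main: "cmod (\<phi> (E n y) - \<psi> (E n y)) \<le> K * \<beta> 0 * (\<Sum>t\<in>T. cmod (\<phi> (v t) - \<psi> (v t)))" .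
    have small: "cmod (\<phi> (y \<ominus> E n y)) \<le> e / 2" "cmod (\<psi> (y \<ominus> E n y)) \<le> e / 2"
      using state_le_cnorm[OF st(1), of "y \<ominus> E n y"] state_le_cnorm[OF st(2), of "y \<ominus> E n y"] y(1) rest by simp_all
    have split: "\<phi> a - \<psi> a = (\<phi> (y \<ominus> E n y) - \<psi> (y \<ominus> E n y)) + (\<phi> (E n y) - \<psi> (E n y))"
      using c y(1) state_E_0[OF st c] by (simp add: lin) (simp add: y_def lin)
    show "cmod (\<phi> a - \<psi> a) \<le> ?r"
      unfolding split using main small norm_triangle_ineq[of "\<phi> (y \<ominus> E n y) - \<psi> (y \<ominus> E n y)" "\<phi> (E n y) - \<psi> (E n y)"]
        norm_triangle_ineq4[of "\<phi> (y \<ominus> E n y)" "\<psi> (y \<ominus> E n y)"] by linarith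
  qed
  moreover have "0 \<le> K * \<beta> 0" using T(2) \<beta>_pos[of 0] by simp
  ultimately show ?thesis using vT by (intro exI[of _ T] exI[of _ v] exI[of _ "K * \<beta> 0"]) simp
qed

lemma mk_metrizes_weak_star: "Metric_space.mtopology (states A) mk = weak_star_topology A"
proof -
  interpret S: Metric_space "states A" mk by (rule Metric_space_mk)
  have eval: "continuous_map (weak_star_topology A) euclidean (\<lambda>\<phi>. \<phi> a)" if "a \<in> carrier A" for a
    unfolding weak_star_topology_def
    by (intro continuous_map_from_subtopology continuous_map_product_projection that)
  have "continuous_map (weak_star_topology A) S.mtopology id"
    unfolding S.continuous_map_to_metric topspace_weak_star
  proof (intro ballI allI impI)
    fix \<phi> and e :: real assume \<phi>: "\<phi> \<in> states A" and e: "0 < e"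
    from e have "0 < e / 2" by simp
    from mk_le_finitely_many[OF this] obtain T v K where T: "finite T" "v \<in> T \<rightarrow> carrier A" "0 \<le> K"
      and le: "\<forall>\<phi>\<in>states A. \<forall>\<psi>\<in>states A.
        mk \<phi> \<psi> \<le> e / 2 + K * (\<Sum>t\<in>T. cmod (\<phi> ((v :: 'a \<Rightarrow> 'a) t) - \<psi> (v t)))"
      by (elim exE conjE) (rule that)
    define g where "g \<psi> = K * (\<Sum>t\<in>T. cmod (\<phi> (v t) - \<psi> (v t)))" for \<psi>
    define U where "U = {\<psi> \<in> topspace (weak_star_topology A). g \<psi> \<in> {..<e / 2}}"
    have "continuous_map (weak_star_topology A) euclidean g"
      unfolding g_def using T
      by (intro continuous_map_real_mult continuous_map_const[THEN iffD2] continuous_map_sum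
          continuous_map_norm continuous_map_diff eval) (auto simp: Pi_iff)
    then have "openin (weak_star_topology A) U"
      unfolding U_def by (intro openin_continuous_map_preimage[of _ euclidean]) auto
    moreover have "\<phi> \<in> U" using \<phi> e by (simp add: U_def g_def topspace_weak_star)
    moreover have "id \<psi> \<in> S.mball (id \<phi>) e" if "\<psi> \<in> U" for \<psi>
      using that le \<phi> by (fastforce simp: U_def g_def topspace_weak_star)
    ultimately show "\<exists>U. openin (weak_star_topology A) U \<and> \<phi> \<in> U \<and> (\<forall>\<psi>\<in>U. id \<psi> \<in> S.mball (id \<phi>) e)"
      by blast
  qed
  moreover have "continuous_map S.mtopology (weak_star_topology A) id"
  proof -
    have "continuous_map S.mtopology euclidean (\<lambda>\<phi>. \<phi> a)" if a: "a \<in> carrier A" for a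
    proof -
      have "\<exists>\<delta>>0. \<forall>\<psi>. \<psi> \<in> states A \<and> mk \<phi> \<psi> < \<delta> \<longrightarrow> dist (\<phi> a) (\<psi> a) < e"
        if \<phi>: "\<phi> \<in> states A" and e: "0 < e" for \<phi> and e :: real
      proof -
        from e have "0 < e / 2" by simp
        from states_diff_le_mk[OF a this] obtain l where
          l: "l > 0" "\<forall>\<phi>\<in>states A. \<forall>\<psi>\<in>states A. cmod (\<phi> a - \<psi> a) \<le> e / 2 + l * mk \<phi> \<psi>" by blast
        have "dist (\<phi> a) (\<psi> a) < e" if "\<psi> \<in> states A" "mk \<phi> \<psi> < e / (2 * l)" for \<psi>
        proof -
          have "l * mk \<phi> \<psi> < e / 2" using that(2) l(1) by (simp add: field_simps)
          then show ?thesis using l(2) \<phi> that(1) by (fastforce simp: dist_norm)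
        qed
        then show ?thesis using l(1) e by (intro exI[of _ "e / (2 * l)"]) simp
      qed
      then have "continuous_map S.mtopology Met_TC.mtopology (\<lambda>\<phi>. \<phi> a)"
        by (subst S.metric_continuous_map[OF Met_TC.Metric_space_axioms]) simp
      then show ?thesis by simp
    qed
    then show ?thesis
      unfolding weak_star_topology_def continuous_map_in_subtopology continuous_map_componentwise
      using states_extensional by auto
  qed
  moreover have "topspace S.mtopology = topspace (weak_star_topology A)"
    by (simp add: topspace_weak_star)
  ultimately show ?thesis
    by (metis topology_eq topology_finer_continuous_id)
qed

theorem quantum_compact_metric_space: "quantum_compact_metric_space A L"
  unfolding quantum_compact_metric_space_def
proof (intro conjI ballI allI)
  show "cstar_algebra A" ..
  show "jordan_lie_subalgebra A (lip_dom A L)" by (rule jordan_lie_subalgebra_lip_dom)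
  show "self_adjoint A \<subseteq> norm_topology A closure_of lip_dom A L" by (rule lip_dom_dense)
  show "L (a \<oplus> b) \<le> L a + L b" if "a \<in> lip_dom A L" "b \<in> lip_dom A L" for a b
    using that by (rule L_add)
  show "L (complex_of_real t \<odot> a) = ennreal \<bar>t\<bar> * L a" if "a \<in> lip_dom A L" for a and t :: real
    using that by (intro L_smult) (simp add: lip_dom_def)
  show "{a \<in> self_adjoint A. L a = 0} = range (\<lambda>t::real. complex_of_real t \<odot> \<one>)" by (rule L_kernel)
  show "max (L (jordan_product A a b)) (L (lie_product A a b))
      \<le> 2 * (ennreal (cnorm A a) * L b + ennreal (cnorm A b) * L a)"
    if "a \<in> lip_dom A L" "b \<in> lip_dom A L" for a b
    using L_jordan_lie(2)[OF that] by simp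
  show "mk_dist A L \<phi> \<psi> < \<infinity>" if "\<phi> \<in> states A" "\<psi> \<in> states A" for \<phi> \<psi>
    using that by (rule mk_dist_finite)
  show "Metric_space (states A) (\<lambda>\<phi> \<psi>. enn2real (mk_dist A L \<phi> \<psi>))"
    using Metric_space_mk unfolding mk_def[abs_def] .
  show "Metric_space.mtopology (states A) (\<lambda>\<phi> \<psi>. enn2real (mk_dist A L \<phi> \<psi>)) = weak_star_topology A"
    using mk_metrizes_weak_star unfolding mk_def[abs_def] .
  show "closedin (subtopology (norm_topology A) (self_adjoint A)) {a \<in> self_adjoint A. L a \<le> r}" for r
    by (rule L_lower_semicontinuous)
qed

end

section \<open>AF algebras with a faithful tracial state\<close>

locale AF_expectations =
  fixes A :: "'u cstar" and \<mu> :: "'u \<Rightarrow> complex"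
    and F :: "nat \<Rightarrow> 'u cstar" and \<alpha> \<iota> E :: "nat \<Rightarrow> 'u \<Rightarrow> 'u"
    and \<beta> :: "nat \<Rightarrow> real"
  assumes cstar_A: "cstar_algebra A"
    and \<mu>: "faithful_tracial_state A \<mu>"
    and cstar_F: "\<And>n. cstar_algebra (F n)"
    and F_finite: "\<And>n. finite_dimensional (F n)"
    and F_0: "star_isomorphic complex_cstar (F 0)"
    and \<alpha>: "\<And>n. star_mono (F n) (F (Suc n)) (\<alpha> n)"
    and limit: "cstar_inductive_limit F \<alpha> A \<iota>"
    and E: "\<And>n. conditional_expectation A (\<iota> n ` carrier (F n)) (E n)"
    and \<mu>_E: "\<And>n a. a \<in> carrier A \<Longrightarrow> \<mu> (E n a) = \<mu> a"
    and \<beta>_pos: "\<And>n. 0 < \<beta> n"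
    and \<beta>_lim: "\<beta> \<longlonglongrightarrow> 0"
begin

sublocale A: cstar_algebra A by (rule cstar_A)

sublocale F: cstar_algebra "F n" for n by (rule cstar_F)

lemma \<iota>_hom: "star_hom (F n) A (\<iota> n)"
  using limit by (simp add: cstar_inductive_limit_def)

lemmas \<iota>_simps = star_hom_simps[OF \<iota>_hom]

lemma \<iota>_linear: "linear_map (F n) A (\<iota> n)"
  using \<iota>_hom by (simp add: star_hom_def)

lemmas \<iota>_minus = linear_map_minus[OF F.complex_module_axioms A.complex_module_axioms \<iota>_linear]

lemma \<alpha>_closed: "x \<in> carrier (F n) \<Longrightarrow> \<alpha> n x \<in> carrier (F (Suc n))"
  using \<alpha>[of n] star_hom_simps(1)[of "F n" "F (Suc n)" "\<alpha> n" x] by (simp add: star_mono_def)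

subsection \<open>The canonical maps are isometric\<close>

lemma cnorm_connecting_map:
  assumes "x \<in> carrier (F n)"
  shows "connecting_map \<alpha> n k x \<in> carrier (F (n + k)) \<and>
    cnorm (F (n + k)) (connecting_map \<alpha> n k x) = cnorm (F n) x"
proof (induction k)
  case (Suc k)
  then show ?case
    using \<alpha>_closed star_mono_isometric[OF cstar_F cstar_F F_finite \<alpha>, of _ "n + k"] by simp
qed (use assms in simp)

lemma cnorm_\<iota>:
  assumes "x \<in> carrier (F n)"
  shows "cnorm A (\<iota> n x) = cnorm (F n) x"
proof -
  have "(\<lambda>k. cnorm (F (n + k)) (connecting_map \<alpha> n k x)) \<longlonglongrightarrow> cnorm A (\<iota> n x)"
    using limit assms by (simp add: cstar_inductive_limit_def)
  then have "(\<lambda>k. cnorm (F n) x) \<longlonglongrightarrow> cnorm A (\<iota> n x)"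
    using cnorm_connecting_map[OF assms] by simp
  then show ?thesis by (metis LIMSEQ_unique tendsto_const)
qed

lemma \<iota>_eqD:
  assumes "x \<in> carrier (F n)" "y \<in> carrier (F n)" "\<iota> n x = \<iota> n y"
  shows "x = y"
proof -
  have "cnorm (F n) (x \<ominus>\<^bsub>F n\<^esub> y) = cnorm A (\<iota> n x \<ominus>\<^bsub>A\<^esub> \<iota> n y)"
    using assms(1,2) by (simp add: cnorm_\<iota>[symmetric] \<iota>_minus)
  also have "\<dots> = 0" using assms by (simp add: A.minus_eq_zero_iff[THEN iffD2] \<iota>_simps(1))
  finally show ?thesis using assms by (simp add: F.cnorm_eq_zero_iff F.minus_eq_zero_iff)
qed

subsection \<open>The finite-dimensional subalgebras\<close>

definition B :: "nat \<Rightarrow> 'u set" where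
  "B n = \<iota> n ` carrier (F n)"

lemma B_carrier: "b \<in> B n \<Longrightarrow> b \<in> carrier A"
  by (auto simp: B_def \<iota>_simps(1))

lemma B_mono: "m \<le> n \<Longrightarrow> B m \<subseteq> B n"
proof (rule lift_Suc_mono_le[of B])
  fix n
  have "\<iota> n x = \<iota> (Suc n) (\<alpha> n x)" if "x \<in> carrier (F n)" for x
    using limit that by (simp add: cstar_inductive_limit_def)
  then show "B n \<subseteq> B (Suc n)" using \<alpha>_closed by (fastforce simp: B_def)
qed

lemma B_one: "\<one>\<^bsub>A\<^esub> \<in> B n"
  unfolding B_def by (rule image_eqI[of _ _ "\<one>\<^bsub>F n\<^esub>"]) (simp_all add: \<iota>_simps(4)[of "\<one>\<^bsub>F n\<^esub>"])

lemma B_mult: "\<lbrakk>b \<in> B n; c \<in> B n\<rbrakk> \<Longrightarrow> b \<otimes>\<^bsub>A\<^esub> c \<in> B n"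
  unfolding B_def by (auto simp: \<iota>_simps(6)[symmetric])

lemma B_minus: "\<lbrakk>b \<in> B n; c \<in> B n\<rbrakk> \<Longrightarrow> b \<ominus>\<^bsub>A\<^esub> c \<in> B n"
  unfolding B_def by (auto simp: \<iota>_minus[symmetric])

lemma B_star: "b \<in> B n \<Longrightarrow> star A b \<in> B n"
  unfolding B_def by (auto simp: \<iota>_simps(3)[symmetric])

lemma B_pow: "b \<in> B n \<Longrightarrow> b [^]\<^bsub>A\<^esub> (k::nat) \<in> B n"
  by (induction k) (simp_all add: B_one B_mult)

lemma B_0: "b \<in> B 0 \<Longrightarrow> \<exists>c. b = c \<odot>\<^bsub>A\<^esub> \<one>\<^bsub>A\<^esub>"
proof -
  assume "b \<in> B 0"
  then obtain x where x: "x \<in> carrier (F 0)" "b = \<iota> 0 x" by (auto simp: B_def)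
  obtain f where f: "star_hom complex_cstar (F 0) f" "bij_betw f UNIV (carrier (F 0))"
    using F_0 by (auto simp: star_isomorphic_def)
  then obtain z where "x = f z" using x(1) by (metis bij_betw_def imageE)
  also have "f z = z \<odot>\<^bsub>F 0\<^esub> f 1"
    using star_hom_simps(2)[OF f(1), of 1 z] by simp
  also have "f 1 = \<one>\<^bsub>F 0\<^esub>"
    using star_hom_simps(4)[OF f(1), of 1] by simp
  finally show ?thesis using x(2) by (auto simp: \<iota>_simps(2) \<iota>_simps(4)[of "\<one>\<^bsub>F 0\<^esub>"])
qed

lemma B_finite_span:
  "\<exists>I v. finite I \<and> v \<in> I \<rightarrow> carrier A \<and> (\<forall>b\<in>B n. \<exists>c. b = A.lincomb (v :: 'u \<Rightarrow> 'u) I c)"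
proof -
  obtain S where S: "finite S" "S \<subseteq> carrier (F n)"
    "\<forall>x\<in>carrier (F n). \<exists>c. x = F.lincomb n (\<lambda>s. s) S c"
    using F_finite[of n] unfolding finite_dimensional_def by (elim exE conjE) (rule that)
  have Sv: "(\<lambda>s. s) \<in> S \<rightarrow> carrier (F n)" using S by auto
  have "\<iota> n \<in> S \<rightarrow> carrier A" using S \<iota>_simps(1) by blast
  moreover have "\<exists>c. b = A.lincomb (\<iota> n) S c" if "b \<in> B n" for b
  proof -
    obtain x where x: "x \<in> carrier (F n)" "b = \<iota> n x" using \<open>b \<in> B n\<close> by (auto simp: B_def)
    from bspec[OF S(3) x(1)] obtain c where c: "x = F.lincomb n (\<lambda>s. s) S c" by (elim exE) (rule that)
    have "b = A.lincomb (\<iota> n) S c"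
      unfolding x(2)
      by (subst c) (rule linear_map_lincomb[OF F.complex_module_axioms A.complex_module_axioms \<iota>_linear S(1) Sv])
    then show ?thesis by (rule exI[of _ c])
  qed
  ultimately have "finite S \<and> \<iota> n \<in> S \<rightarrow> carrier A \<and> (\<forall>b\<in>B n. \<exists>c. b = A.lincomb (\<iota> n) S c)"
    using S(1) by (intro conjI ballI)
  then show ?thesis by (intro exI[of _ S] exI[of _ "\<iota> n"])
qed

subsection \<open>The conditional expectations\<close>

lemma \<mu>_state: "\<mu> \<in> states A"
  and \<mu>_faithful: "a \<in> carrier A \<Longrightarrow> \<mu> (star A a \<otimes>\<^bsub>A\<^esub> a) = 0 \<Longrightarrow> a = \<zero>\<^bsub>A\<^esub>"
  using \<mu> by (auto simp: faithful_tracial_state_def)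

lemmas \<mu>_simps = A.functional_simps[OF A.state_linear[OF \<mu>_state]]

lemma E_linear: "linear_map A A (E n)"
  using E[of n] by (simp add: conditional_expectation_def positive_map_def)

lemma E_in_B: "a \<in> carrier A \<Longrightarrow> E n a \<in> B n"
  using E[of n] unfolding conditional_expectation_def B_def by blast

lemma E_bimodule:
  "\<lbrakk>b \<in> B n; c \<in> B n; a \<in> carrier A\<rbrakk> \<Longrightarrow> E n (b \<otimes>\<^bsub>A\<^esub> a \<otimes>\<^bsub>A\<^esub> c) = b \<otimes>\<^bsub>A\<^esub> E n a \<otimes>\<^bsub>A\<^esub> c"
  using E[of n] unfolding conditional_expectation_def B_def by blast

lemma E_carrier: "a \<in> carrier A \<Longrightarrow> E n a \<in> carrier A"
  by (rule B_carrier[OF E_in_B])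

lemma E_left: "\<lbrakk>b \<in> B n; a \<in> carrier A\<rbrakk> \<Longrightarrow> E n (b \<otimes>\<^bsub>A\<^esub> a) = b \<otimes>\<^bsub>A\<^esub> E n a"
  using E_bimodule[OF _ B_one, of b n a] by (simp add: B_carrier E_carrier)

lemma E_minus: "\<lbrakk>a \<in> carrier A; b \<in> carrier A\<rbrakk> \<Longrightarrow> E n (a \<ominus>\<^bsub>A\<^esub> b) = E n a \<ominus>\<^bsub>A\<^esub> E n b"
  by (rule linear_map_minus[OF A.complex_module_axioms A.complex_module_axioms E_linear])

lemma E_smult: "a \<in> carrier A \<Longrightarrow> E n (c \<odot>\<^bsub>A\<^esub> a) = c \<odot>\<^bsub>A\<^esub> E n a"
  using E_linear[of n] by (simp add: linear_map_def)

lemma E_contractive: "a \<in> carrier A \<Longrightarrow> cnorm A (E n a) \<le> cnorm A a"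
  using E[of n] by (intro map_norm_le_1D[OF cstar_A cstar_A E_linear]) (simp_all add: conditional_expectation_def)

text \<open>
  Elements of a subalgebra are separated by the functionals \<open>x \<mapsto> \<mu>(bx)\<close> with \<open>b\<close> in it. Hence
  invariance of \<open>\<mu>\<close> determines \<open>E\<^sub>n\<close>.
\<close>

lemma B_eqI:
  assumes "x \<in> B n" "y \<in> B n" "\<And>b. b \<in> B n \<Longrightarrow> \<mu> (b \<otimes>\<^bsub>A\<^esub> x) = \<mu> (b \<otimes>\<^bsub>A\<^esub> y)"
  shows "x = y"
proof -
  let ?d = "x \<ominus>\<^bsub>A\<^esub> y"
  have d: "?d \<in> B n" using assms(1,2) by (rule B_minus)
  note c = assms(1,2)[THEN B_carrier] d[THEN B_carrier]
  have "star A ?d \<otimes>\<^bsub>A\<^esub> ?d = star A ?d \<otimes>\<^bsub>A\<^esub> x \<ominus>\<^bsub>A\<^esub> star A ?d \<otimes>\<^bsub>A\<^esub> y"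
    using c by (simp add: A.cstar_simps)
  then have "\<mu> (star A ?d \<otimes>\<^bsub>A\<^esub> ?d) = 0"
    using c assms(3)[OF B_star[OF d]] by (simp add: \<mu>_simps)
  then show ?thesis using \<mu>_faithful[OF c(3)] c by (simp add: A.minus_eq_zero_iff)
qed

text \<open>
  A positive bimodule map of norm 1 onto a subalgebra need not fix it: it multiplies its elements by
  the central element \<open>E\<^sub>n(1)\<close>. Invariance of \<open>\<mu>\<close> forces this factor to be 1.
\<close>

lemma E_one: "E n \<one>\<^bsub>A\<^esub> = \<one>\<^bsub>A\<^esub>"
proof (rule B_eqI)
  fix b assume b: "b \<in> B n"
  then show "\<mu> (b \<otimes>\<^bsub>A\<^esub> E n \<one>\<^bsub>A\<^esub>) = \<mu> (b \<otimes>\<^bsub>A\<^esub> \<one>\<^bsub>A\<^esub>)"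
    using E_left[OF b, of "\<one>\<^bsub>A\<^esub>"] \<mu>_E[of b n] by (simp add: B_carrier)
qed (simp_all add: E_in_B B_one)

lemma E_fixes_B: "b \<in> B n \<Longrightarrow> E n b = b"
  using E_left[of b n "\<one>\<^bsub>A\<^esub>"] by (simp add: E_one B_carrier)

lemma E_tower: "\<lbrakk>n \<le> m; a \<in> carrier A\<rbrakk> \<Longrightarrow> E m (E n a) = E n a"
  using E_in_B[of a n] B_mono[of n m] by (intro E_fixes_B) auto

text \<open>
  For \<open>b\<close> in the smaller algebra, \<open>\<mu>(b E\<^sub>m(E\<^sub>n(a)))\<close> and \<open>\<mu>(b E\<^sub>m(a))\<close> are both equal to \<open>\<mu>(ba)\<close>.
\<close>

lemma E_tower_inner:
  assumes "m \<le> n" "a \<in> carrier A"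
  shows "E m (E n a) = E m a"
proof (rule B_eqI)
  show "E m (E n a) \<in> B m" "E m a \<in> B m" using assms by (simp_all add: E_in_B E_carrier)
  fix b assume b: "b \<in> B m"
  then have bn: "b \<in> B n" using B_mono[OF assms(1)] by auto
  note c = B_carrier[OF b] E_carrier[OF assms(2)] assms(2)
  have "\<mu> (b \<otimes>\<^bsub>A\<^esub> E m (E n a)) = \<mu> (E m (b \<otimes>\<^bsub>A\<^esub> E n a))" using E_left[OF b] c by simp
  also have "\<dots> = \<mu> (E n (b \<otimes>\<^bsub>A\<^esub> a))" using c by (simp add: \<mu>_E E_left[OF bn])
  also have "\<dots> = \<mu> (E m (b \<otimes>\<^bsub>A\<^esub> a))" using c by (simp add: \<mu>_E)
  also have "\<dots> = \<mu> (b \<otimes>\<^bsub>A\<^esub> E m a)" using E_left[OF b] c by simp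
  finally show "\<mu> (b \<otimes>\<^bsub>A\<^esub> E m (E n a)) = \<mu> (b \<otimes>\<^bsub>A\<^esub> E m a)" .
qed

lemma E_square:
  assumes "a \<in> carrier A"
  obtains c where "c \<in> carrier A" "E n (star A a \<otimes>\<^bsub>A\<^esub> a) = star A c \<otimes>\<^bsub>A\<^esub> c"
proof -
  have "star A a \<otimes>\<^bsub>A\<^esub> a \<in> positive_elements A" using assms by (auto simp: positive_elements_def)
  then have "E n (star A a \<otimes>\<^bsub>A\<^esub> a) \<in> positive_elements A"
    using E[of n] unfolding conditional_expectation_def positive_map_def by blast
  then show thesis using that by (auto simp: positive_elements_def)
qed

text \<open>Polarization: \<open>4a = (1 + a)\<^sup>2 - (1 - a)\<^sup>2\<close> is a difference of positive elements.\<close>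

lemma E_self_adjoint:
  assumes a: "a \<in> self_adjoint A"
  shows "E n a \<in> self_adjoint A"
proof -
  have c: "a \<in> carrier A" "star A a = a" using a by (auto simp: self_adjoint_def)
  let ?p = "\<one>\<^bsub>A\<^esub> \<oplus>\<^bsub>A\<^esub> a" and ?m = "\<one>\<^bsub>A\<^esub> \<ominus>\<^bsub>A\<^esub> a"
  have quarters: "a = (1/4) \<odot>\<^bsub>A\<^esub> a \<oplus>\<^bsub>A\<^esub> ((1/4) \<odot>\<^bsub>A\<^esub> a \<oplus>\<^bsub>A\<^esub> ((1/4) \<odot>\<^bsub>A\<^esub> a \<oplus>\<^bsub>A\<^esub> (1/4) \<odot>\<^bsub>A\<^esub> a))"
    using c by (simp add: A.smult_add_left[symmetric])
  have "a = (1/4) \<odot>\<^bsub>A\<^esub> (star A ?p \<otimes>\<^bsub>A\<^esub> ?p \<ominus>\<^bsub>A\<^esub> star A ?m \<otimes>\<^bsub>A\<^esub> ?m)"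
    using c A.smult_cancel[of "(1/4) \<odot>\<^bsub>A\<^esub> \<one>\<^bsub>A\<^esub>"] A.smult_cancel[of "(1/4) \<odot>\<^bsub>A\<^esub> (a \<otimes>\<^bsub>A\<^esub> a)"]
    by (subst quarters) (simp add: A.cstar_simps)
  then have "E n a = E n ((1/4) \<odot>\<^bsub>A\<^esub> (star A ?p \<otimes>\<^bsub>A\<^esub> ?p \<ominus>\<^bsub>A\<^esub> star A ?m \<otimes>\<^bsub>A\<^esub> ?m))"
    by (rule arg_cong)
  also have "\<dots> = (1/4) \<odot>\<^bsub>A\<^esub> (E n (star A ?p \<otimes>\<^bsub>A\<^esub> ?p) \<ominus>\<^bsub>A\<^esub> E n (star A ?m \<otimes>\<^bsub>A\<^esub> ?m))"
    using c by (simp only: E_smult E_minus A.mult_closed A.star_closed A.add_in_carrier A.minus_in_carrier A.one_carrier)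
  finally have "E n a = (1/4) \<odot>\<^bsub>A\<^esub> (E n (star A ?p \<otimes>\<^bsub>A\<^esub> ?p) \<ominus>\<^bsub>A\<^esub> E n (star A ?m \<otimes>\<^bsub>A\<^esub> ?m))" .
  moreover have "?p \<in> carrier A" "?m \<in> carrier A" using c by simp_all
  then obtain x y where "x \<in> carrier A" "E n (star A ?p \<otimes>\<^bsub>A\<^esub> ?p) = star A x \<otimes>\<^bsub>A\<^esub> x"
    "y \<in> carrier A" "E n (star A ?m \<otimes>\<^bsub>A\<^esub> ?m) = star A y \<otimes>\<^bsub>A\<^esub> y"
    by (metis E_square)
  ultimately show ?thesis by (simp add: self_adjoint_def A.cstar_simps)
qed

lemma E_dense:
  assumes a: "a \<in> carrier A" and e: "0 < e"
  shows "\<exists>n. cnorm A (a \<ominus>\<^bsub>A\<^esub> E n a) < e"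
proof -
  interpret D: Metric_space "carrier A" "cstar_dist A" by (rule A.Metric_space_cstar_dist)
  have "a \<in> norm_topology A closure_of (\<Union>n. B n)"
    using limit a unfolding cstar_inductive_limit_def B_def by simp
  moreover have "0 < e / 2" using e by simp
  ultimately have "\<exists>b\<in>\<Union>n. B n. b \<in> D.mball a (e / 2)"
    unfolding norm_topology_def D.metric_closure_of by blast
  then obtain n b where b: "b \<in> B n" "cstar_dist A a b < e / 2" by (auto simp del: mult_2)
  then have bc: "b \<in> carrier A" "cnorm A (a \<ominus>\<^bsub>A\<^esub> b) < e / 2"
    using a by (auto simp: cstar_dist_def B_carrier)
  have "cnorm A (b \<ominus>\<^bsub>A\<^esub> E n a) = cnorm A (E n (b \<ominus>\<^bsub>A\<^esub> a))"
    using a bc by (simp add: E_minus E_fixes_B[OF b(1)])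
  also have "\<dots> \<le> cnorm A (a \<ominus>\<^bsub>A\<^esub> b)"
    using a bc E_contractive[of "b \<ominus>\<^bsub>A\<^esub> a" n] by (simp add: A.cnorm_minus_commute)
  finally have "cnorm A (a \<ominus>\<^bsub>A\<^esub> E n a) < e"
    using A.cnorm_triangle[OF a bc(1) E_carrier[OF a, of n]] bc(2) by simp
  then show ?thesis by (rule exI)
qed

subsection \<open>The two quantum compact metric spaces\<close>

abbreviation L :: "'u \<Rightarrow> ennreal" where
  "L \<equiv> lip_norm A E \<beta>"

sublocale tower: finite_rank_tower A E \<beta> L
proof
  show "\<exists>I v. finite I \<and> v \<in> I \<rightarrow> carrier A \<and>
      (\<forall>a\<in>carrier A. \<exists>c. E n a = A.lincomb (v :: 'u \<Rightarrow> 'u) I c)" for n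
  proof -
    from B_finite_span[of n] obtain I v where I: "finite I" "v \<in> I \<rightarrow> carrier A"
      "\<forall>b\<in>B n. \<exists>c. b = A.lincomb (v :: 'u \<Rightarrow> 'u) I c" by (elim exE conjE) (rule that)
    have "\<exists>c. E n a = A.lincomb v I c" if "a \<in> carrier A" for a
      by (rule bspec[OF I(3) E_in_B[OF that]])
    with I(1,2) show ?thesis by (intro exI[of _ I] exI[of _ v] conjI ballI)
  qed
  show "E n (E n a \<otimes>\<^bsub>A\<^esub> E n b) = E n a \<otimes>\<^bsub>A\<^esub> E n b" if "a \<in> carrier A" "b \<in> carrier A" for n a b
    using that by (intro E_fixes_B B_mult E_in_B)
  show "\<exists>c. E 0 a = c \<odot>\<^bsub>A\<^esub> \<one>\<^bsub>A\<^esub>" if "a \<in> carrier A" for a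
    using that by (intro B_0 E_in_B)
qed (simp_all add: E_linear E_contractive E_self_adjoint E_tower E_one E_dense \<beta>_pos \<beta>_lim)

definition \<iota>_inv :: "nat \<Rightarrow> 'u \<Rightarrow> 'u" where
  "\<iota>_inv n = inv_into (carrier (F n)) (\<iota> n)"

lemma \<iota>_inv: "b \<in> B n \<Longrightarrow> \<iota>_inv n b \<in> carrier (F n)" "b \<in> B n \<Longrightarrow> \<iota> n (\<iota>_inv n b) = b"
  unfolding B_def \<iota>_inv_def by (rule inv_into_into, assumption) (rule f_inv_into_f, assumption)

lemma \<iota>_inv_\<iota>: "x \<in> carrier (F n) \<Longrightarrow> \<iota>_inv n (\<iota> n x) = x"
  by (rule \<iota>_eqD[of _ n]) (auto simp: \<iota>_inv B_def)

definition E_on :: "nat \<Rightarrow> nat \<Rightarrow> 'u \<Rightarrow> 'u" where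
  "E_on n m x = \<iota>_inv n (E m (\<iota> n x))"

text \<open>
  The map \<open>E m\<close> preserves \<open>B n\<close>: its range is contained in \<open>B n\<close> if \<open>m \<le> n\<close>, and it fixes \<open>B n\<close>
  otherwise.
\<close>

lemma E_on:
  assumes "x \<in> carrier (F n)"
  shows "E_on n m x \<in> carrier (F n)" "\<iota> n (E_on n m x) = E m (\<iota> n x)"
proof -
  have x: "\<iota> n x \<in> B n" using assms by (simp add: B_def)
  have "E m (\<iota> n x) \<in> B n"
  proof (cases "m \<le> n")
    case True
    then show ?thesis using B_mono[OF True] E_in_B[OF B_carrier[OF x], of m] by auto
  next
    case False
    then have "\<iota> n x \<in> B m" using B_mono[of n m] x by auto
    then show ?thesis using x by (simp add: E_fixes_B)
  qed
  then show "E_on n m x \<in> carrier (F n)" "\<iota> n (E_on n m x) = E m (\<iota> n x)"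
    by (simp_all add: E_on_def \<iota>_inv)
qed

text \<open>Every axiom is pulled back along the isometric embedding \<open>\<iota> n\<close>, which intertwines \<open>E_on n m\<close> and \<open>E m\<close>.\<close>

lemma finite_rank_tower_F: "finite_rank_tower (F n) (E_on n) \<beta> (L \<circ> \<iota> n)"
proof
  fix m
  note closed = E_on(1)[of _ n] and comm = E_on(2)[of _ n]
  show "linear_map (F n) (F n) (E_on n m)"
    unfolding linear_map_def
  proof (intro conjI ballI allI funcsetI)
    fix x assume x: "x \<in> carrier (F n)"
    then show "E_on n m x \<in> carrier (F n)" by (rule closed)
    show "E_on n m (c \<odot>\<^bsub>F n\<^esub> x) = c \<odot>\<^bsub>F n\<^esub> E_on n m x" for c
      by (rule \<iota>_eqD[of _ n]) (use x in \<open>simp_all add: closed comm \<iota>_simps tower.E_smult\<close>)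
    fix y assume y: "y \<in> carrier (F n)"
    show "E_on n m (x \<oplus>\<^bsub>F n\<^esub> y) = E_on n m x \<oplus>\<^bsub>F n\<^esub> E_on n m y"
      by (rule \<iota>_eqD[of _ n]) (use x y in \<open>simp_all add: closed comm \<iota>_simps tower.E_add\<close>)
  qed
  fix x assume x: "x \<in> carrier (F n)"
  note ix = \<iota>_simps(1)[OF x]
  show "cnorm (F n) (E_on n m x) \<le> cnorm (F n) x"
    using E_contractive[OF ix, of m] x by (simp add: cnorm_\<iota>[symmetric] closed comm)
  show "E_on n m (E_on n k x) = E_on n k x" if "k \<le> m" for k
    by (rule \<iota>_eqD[of _ n]) (use x that in \<open>simp_all add: closed comm E_tower ix\<close>)
  show "E_on n m (E_on n m x \<otimes>\<^bsub>F n\<^esub> E_on n m y) = E_on n m x \<otimes>\<^bsub>F n\<^esub> E_on n m y"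
    if y: "y \<in> carrier (F n)" for y
    by (rule \<iota>_eqD[of _ n]) (use x y in \<open>simp_all add: closed comm \<iota>_simps tower.E_mult\<close>)
  show "\<exists>c. E_on n 0 x = c \<odot>\<^bsub>F n\<^esub> \<one>\<^bsub>F n\<^esub>"
  proof -
    obtain c where c: "E 0 (\<iota> n x) = c \<odot>\<^bsub>A\<^esub> \<one>\<^bsub>A\<^esub>" using B_0[OF E_in_B[OF ix]] by blast
    have "E_on n 0 x = c \<odot>\<^bsub>F n\<^esub> \<one>\<^bsub>F n\<^esub>"
      by (rule \<iota>_eqD[of _ n]) (use x in \<open>simp_all add: closed comm c \<iota>_simps(2) \<iota>_simps(4)[OF x]\<close>)
    then show ?thesis by (rule exI)
  qed
  show "\<exists>m. cnorm (F n) (x \<ominus>\<^bsub>F n\<^esub> E_on n m x) < e" if "0 < e" for e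
  proof -
    have "E_on n n x = x"
      by (rule \<iota>_eqD[of _ n]) (use x E_fixes_B[of "\<iota> n x" n] in \<open>simp_all add: closed comm B_def\<close>)
    then show ?thesis using x that by (intro exI[of _ n]) (simp add: F.minus_eq_zero_iff[THEN iffD2])
  qed
next
  fix m and x assume "x \<in> self_adjoint (F n)"
  then have x: "x \<in> carrier (F n)" "star (F n) x = x" by (auto simp: self_adjoint_def)
  have "\<iota> n x \<in> self_adjoint A"
    using x \<iota>_simps(3)[OF x(1)] by (simp add: self_adjoint_def \<iota>_simps(1))
  then have Ex: "star A (E m (\<iota> n x)) = E m (\<iota> n x)"
    using E_self_adjoint by (auto simp: self_adjoint_def)
  have "star (F n) (E_on n m x) = E_on n m x"
    by (rule \<iota>_eqD[of _ n]) (use x Ex in \<open>simp_all add: E_on \<iota>_simps(3)\<close>)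
  then show "E_on n m x \<in> self_adjoint (F n)" using x by (simp add: self_adjoint_def E_on)
  have "cnorm A (\<iota> n x \<ominus>\<^bsub>A\<^esub> E k (\<iota> n x)) = cnorm (F n) (x \<ominus>\<^bsub>F n\<^esub> E_on n k x)" for k
    using x by (simp add: cnorm_\<iota>[symmetric] \<iota>_minus E_on)
  then show "(L \<circ> \<iota> n) x = lip_norm (F n) (E_on n) \<beta> x" by (simp add: lip_norm_def)
next
  fix m
  show "E_on n m \<one>\<^bsub>F n\<^esub> = \<one>\<^bsub>F n\<^esub>"
    by (rule \<iota>_eqD[of _ n]) (simp_all add: E_on \<iota>_simps(4)[of "\<one>\<^bsub>F n\<^esub>"] E_one)
  obtain S where S: "finite S" "S \<subseteq> carrier (F n)"
    "\<forall>x\<in>carrier (F n). \<exists>c. x = F.lincomb n (\<lambda>s. s) S c"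
    using F_finite[of n] unfolding finite_dimensional_def by (elim exE conjE) (rule that)
  show "\<exists>I v. finite I \<and> v \<in> I \<rightarrow> carrier (F n) \<and>
      (\<forall>x\<in>carrier (F n). \<exists>c. E_on n m x = F.lincomb n (v :: 'u \<Rightarrow> 'u) I c)"
  proof (rule exI[of _ S], rule exI[of _ "\<lambda>s. s"], intro conjI ballI)
    show "finite S" "(\<lambda>s. s) \<in> S \<rightarrow> carrier (F n)" using S by auto
    show "\<exists>c. E_on n m x = F.lincomb n (\<lambda>s. s) S c" if "x \<in> carrier (F n)" for x
      by (rule bspec[OF S(3) E_on(1)[OF that]])
  qed
qed (simp_all add: \<beta>_pos \<beta>_lim)

lemma qcms_A: "(A, L) \<in> qcms"
  using tower.quantum_compact_metric_space by (simp add: qcms_def)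

lemma qcms_F: "(F n, L \<circ> \<iota> n) \<in> qcms"
  using finite_rank_tower.quantum_compact_metric_space[OF finite_rank_tower_F] by (simp add: qcms_def)

end

section \<open>The propinquity estimate\<close>

lemma hausdorff_distance_self:
  assumes "\<And>s. s \<in> S \<Longrightarrow> d s s = 0"
  shows "hausdorff_distance d S S = 0"
proof -
  have "(SUP s\<in>S. INF t\<in>S. d s t) \<le> 0" "(SUP t\<in>S. INF s\<in>S. d s t) \<le> 0"
    by (intro SUP_least INF_lower2, assumption, simp add: assms)+
  then show ?thesis by (simp add: hausdorff_distance_def)
qed

lemma mk_dist_self: "mk_dist A L \<phi> \<phi> = 0"
proof -
  have "mk_dist A L \<phi> \<phi> \<le> 0" unfolding mk_dist_def by (rule SUP_least) simp
  then show ?thesis by simp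
qed

context AF_expectations
begin

text \<open>
  An element of \<open>F n\<close> that is of the form \<open>c\<^sup>*c\<close> in \<open>A\<close> is not given as a square in \<open>F n\<close>, so positivity
  of \<open>\<psi>\<close> does not apply directly. But if \<open>\<parallel>c\<parallel> \<le> 1\<close> then \<open>|\<psi>(1 - c\<^sup>*c)| \<le> \<parallel>1 - c\<^sup>*c\<parallel> \<le> 1 = \<psi>(1)\<close>,
  which forces the real number \<open>\<psi>(c\<^sup>*c)\<close> to be nonnegative.
\<close>

lemma state_of_square_nonneg:
  assumes \<psi>: "\<psi> \<in> states (F n)" and c: "c \<in> carrier A" and cB: "star A c \<otimes>\<^bsub>A\<^esub> c \<in> B n"
  shows "\<psi> (\<iota>_inv n (star A c \<otimes>\<^bsub>A\<^esub> c)) \<in> \<real>" "0 \<le> Re (\<psi> (\<iota>_inv n (star A c \<otimes>\<^bsub>A\<^esub> c)))"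
proof -
  let ?h = "\<iota>_inv n (star A c \<otimes>\<^bsub>A\<^esub> c)"
  note lin = F.functional_simps[OF F.state_linear[OF \<psi>]]
  have h: "?h \<in> carrier (F n)" and \<iota>h: "\<iota> n ?h = star A c \<otimes>\<^bsub>A\<^esub> c" using \<iota>_inv[OF cB] by auto
  have "star (F n) ?h = ?h"
    by (rule \<iota>_eqD[of _ n]) (use h c in \<open>simp_all add: \<iota>_simps(3) \<iota>h A.star_mult\<close>)
  then have "?h \<in> self_adjoint (F n)" using h by (simp add: self_adjoint_def)
  then show real: "\<psi> ?h \<in> \<real>" by (rule F.positive_functional_real[OF F.state_positive[OF \<psi>]])
  \<comment> \<open>rescale \<open>c\<close> to a contraction; the summand 1 allows \<open>c = 0\<close>\<close>
  define t where "t = 1 / (cnorm A c + 1)"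
  have t: "0 < t" "t * cnorm A c \<le> 1" using A.cnorm_nonneg[OF c] by (simp_all add: t_def)
  define c' where "c' = complex_of_real t \<odot>\<^bsub>A\<^esub> c"
  have c': "c' \<in> carrier A" "cnorm A c' \<le> 1" using c t by (simp_all add: c'_def A.cnorm_smult)
  have sq: "star A c' \<otimes>\<^bsub>A\<^esub> c' = complex_of_real (t * t) \<odot>\<^bsub>A\<^esub> (star A c \<otimes>\<^bsub>A\<^esub> c)"
    using c by (simp add: c'_def A.cstar_simps)
  define k where "k = \<one>\<^bsub>F n\<^esub> \<ominus>\<^bsub>F n\<^esub> complex_of_real (t * t) \<odot>\<^bsub>F n\<^esub> ?h"
  have k: "k \<in> carrier (F n)" using h by (simp add: k_def)
  have \<iota>k: "\<iota> n k = \<one>\<^bsub>A\<^esub> \<ominus>\<^bsub>A\<^esub> star A c' \<otimes>\<^bsub>A\<^esub> c'"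
    using h by (simp add: k_def \<iota>_minus \<iota>_simps(2) \<iota>_simps(4)[OF h] \<iota>h sq)
  have "cnorm A (\<one>\<^bsub>A\<^esub> \<ominus>\<^bsub>A\<^esub> star A c' \<otimes>\<^bsub>A\<^esub> c') \<le> 1"
  proof -
    from B_finite_span[of n] obtain I v where I: "finite I" "v \<in> I \<rightarrow> carrier A"
      "\<forall>b\<in>B n. \<exists>d. b = A.lincomb (v :: 'u \<Rightarrow> 'u) I d" by (elim exE conjE) (rule that)
    have "\<one>\<^bsub>A\<^esub> \<ominus>\<^bsub>A\<^esub> star A c' \<otimes>\<^bsub>A\<^esub> c' \<in> B n"
      using k unfolding \<iota>k[symmetric] B_def by blast
    from bspec[OF I(3) B_pow[OF this]]
    have "\<exists>d. (\<one>\<^bsub>A\<^esub> \<ominus>\<^bsub>A\<^esub> star A c' \<otimes>\<^bsub>A\<^esub> c') [^]\<^bsub>A\<^esub> (m::nat) = A.lincomb v I d" for m .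
    then show ?thesis
      by (intro A.cnorm_one_minus_square_le_1[OF \<mu>_state \<mu>_faithful c' I(1,2)])
  qed
  then have "cmod (\<psi> k) \<le> 1"
    using F.state_le_cnorm[OF \<psi> k] k by (simp add: cnorm_\<iota>[symmetric] \<iota>k)
  moreover have "\<psi> k = 1 - complex_of_real (t * t) * \<psi> ?h"
    using h by (simp add: k_def lin F.state_one[OF \<psi>])
  ultimately have "0 \<le> (t * t) * Re (\<psi> ?h)"
    using complex_Re_le_cmod[of "\<psi> k"] by simp
  then show "0 \<le> Re (\<psi> ?h)" using t(1) by (meson mult_pos_neg mult_pos_pos not_le)
qed

text \<open>The extension is \<open>\<psi> \<circ> \<iota>\<^sub>n\<^sup>-\<^sup>1 \<circ> E\<^sub>n\<close>; it is positive because \<open>E\<^sub>n\<close> maps squares to squares.\<close>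

lemma state_extends:
  assumes \<psi>: "\<psi> \<in> states (F n)"
  shows "\<exists>\<phi>\<in>states A. \<psi> = compose (carrier (F n)) \<phi> (\<iota> n)"
proof
  let ?\<phi> = "restrict (\<lambda>a. \<psi> (\<iota>_inv n (E n a))) (carrier A)"
  note lin = F.functional_simps[OF F.state_linear[OF \<psi>]]
  have \<iota>_inv_add: "\<iota>_inv n (E n (a \<oplus>\<^bsub>A\<^esub> b)) = \<iota>_inv n (E n a) \<oplus>\<^bsub>F n\<^esub> \<iota>_inv n (E n b)"
    if "a \<in> carrier A" "b \<in> carrier A" for a b
    by (rule \<iota>_eqD[of _ n]) (use that in \<open>simp_all add: \<iota>_inv E_in_B \<iota>_simps tower.E_add[symmetric]\<close>)
  have \<iota>_inv_smult: "\<iota>_inv n (E n (c \<odot>\<^bsub>A\<^esub> a)) = c \<odot>\<^bsub>F n\<^esub> \<iota>_inv n (E n a)" if "a \<in> carrier A" for a c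
    by (rule \<iota>_eqD[of _ n]) (use that in \<open>simp_all add: \<iota>_inv E_in_B \<iota>_simps E_smult[symmetric]\<close>)
  show "?\<phi> \<in> states A"
  proof (rule A.stateI)
    have "linear_map A complex_cstar ?\<phi>"
      unfolding linear_map_def using \<iota>_inv_add \<iota>_inv_smult by (auto simp: lin \<iota>_inv E_in_B)
    moreover have "?\<phi> (star A b \<otimes>\<^bsub>A\<^esub> b) \<in> positive_elements complex_cstar" if b: "b \<in> carrier A" for b
    proof -
      obtain c where c: "c \<in> carrier A" "E n (star A b \<otimes>\<^bsub>A\<^esub> b) = star A c \<otimes>\<^bsub>A\<^esub> c"
        using E_square[OF b] .
      have "star A c \<otimes>\<^bsub>A\<^esub> c \<in> B n" unfolding c(2)[symmetric] using b by (intro E_in_B) simp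
      from state_of_square_nonneg[OF \<psi> c(1) this] show ?thesis
        using b by (simp add: c(2) positive_elements_complex)
    qed
    ultimately show "positive_map A complex_cstar ?\<phi>"
      unfolding positive_map_def by (auto simp: positive_elements_def[of A])
    fix a assume a: "a \<in> carrier A"
    have "cmod (\<psi> (\<iota>_inv n (E n a))) \<le> cnorm (F n) (\<iota>_inv n (E n a))"
      using a by (intro F.state_le_cnorm[OF \<psi>] \<iota>_inv E_in_B)
    also have "\<dots> = cnorm A (E n a)" using a by (simp add: cnorm_\<iota>[symmetric] \<iota>_inv E_in_B)
    also have "\<dots> \<le> cnorm A a" using a by (rule E_contractive)
    finally show "cmod (?\<phi> a) \<le> cnorm A a" using a by simp
  next
    have "\<iota>_inv n \<one>\<^bsub>A\<^esub> = \<one>\<^bsub>F n\<^esub>"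
      using \<iota>_inv_\<iota>[of "\<one>\<^bsub>F n\<^esub>" n] by (simp add: \<iota>_simps(4)[of "\<one>\<^bsub>F n\<^esub>"])
    then show "?\<phi> \<one>\<^bsub>A\<^esub> = 1" by (simp add: E_one F.state_one[OF \<psi>])
  qed simp
  show "\<psi> = compose (carrier (F n)) ?\<phi> (\<iota> n)"
  proof (rule extensionalityI[of _ "carrier (F n)"])
    show "\<psi> \<in> extensional (carrier (F n))" using \<psi> by (simp add: states_def)
    fix x assume x: "x \<in> carrier (F n)"
    then have "E n (\<iota> n x) = \<iota> n x" by (intro E_fixes_B) (simp add: B_def)
    then show "\<psi> x = compose (carrier (F n)) ?\<phi> (\<iota> n) x"
      using x by (simp add: compose_def \<iota>_simps(1) \<iota>_inv_\<iota>)
  qed simp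
qed

lemma state_restricts:
  assumes \<phi>: "\<phi> \<in> states A"
  shows "compose (carrier (F n)) \<phi> (\<iota> n) \<in> states (F n)" (is "?\<psi> \<in> _")
proof (rule F.stateI)
  note lin = A.functional_simps[OF A.state_linear[OF \<phi>]]
  have "linear_map (F n) complex_cstar ?\<psi>"
    unfolding linear_map_def by (auto simp: compose_def \<iota>_simps lin)
  moreover have "?\<psi> (star (F n) x \<otimes>\<^bsub>F n\<^esub> x) \<in> positive_elements complex_cstar" if "x \<in> carrier (F n)" for x
    using A.positive_functional_square[OF A.state_positive[OF \<phi>], of "\<iota> n x"] that
    by (simp add: compose_def \<iota>_simps positive_elements_complex)
  ultimately show "positive_map (F n) complex_cstar ?\<psi>"
    unfolding positive_map_def by (auto simp: positive_elements_def[of "F n"])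
  show "cmod (?\<psi> x) \<le> cnorm (F n) x" if "x \<in> carrier (F n)" for x
    using A.state_le_cnorm[OF \<phi>, of "\<iota> n x"] that by (simp add: compose_def \<iota>_simps(1) cnorm_\<iota>)
  show "?\<psi> \<one>\<^bsub>F n\<^esub> = 1"
    by (simp add: compose_def \<iota>_simps(4)[of "\<one>\<^bsub>F n\<^esub>"] A.state_one[OF \<phi>])
qed simp

lemma one_level_states_one: "one_level_states A \<one>\<^bsub>A\<^esub> = states A"
proof -
  have "\<phi> \<zero>\<^bsub>A\<^esub> = 0" if "\<phi> \<in> states A" for \<phi>
    using linear_map_zero[OF A.complex_module_axioms complex_module_complex A.state_linear[OF that]] by simp
  then show ?thesis by (auto simp: one_level_states_def A.minus_eq_zero_iff[THEN iffD2])
qed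

lemma bridge_\<iota>: "bridge (F n) A A (\<iota> n) (\<lambda>a. a) \<one>\<^bsub>A\<^esub>"
proof -
  have "star_mono (F n) A (\<iota> n)" using \<iota>_hom \<iota>_eqD by (auto simp: star_mono_def inj_on_def)
  moreover have "star_mono A A (\<lambda>a. a)"
    by (auto simp: star_mono_def star_hom_def ring_hom_def linear_map_def)
  ultimately show ?thesis
    using cstar_A \<mu>_state by (auto simp: bridge_def one_level_states_one)
qed

lemma height_\<iota>: "bridge_height (F n) (L \<circ> \<iota> n) A L A (\<iota> n) (\<lambda>a. a) \<one>\<^bsub>A\<^esub> = 0"
proof -
  have "(\<lambda>\<phi>. compose (carrier (F n)) \<phi> (\<iota> n)) ` states A = states (F n)"
    using state_restricts state_extends by (auto simp: image_iff)
  moreover have "compose (carrier A) \<phi> (\<lambda>a. a) = \<phi>" if "\<phi> \<in> states A" for \<phi>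
    using that tower.states_extensional by (auto simp: compose_def fun_eq_iff extensional_def)
  then have "(\<lambda>\<phi>. compose (carrier A) \<phi> (\<lambda>a. a)) ` states A = states A" by simp
  ultimately show ?thesis
    by (simp add: bridge_height_def one_level_states_one hausdorff_distance_self mk_dist_self)
qed

text \<open>For \<open>m < n\<close> one has \<open>E\<^sub>n(b) - E\<^sub>m(E\<^sub>n(b)) = E\<^sub>n(b - E\<^sub>m(b))\<close>, since \<open>E\<^sub>m E\<^sub>n = E\<^sub>m = E\<^sub>n E\<^sub>m\<close>.\<close>

lemma defect_E_le:
  assumes b: "b \<in> carrier A"
  shows "tower.defect m (E n b) \<le> tower.defect m b"
proof (cases "n \<le> m")
  case True
  then show ?thesis using tower.defect_E[OF True b] tower.defect_nonneg[OF b] by simp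
next
  case False
  have "E n b \<ominus>\<^bsub>A\<^esub> E m (E n b) = E n (b \<ominus>\<^bsub>A\<^esub> E m b)"
    using False b by (simp add: E_tower_inner E_minus E_tower)
  then show ?thesis using E_contractive[of "b \<ominus>\<^bsub>A\<^esub> E m b" n] b by (simp add: tower.defect_def)
qed

text \<open>
  An element \<open>x\<close> of the Lip-ball of \<open>F n\<close> is matched with \<open>\<iota>\<^sub>n(x)\<close>, at distance 0, and an element \<open>b\<close>
  of the Lip-ball of \<open>A\<close> with \<open>E\<^sub>n(b)\<close>, at distance \<open>\<parallel>b - E\<^sub>n(b)\<parallel> \<le> \<beta>(n)\<close>.
\<close>

lemma reach_\<iota>: "bridge_reach (F n) (L \<circ> \<iota> n) A L A (\<iota> n) (\<lambda>a. a) \<one>\<^bsub>A\<^esub> \<le> ennreal (\<beta> n)"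
  unfolding bridge_reach_def hausdorff_distance_def
proof (intro max.boundedI SUP_least)
  fix x assume "x \<in> lip_ball (F n) (L \<circ> \<iota> n)"
  then have x: "x \<in> carrier (F n)" "star (F n) x = x" "L (\<iota> n x) \<le> 1"
    by (auto simp: lip_ball_def self_adjoint_def)
  have "\<iota> n x \<in> lip_ball A L"
    using x \<iota>_simps(3)[OF x(1)] by (simp add: lip_ball_def self_adjoint_def \<iota>_simps(1))
  then show "(INF b\<in>lip_ball A L. ennreal (cnorm A (\<iota> n x \<otimes>\<^bsub>A\<^esub> \<one>\<^bsub>A\<^esub> \<ominus>\<^bsub>A\<^esub> \<one>\<^bsub>A\<^esub> \<otimes>\<^bsub>A\<^esub> b))) \<le> ennreal (\<beta> n)"
    by (rule INF_lower2) (use x in \<open>simp add: \<iota>_simps(1) A.minus_eq_zero_iff[THEN iffD2]\<close>)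
next
  fix b assume "b \<in> lip_ball A L"
  then have b: "b \<in> self_adjoint A" "tower.defect m b \<le> \<beta> m" for m
    using tower.lip_ball_defect by blast+
  then have bc: "b \<in> carrier A" by (simp add: self_adjoint_def)
  let ?x = "\<iota>_inv n (E n b)"
  have x: "?x \<in> carrier (F n)" "\<iota> n ?x = E n b" using \<iota>_inv[OF E_in_B[OF bc]] by auto
  have Eb: "E n b \<in> self_adjoint A" using b(1) by (rule E_self_adjoint)
  have "star (F n) ?x = ?x"
    by (rule \<iota>_eqD[of _ n]) (use x Eb in \<open>simp_all add: \<iota>_simps(3) self_adjoint_def\<close>)
  moreover have "L (E n b) \<le> ennreal 1"
    using tower.L_le_iff[OF Eb, of 1] order_trans[OF defect_E_le[OF bc] b(2)] by simp
  ultimately have "?x \<in> lip_ball (F n) (L \<circ> \<iota> n)"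
    using x by (simp add: lip_ball_def self_adjoint_def)
  then show "(INF x\<in>lip_ball (F n) (L \<circ> \<iota> n). ennreal (cnorm A (\<iota> n x \<otimes>\<^bsub>A\<^esub> \<one>\<^bsub>A\<^esub> \<ominus>\<^bsub>A\<^esub> \<one>\<^bsub>A\<^esub> \<otimes>\<^bsub>A\<^esub> b))) \<le> ennreal (\<beta> n)"
  proof (rule INF_lower2)
    show "ennreal (cnorm A (\<iota> n ?x \<otimes>\<^bsub>A\<^esub> \<one>\<^bsub>A\<^esub> \<ominus>\<^bsub>A\<^esub> \<one>\<^bsub>A\<^esub> \<otimes>\<^bsub>A\<^esub> b)) \<le> ennreal (\<beta> n)"
      using b(2)[of n] bc x E_carrier[OF bc, of n]
      by (simp add: tower.defect_def A.cnorm_minus_commute ennreal_leI)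
  qed
qed

lemma propinquity_le: "propinquity (F n, L \<circ> \<iota> n) (A, L) \<le> ennreal (\<beta> n)"
proof -
  have "propinquity (F n, L \<circ> \<iota> n) (A, L)
      \<le> bridge_length (F n) (L \<circ> \<iota> n) A L A (\<iota> n) (\<lambda>a. a) \<one>\<^bsub>A\<^esub>"
    by (rule propinquity_le_bridge_length[OF qcms_F qcms_A bridge_\<iota>])
  also have "\<dots> \<le> ennreal (\<beta> n)"
    unfolding bridge_length_def using reach_\<iota> by (simp add: height_\<iota>)
  finally show ?thesis .
qed

end

theorem theorem3p5:
  fixes A :: "'u cstar" and \<mu> :: "'u \<Rightarrow> complex"
    and F :: "nat \<Rightarrow> 'u cstar" and \<alpha> \<iota> E :: "nat \<Rightarrow> 'u \<Rightarrow> 'u"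
    and \<beta> :: "nat \<Rightarrow> real"
  assumes "cstar_algebra A"
    and "faithful_tracial_state A \<mu>"
    and "\<And>n. cstar_algebra (F n)"
    and "\<And>n. finite_dimensional (F n)"
    and "star_isomorphic complex_cstar (F 0)"
    and "\<And>n. star_mono (F n) (F (Suc n)) (\<alpha> n)"
    and "cstar_inductive_limit F \<alpha> A \<iota>"
    and "\<And>n. conditional_expectation A (\<iota> n ` carrier (F n)) (E n)"
    and "\<And>n a. a \<in> carrier A \<Longrightarrow> \<mu> (E n a) = \<mu> a"
    and "\<And>n. 0 < \<beta> n"
    and "\<beta> \<longlonglongrightarrow> 0"
  shows "quantum_compact_metric_space A (lip_norm A E \<beta>) \<and>
    (\<forall>n. propinquity (F n, lip_norm A E \<beta> \<circ> \<iota> n) (A, lip_norm A E \<beta>) \<le> ennreal (\<beta> n)) \<and>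
    (\<lambda>n. propinquity (F n, lip_norm A E \<beta> \<circ> \<iota> n) (A, lip_norm A E \<beta>)) \<longlonglongrightarrow> 0"
proof (intro conjI allI)
  interpret AF_expectations A \<mu> F \<alpha> \<iota> E \<beta> by (rule AF_expectations.intro) (fact assms)+
  show "quantum_compact_metric_space A (lip_norm A E \<beta>)"
    by (rule tower.quantum_compact_metric_space)
  show "propinquity (F n, lip_norm A E \<beta> \<circ> \<iota> n) (A, lip_norm A E \<beta>) \<le> ennreal (\<beta> n)" for n
    by (rule propinquity_le)
  show "(\<lambda>n. propinquity (F n, lip_norm A E \<beta> \<circ> \<iota> n) (A, lip_norm A E \<beta>)) \<longlonglongrightarrow> 0"
  proof (rule tendsto_sandwich[OF _ _ tendsto_const])
    show "(\<lambda>n. ennreal (\<beta> n)) \<longlonglongrightarrow> 0" using tendsto_ennrealI[OF \<beta>_lim] by simp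
  qed (simp_all add: propinquity_le)
qed

end
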